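(* Let $\Gamma$ be a finite subgroup of $\mathrm{SO}(4)$ and suppose that a $\Gamma$-equivariant system $\dot x=f(x)$ in $\mathbb R^4$ possesses a heteroclinic network that is simple and maximal. Regard the network as a directed multigraph whose vertices are the $\Gamma$-orbits of its equilibria and whose arrows are the $\Gamma$-orbits of its connections. Then, up to relabelling of the vertices: (i) If $\Gamma$ has exactly two group orbits of isotropy semiaxes, then the network has two equilibria $\xi_1,\xi_2$, with two connections $\xi_1\to\xi_2$ and one connection $\xi_2\to\xi_1$. (ii) If the graph associated with $\Gamma$ is of type III, then the network has four equilibria and the connections $\xi_1\to\xi_2$, $\xi_2\to\xi_3$, $\xi_3\to\xi_1$, $\xi_3\to\xi_4$, $\xi_4\to\xi_1$, $\xi_4\to\xi_2$. (iii) If the graph associated with $\Gamma$ is of type IV, then the network is one of three networks, which are distinguished by the number (zero, one or two) of pairs of equilibria forming cycles that consist of two equilibria: there are connections $\xi_1\to\xi_3$ and $\xi_4\to\xi_2$; the two connections between $\xi_1$ and $\xi_2$ are either both $\xi_2\to\xi_1$ or one in each direction; and the two connections between $\xi_3$ and $\xi_4$ are either both $\xi_3\to\xi_4$ or one in each direction. (iv) If the graph associated with $\Gamma$ is of type V, then the network is one of the following three: - the cycle $\xi_1\to\xi_2\to\xi_3\to\xi_4\to\xi_5\to\xi_6\to\xi_1$ together with $\xi_1\to\xi_4$, $\xi_2\to\xi_5$, $\xi_3\to\xi_6$; - the cycle $\xi_1\to\xi_2\to\xi_3\to\xi_4\to\xi_5\to\xi_6\to\xi_1$ together with $\xi_1\to\xi_4$,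 $\xi_3\to\xi_6$, $\xi_5\to\xi_2$; - the network without a cycle through all six equilibria, which is the union of four cycles with four equilibria each: with equilibria $a_1,a_2,a_3,b_1,b_2,b_3$, the connections are $a_1\to b_1$, $a_2\to b_1$, $b_1\to a_3$, $a_3\to b_2$, $a_3\to b_3$, $b_2\to a_1$, $b_2\to a_2$, $b_3\to a_1$, $b_3\to a_2$. (v) If the graph associated with $\Gamma$ is of type VI, then the network is one of eight networks with connections $\xi_1\to\xi_4$, $\xi_2\to\xi_5$, $\xi_6\to\xi_3$, where the connections between $\xi_1,\xi_2,\xi_3$ are one of (a) $\xi_1\to\xi_2,\ \xi_2\to\xi_3,\ \xi_3\to\xi_1$; (b) $\xi_1\to\xi_2,\ \xi_3\to\xi_2,\ \xi_3\to\xi_1$; (c) $\xi_2\to\xi_1,\ \xi_3\to\xi_2,\ \xi_3\to\xi_1$; (d) $\xi_2\to\xi_1,\ \xi_3\to\xi_2,\ \xi_1\to\xi_3$; and the connections between $\xi_4,\xi_5,\xi_6$ are one of (a$'$) $\xi_4\to\xi_5,\ \xi_5\to\xi_6,\ \xi_6\to\xi_4$; (b$'$) $\xi_4\to\xi_5,\ \xi_5\to\xi_6,\ \xi_4\to\xi_6$; (c$'$) $\xi_5\to\xi_4,\ \xi_5\to\xi_6,\ \xi_4\to\xi_6$; (d$'$) $\xi_5\to\xi_4,\ \xi_6\to\xi_5,\ \xi_4\to\xi_6$; the $16$ combinations being identified in pairs by the relabelling $(\xi_1,\xi_2,\xi_3,\xi_4,\xi_5,\xi_6)\mapsto(\xi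_2,\xi_1,\xi_3,\xi_5,\xi_4,\xi_6)$.
   Context: Isotropy notions and graph. For finite $\Gamma\subset\mathrm O(4)$, an isotropy plane (axis) is a 2-dimensional (1-dimensional) fixed-point subspace of an isotropy subgroup; an isotropy semiaxis is a connected component of $\tilde L\setminus\{0\}$, $\tilde L$ an isotropy axis. The graph associated with $\Gamma$ has a vertex for each $\Gamma$-orbit of isotropy semiaxes and a line for each $\Gamma$-orbit of isotropy planes; a vertex lies on a line iff for some representatives the semiaxis is contained in the plane. Graph types: III is the complete graph $K_4$; IV has vertices $v_1,\dots,v_4$ with two edges $v_1v_2$, two edges $v_3v_4$, one edge $v_1v_3$ and one edge $v_2v_4$; V is the hexagon with its three long diagonals ($K_{3,3}$); VI is the triangular prism (triangles $v_1v_2v_3$ and $v_4v_5v_6$ and edges $v_jv_{j+3}$). Heteroclinic cycles. For a smooth $\Gamma$-equivariant $f$, a heteroclinic cycle consists of hyperbolic equilibria $\xi_1,\dots,\xi_M$ and connecting trajectories $\kappa_j\subset W^u(\xi_j)\cap W^s(\xi_{j+1})$, with $\xi_{M+1}=\xi_1$ (equilibria and connections being considered up to the action of $\Gamma$). It is robust if for every $j$ there is a subgroup $\Sigma_j\subset\Gamma$ such that $\kappa_j\subset P_j:=\mathrm{Fix}(\Sigma_j)$ and $\xi_{j+1}$ is a sink in $P_j$. A robust cycle in $\mathbb R^4$ is simple if: $\dim P_j=2$ for all $j$; the cycle intersects each connected component of $(P_{j-1}\cap P_j)\setminus\{0\}$ at most once (then $P_{j-1}\cap P_j=\mathrm{Fix}(\Delta_j)$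 is an isotropy axis); and for all $j$ the isotypic decomposition of $\mathbb R^4$ with respect to $\Delta_j$ consists of four one-dimensional components. A heteroclinic network is a connected union of heteroclinic cycles; it is simple if all its cycles are simple. Maximal network: every isotropy semiaxis contains a steady state, every isotropy plane contains a heteroclinic connection, and all such steady states and connections belong to the network. *)

theory Defs
  imports "HOL-Analysis.Analysis" "Graph_Theory.Digraph_Isomorphism"
begin

type_synonym R4 = "real^4"
type_synonym M4 = "real^4^4"

section \<open>Finite matrix groups and their isotropy structure\<close>

definition matrix_group :: "M4 set \<Rightarrow> bool" where
  "matrix_group G \<longleftrightarrow> mat 1 \<in> G \<and> (\<forall>A\<in>G. \<forall>B\<in>G. A ** B \<in> G) \<and>
     (\<forall>A\<in>G. \<exists>B\<in>G. A ** B = mat 1 \<and> B ** A = mat 1)"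

definition SO4 :: "M4 set" where
  "SO4 = {A. orthogonal_matrix A \<and> det A = 1}"

definition act :: "M4 \<Rightarrow> R4 set \<Rightarrow> R4 set" where
  "act g S = (\<lambda>x. g *v x) ` S"

definition Fix :: "M4 set \<Rightarrow> R4 set" where
  "Fix H = {x. \<forall>g\<in>H. g *v x = x}"

definition isotropy :: "M4 set \<Rightarrow> R4 \<Rightarrow> M4 set" where
  "isotropy G x = {g\<in>G. g *v x = x}"

definition isotropy_spaces :: "M4 set \<Rightarrow> nat \<Rightarrow> R4 set set" where
  "isotropy_spaces G d = {L. (\<exists>x. L = Fix (isotropy G x)) \<and> dim L = d}"

definition isotropy_planes :: "M4 set \<Rightarrow> R4 set set" where
  "isotropy_planes G = isotropy_spaces G 2"

definition isotropy_axes :: "M4 set \<Rightarrow> R4 set set" where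
  "isotropy_axes G = isotropy_spaces G 1"

definition isotropy_semiaxes :: "M4 set \<Rightarrow> R4 set set" where
  "isotropy_semiaxes G = (\<Union>L\<in>isotropy_axes G. components (L - {0}))"

definition set_orbit :: "M4 set \<Rightarrow> R4 set \<Rightarrow> R4 set set" where
  "set_orbit G S = (\<lambda>g. act g S) ` G"

section \<open>The graph associated with a group\<close>

definition graph_vertices :: "M4 set \<Rightarrow> R4 set set set" where
  "graph_vertices G = set_orbit G ` isotropy_semiaxes G"

definition graph_lines :: "M4 set \<Rightarrow> R4 set set set" where
  "graph_lines G = set_orbit G ` isotropy_planes G"

definition lies_on :: "R4 set set \<Rightarrow> R4 set set \<Rightarrow> bool" where
  "lies_on v e \<longleftrightarrow> (\<exists>S\<in>v. \<exists>P\<in>e. S \<subseteq> P)"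

text \<open>A multigraph is given by its vertex set \<open>{1..n}\<close> and the list of its edges; the two
  occurrences of a pair in the list are two parallel edges.\<close>

definition graph_isomorphic_to :: "M4 set \<Rightarrow> nat \<Rightarrow> (nat \<times> nat) list \<Rightarrow> bool" where
  "graph_isomorphic_to G n es \<longleftrightarrow>
     (\<exists>\<phi> \<psi>. bij_betw \<phi> {1..n} (graph_vertices G) \<and> bij_betw \<psi> {..<length es} (graph_lines G) \<and>
        (\<forall>v\<in>{1..n}. \<forall>i<length es.
           lies_on (\<phi> v) (\<psi> i) \<longleftrightarrow> v = fst (es ! i) \<or> v = snd (es ! i)))"

definition graph_type_III :: "M4 set \<Rightarrow> bool" where
  "graph_type_III G \<longleftrightarrow> graph_isomorphic_to G 4 [(1,2), (1,3), (1,4), (2,3), (2,4), (3,4)]"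

definition graph_type_IV :: "M4 set \<Rightarrow> bool" where
  "graph_type_IV G \<longleftrightarrow> graph_isomorphic_to G 4 [(1,2), (1,2), (3,4), (3,4), (1,3), (2,4)]"

definition graph_type_V :: "M4 set \<Rightarrow> bool" where
  "graph_type_V G \<longleftrightarrow> graph_isomorphic_to G 6
     [(1,2), (2,3), (3,4), (4,5), (5,6), (6,1), (1,4), (2,5), (3,6)]"

definition graph_type_VI :: "M4 set \<Rightarrow> bool" where
  "graph_type_VI G \<longleftrightarrow> graph_isomorphic_to G 6
     [(1,2), (2,3), (3,1), (4,5), (5,6), (6,4), (1,4), (2,5), (3,6)]"

section \<open>Isotypic decomposition\<close>

definition invariant_subspace :: "M4 set \<Rightarrow> R4 set \<Rightarrow> bool" where
  "invariant_subspace H V \<longleftrightarrow> subspace V \<and> (\<forall>g\<in>H. act g V \<subseteq> V)"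

definition irreducible_subspace :: "M4 set \<Rightarrow> R4 set \<Rightarrow> bool" where
  "irreducible_subspace H V \<longleftrightarrow> invariant_subspace H V \<and> V \<noteq> {0} \<and>
     (\<forall>W. invariant_subspace H W \<and> W \<subseteq> V \<longrightarrow> W = {0} \<or> W = V)"

definition equivalent_subspaces :: "M4 set \<Rightarrow> R4 set \<Rightarrow> R4 set \<Rightarrow> bool" where
  "equivalent_subspaces H V W \<longleftrightarrow>
     (\<exists>h. linear h \<and> bij_betw h V W \<and> (\<forall>g\<in>H. \<forall>x\<in>V. h (g *v x) = g *v h x))"

definition isotypic_components :: "M4 set \<Rightarrow> R4 set set" where
  "isotypic_components H =
     {span (\<Union>{W. irreducible_subspace H W \<and> equivalent_subspaces H V W}) | V.
        irreducible_subspace H V}"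

section \<open>Equivariant vector fields\<close>

text \<open>A map is $C^{k+1}$ iff it is differentiable and all its directional derivatives
  are $C^k$.\<close>

primrec C_k :: "nat \<Rightarrow> (R4 \<Rightarrow> R4) \<Rightarrow> bool" where
  "C_k 0 f \<longleftrightarrow> continuous_on UNIV f"
| "C_k (Suc k) f \<longleftrightarrow> (\<forall>x. f differentiable (at x)) \<and>
     (\<forall>v. C_k k (\<lambda>x. frechet_derivative f (at x) v))"

definition smooth :: "(R4 \<Rightarrow> R4) \<Rightarrow> bool" where
  "smooth f \<longleftrightarrow> (\<forall>k. C_k k f)"

definition equivariant :: "M4 set \<Rightarrow> (R4 \<Rightarrow> R4) \<Rightarrow> bool" where
  "equivariant G f \<longleftrightarrow> (\<forall>g\<in>G. \<forall>x. f (g *v x) = g *v f x)"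

text \<open>The complex eigenvalues of the restriction of \<open>A\<close> to an \<open>A\<close>-invariant real subspace
  \<open>P\<close>: eigenvectors range over the complexification of \<open>P\<close>.\<close>

definition eigenvalues_on :: "R4 set \<Rightarrow> M4 \<Rightarrow> complex set" where
  "eigenvalues_on P A =
     {\<mu>. \<exists>v::complex^4. v \<noteq> 0 \<and> (\<chi> i. Re (v $ i)) \<in> P \<and> (\<chi> i. Im (v $ i)) \<in> P \<and>
        (\<chi> i j. complex_of_real (A $ i $ j)) *v v = \<mu> *s v}"

definition hyperbolic_equilibrium :: "(R4 \<Rightarrow> R4) \<Rightarrow> R4 \<Rightarrow> bool" where
  "hyperbolic_equilibrium f \<xi> \<longleftrightarrow> f \<xi> = 0 \<and>
     (\<forall>\<mu>\<in>eigenvalues_on UNIV (jacobian f (at \<xi>)). Re \<mu> \<noteq> 0)"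

definition sink_in :: "(R4 \<Rightarrow> R4) \<Rightarrow> R4 set \<Rightarrow> R4 \<Rightarrow> bool" where
  "sink_in f P \<xi> \<longleftrightarrow> \<xi> \<in> P \<and> f \<xi> = 0 \<and>
     (\<forall>\<mu>\<in>eigenvalues_on P (jacobian f (at \<xi>)). Re \<mu> < 0)"

definition solution_on :: "(R4 \<Rightarrow> R4) \<Rightarrow> real set \<Rightarrow> (real \<Rightarrow> R4) \<Rightarrow> bool" where
  "solution_on f I x \<longleftrightarrow> (\<forall>t\<in>I. (x has_vector_derivative f (x t)) (at t within I))"

definition stable_manifold :: "(R4 \<Rightarrow> R4) \<Rightarrow> R4 \<Rightarrow> R4 set" where
  "stable_manifold f \<xi> = {x 0 | x. solution_on f {0..} x \<and> (x \<longlongrightarrow> \<xi>) at_top}"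

definition unstable_manifold :: "(R4 \<Rightarrow> R4) \<Rightarrow> R4 \<Rightarrow> R4 set" where
  "unstable_manifold f \<xi> = {x 0 | x. solution_on f {..0} x \<and> (x \<longlongrightarrow> \<xi>) at_bot}"

text \<open>A trajectory is identified with its image, so that time shifts of a solution give the
  same connection. Every trajectory contained in the intersection of the two manifolds is
  defined for all times; stationary ones are excluded.\<close>

definition connecting_trajectory :: "(R4 \<Rightarrow> R4) \<Rightarrow> R4 \<Rightarrow> R4 set \<Rightarrow> R4 \<Rightarrow> bool" where
  "connecting_trajectory f \<xi> \<kappa> \<eta> \<longleftrightarrow>
     (\<exists>x. solution_on f UNIV x \<and> \<kappa> = range x) \<and>
     \<kappa> \<subseteq> unstable_manifold f \<xi> \<inter> stable_manifold f \<eta> \<and> (\<forall>p\<in>\<kappa>. f p \<noteq> 0)"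

section \<open>Heteroclinic cycles\<close>

text \<open>As equilibria and connections are considered up to the action of the group, a cycle
  of length \<open>M\<close> closes only up to some group element \<open>g\<close>. It is encoded by its lift to a
  bi-infinite chain of equilibria \<open>\<xi> j\<close> and connections \<open>\<kappa> j\<close> from \<open>\<xi> j\<close> to \<open>\<xi> (j + 1)\<close>
  with \<open>\<xi> (j + M) = g \<xi> j\<close>, \<open>\<kappa> (j + M) = g \<kappa> j\<close>.\<close>

definition heteroclinic_cycle ::
  "M4 set \<Rightarrow> (R4 \<Rightarrow> R4) \<Rightarrow> nat \<Rightarrow> M4 \<Rightarrow> (int \<Rightarrow> R4) \<Rightarrow> (int \<Rightarrow> R4 set) \<Rightarrow> bool" where
  "heteroclinic_cycle G f M g \<xi> \<kappa> \<longleftrightarrow> M > 0 \<and> g \<in> G \<and>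
     (\<forall>j. hyperbolic_equilibrium f (\<xi> j)) \<and>
     (\<forall>j. connecting_trajectory f (\<xi> j) (\<kappa> j) (\<xi> (j + 1))) \<and>
     (\<forall>j. \<xi> (j + int M) = g *v \<xi> j \<and> \<kappa> (j + int M) = act g (\<kappa> j))"

text \<open>\<open>P j\<close> is the fixed-point subspace containing \<open>\<kappa> j\<close>; the last condition makes the choice
  of these subspaces compatible with the closing element of the cycle.\<close>

definition robust_via ::
  "M4 set \<Rightarrow> (R4 \<Rightarrow> R4) \<Rightarrow> nat \<Rightarrow> M4 \<Rightarrow> (int \<Rightarrow> R4) \<Rightarrow> (int \<Rightarrow> R4 set) \<Rightarrow> (int \<Rightarrow> R4 set) \<Rightarrow> bool" where
  "robust_via G f M g \<xi> \<kappa> P \<longleftrightarrow>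
     (\<forall>j. (\<exists>\<Sigma>. matrix_group \<Sigma> \<and> \<Sigma> \<subseteq> G \<and> P j = Fix \<Sigma>) \<and>
        \<kappa> j \<subseteq> P j \<and> sink_in f (P j) (\<xi> (j + 1)) \<and> P (j + int M) = act g (P j))"

definition cycle_equilibria :: "M4 set \<Rightarrow> (int \<Rightarrow> R4) \<Rightarrow> R4 set" where
  "cycle_equilibria G \<xi> = {g *v \<xi> j | g j. g \<in> G}"

text \<open>A connection is recorded together with the equilibria it leads from and to.\<close>

type_synonym connection = "R4 \<times> R4 set \<times> R4"

definition act_connection :: "M4 \<Rightarrow> connection \<Rightarrow> connection" where
  "act_connection g c = (g *v fst c, act g (fst (snd c)), g *v snd (snd c))"

definition cycle_connections ::
  "M4 set \<Rightarrow> (int \<Rightarrow> R4) \<Rightarrow> (int \<Rightarrow> R4 set) \<Rightarrow> connection set" where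
  "cycle_connections G \<xi> \<kappa> = {act_connection g (\<xi> j, \<kappa> j, \<xi> (j + 1)) | g j. g \<in> G}"

definition point_set :: "R4 set \<Rightarrow> connection set \<Rightarrow> R4 set" where
  "point_set E K = E \<union> (\<Union>c\<in>K. fst (snd c))"

text \<open>The group \<open>\<Delta>\<^sub>j\<close> is the pointwise stabiliser of \<open>P\<^sub>j\<^sub>-\<^sub>1 \<inter> P\<^sub>j\<close>. The
  equilibria are required to be nonzero: the origin lies on no semiaxis.\<close>

definition simple_cycle ::
  "M4 set \<Rightarrow> (R4 \<Rightarrow> R4) \<Rightarrow> nat \<Rightarrow> M4 \<Rightarrow> (int \<Rightarrow> R4) \<Rightarrow> (int \<Rightarrow> R4 set) \<Rightarrow> bool" where
  "simple_cycle G f M g \<xi> \<kappa> \<longleftrightarrow> heteroclinic_cycle G f M g \<xi> \<kappa> \<and>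
     (\<exists>P. robust_via G f M g \<xi> \<kappa> P \<and>
        (\<forall>j. dim (P j) = 2 \<and> \<xi> j \<noteq> 0 \<and>
           (\<forall>C\<in>components (P (j - 1) \<inter> P j - {0}).
              \<forall>x \<in> C \<inter> point_set (cycle_equilibria G \<xi>) (cycle_connections G \<xi> \<kappa>).
              \<forall>y \<in> C \<inter> point_set (cycle_equilibria G \<xi>) (cycle_connections G \<xi> \<kappa>). x = y) \<and>
           P (j - 1) \<inter> P j \<in> isotropy_axes G \<and>
           (let \<Delta> = {g\<in>G. \<forall>x \<in> P (j - 1) \<inter> P j. g *v x = x} in
              card (isotypic_components \<Delta>) = 4 \<and> (\<forall>V\<in>isotypic_components \<Delta>. dim V = 1))))"

section \<open>Heteroclinic networks\<close>

text \<open>Connectedness of the image of \<open>X\<close> in the orbit space.\<close>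

definition connected_mod :: "M4 set \<Rightarrow> R4 set \<Rightarrow> bool" where
  "connected_mod G X \<longleftrightarrow>
     (\<forall>A B. openin (top_of_set X) A \<and> openin (top_of_set X) B \<and>
        (\<forall>g\<in>G. act g A = A \<and> act g B = B) \<and> A \<union> B = X \<and> A \<inter> B = {} \<longrightarrow> A = {} \<or> B = {})"

definition heteroclinic_network ::
  "M4 set \<Rightarrow> (R4 \<Rightarrow> R4) \<Rightarrow> R4 set \<Rightarrow> connection set \<Rightarrow> bool" where
  "heteroclinic_network G f E K \<longleftrightarrow>
     (\<exists>\<C>. (\<forall>(\<xi>, \<kappa>)\<in>\<C>. \<exists>M g. heteroclinic_cycle G f M g \<xi> \<kappa>) \<and>
        E = (\<Union>(\<xi>, \<kappa>)\<in>\<C>. cycle_equilibria G \<xi>) \<and>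
        K = (\<Union>(\<xi>, \<kappa>)\<in>\<C>. cycle_connections G \<xi> \<kappa>)) \<and>
     connected_mod G (point_set E K)"

definition simple_network ::
  "M4 set \<Rightarrow> (R4 \<Rightarrow> R4) \<Rightarrow> R4 set \<Rightarrow> connection set \<Rightarrow> bool" where
  "simple_network G f E K \<longleftrightarrow> heteroclinic_network G f E K \<and>
     (\<forall>M g \<xi> \<kappa>. heteroclinic_cycle G f M g \<xi> \<kappa> \<and> cycle_connections G \<xi> \<kappa> \<subseteq> K \<longrightarrow>
        simple_cycle G f M g \<xi> \<kappa>)"

definition semiaxis_steady_states :: "M4 set \<Rightarrow> (R4 \<Rightarrow> R4) \<Rightarrow> R4 set" where
  "semiaxis_steady_states G f = {x \<in> \<Union>(isotropy_semiaxes G). f x = 0}"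

definition plane_connections :: "M4 set \<Rightarrow> (R4 \<Rightarrow> R4) \<Rightarrow> R4 set \<Rightarrow> connection set" where
  "plane_connections G f P =
     {(\<xi>, \<kappa>, \<eta>). \<xi> \<in> semiaxis_steady_states G f \<and> \<eta> \<in> semiaxis_steady_states G f \<and>
        connecting_trajectory f \<xi> \<kappa> \<eta> \<and> \<kappa> \<subseteq> P}"

text \<open>The heteroclinic connections in an isotropy plane are those between steady states on
  isotropy semiaxes; trajectories leaving the origin, for instance, do not count.\<close>

definition maximal_network ::
  "M4 set \<Rightarrow> (R4 \<Rightarrow> R4) \<Rightarrow> R4 set \<Rightarrow> connection set \<Rightarrow> bool" where
  "maximal_network G f E K \<longleftrightarrow>
     (\<forall>S\<in>isotropy_semiaxes G. S \<inter> semiaxis_steady_states G f \<noteq> {}) \<and>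
     (\<forall>P\<in>isotropy_planes G. plane_connections G f P \<noteq> {}) \<and>
     semiaxis_steady_states G f \<subseteq> E \<and>
     (\<forall>P\<in>isotropy_planes G. plane_connections G f P \<subseteq> K)"

section \<open>Networks as directed multigraphs\<close>

text \<open>An orbit of connections starts at the orbit of the starting points of its members.\<close>

definition network_digraph ::
  "M4 set \<Rightarrow> R4 set \<Rightarrow> connection set \<Rightarrow> (R4 set, connection set) pre_digraph" where
  "network_digraph G E K =
     \<lparr> verts = (\<lambda>\<xi>. (\<lambda>g. g *v \<xi>) ` G) ` E,
       arcs = (\<lambda>c. (\<lambda>g. act_connection g c) ` G) ` K,
       tail = (\<lambda>a. fst ` a),
       head = (\<lambda>a. (\<lambda>c. snd (snd c)) ` a) \<rparr>"

definition digraph_of :: "nat \<Rightarrow> (nat \<times> nat) list \<Rightarrow> (nat, nat) pre_digraph" where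
  "digraph_of n arrs =
     \<lparr> verts = {1..n}, arcs = {..<length arrs}, tail = (\<lambda>i. fst (arrs ! i)), head = (\<lambda>i. snd (arrs ! i)) \<rparr>"

definition network_two_orbits :: "(nat, nat) pre_digraph" where
  "network_two_orbits = digraph_of 2 [(1,2), (1,2), (2,1)]"

definition network_III :: "(nat, nat) pre_digraph" where
  "network_III = digraph_of 4 [(1,2), (2,3), (3,1), (3,4), (4,1), (4,2)]"

text \<open>\<open>b\<close> and \<open>c\<close> tell whether the connections between 1 and 2, respectively 3 and 4, go
  in both directions.\<close>

definition network_IV :: "bool \<Rightarrow> bool \<Rightarrow> (nat, nat) pre_digraph" where
  "network_IV b c = digraph_of 4
     ([(1,3), (4,2)] @ (if b then [(1,2), (2,1)] else [(2,1), (2,1)])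
        @ (if c then [(3,4), (4,3)] else [(3,4), (3,4)]))"

definition two_cycle_pairs :: "('a, 'b) pre_digraph \<Rightarrow> 'a set set" where
  "two_cycle_pairs D = {{u, v} | u v. u \<noteq> v \<and> (u, v) \<in> arcs_ends D \<and> (v, u) \<in> arcs_ends D}"

definition network_V1 :: "(nat, nat) pre_digraph" where
  "network_V1 = digraph_of 6 [(1,2), (2,3), (3,4), (4,5), (5,6), (6,1), (1,4), (2,5), (3,6)]"

definition network_V2 :: "(nat, nat) pre_digraph" where
  "network_V2 = digraph_of 6 [(1,2), (2,3), (3,4), (4,5), (5,6), (6,1), (1,4), (3,6), (5,2)]"

text \<open>The vertices \<open>a\<^sub>1, a\<^sub>2, a\<^sub>3, b\<^sub>1, b\<^sub>2, b\<^sub>3\<close> are numbered 1 to 6.\<close>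

definition network_V3 :: "(nat, nat) pre_digraph" where
  "network_V3 = digraph_of 6 [(1,4), (2,4), (4,3), (3,5), (3,6), (5,1), (5,2), (6,1), (6,2)]"

text \<open>The arc sets of the directed cycles without repeated vertices.\<close>

definition cycle_arc_sets :: "('a, 'b) pre_digraph \<Rightarrow> 'b set set" where
  "cycle_arc_sets D = {set p | p. pre_digraph.cycle D p}"

definition first_triangle :: "(nat \<times> nat) list list" where
  "first_triangle =
     [[(1,2), (2,3), (3,1)], [(1,2), (3,2), (3,1)], [(2,1), (3,2), (3,1)], [(2,1), (3,2), (1,3)]]"

definition second_triangle :: "(nat \<times> nat) list list" where
  "second_triangle =
     [[(4,5), (5,6), (6,4)], [(4,5), (5,6), (4,6)], [(5,4), (5,6), (4,6)], [(5,4), (6,5), (4,6)]]"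

definition arrows_VI :: "nat \<Rightarrow> nat \<Rightarrow> (nat \<times> nat) list" where
  "arrows_VI p q = [(1,4), (2,5), (6,3)] @ first_triangle ! p @ second_triangle ! q"

definition network_VI :: "nat \<Rightarrow> nat \<Rightarrow> (nat, nat) pre_digraph" where
  "network_VI p q = digraph_of 6 (arrows_VI p q)"

definition relabel_VI :: "nat \<Rightarrow> nat" where
  "relabel_VI = id(1 := 2, 2 := 1, 4 := 5, 5 := 4)"

end

theory Submission
  imports Defs
begin

text \<open>At an equilibrium \<open>\<xi>\<close> of the network, four one-dimensional isotypic components and
  determinant one force the isotropy group of \<open>\<xi>\<close> to consist of the identity and three half-turns in an
  orthogonal frame containing \<open>\<xi>\<close>. Hence exactly three isotropy planes pass through \<open>\<xi>\<close>, each is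
  reflected in the line of \<open>\<xi>\<close> by an element of the group, and the linearisation at \<open>\<xi>\<close> is diagonal in
  the frame, so that \<open>\<xi>\<close> is a sink or a saddle in each of these planes.

  In an isotropy plane \<open>P\<close> the lines of the equilibria are mirrors, and a connection stays inside one
  chamber. Therefore every equilibrium of \<open>P\<close> is mapped to the start or to the end of the connection by
  the stabiliser of \<open>P\<close>; since the unstable manifold of a saddle in \<open>P\<close> consists of two branches
  exchanged by a reflection, \<open>P\<close> contains a single orbit of connections. The network is thus an
  orientation of the graph of the group. There are three arrows at every vertex, every arrow lies on a
  closed walk and every vertex is the tail of an arrow, and finitely many orientations remain to be
  compared with the listed networks. Sums of squares of walk counts distinguish the networks of type VI.\<close>

text \<open>Two counts carry the analysis. A semiaxis holds exactly one equilibrium: each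
  equilibrium is a sink in the plane of an incoming connection, which contains its line, so its
  radial eigenvalue is negative; by maximality this holds at every zero of \<open>f\<close> on the
  semiaxis, and neighbouring zeros of a function of one variable cannot both have negative
  derivative. A plane holds one connection up to symmetry: no invariant manifold is constructed; a
  quadratic form that does not decrease along differences of solutions shows that two trajectories
  leaving a saddle on the same side share a point. The chamber argument avoids classifying plane
  reflection groups: among the finitely many images of an equilibrium, one with largest inner
  product with a point of the connection lies in the closed chamber of the connection. Two orbits of
  semiaxes come without a prescribed graph, so there the three planes through an equilibrium are
  counted as arrow ends at a vertex. For the prescribed graphs, orientations are tested only against
  cuts, so no reachability has to be computed.\<close>

section \<open>Orthonormal bases and determinants\<close>

lemma orthogonal_matrix_inner:
  fixes g :: "real^'n^'n"
  assumes "orthogonal_matrix g"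
  shows "(g *v x) \<bullet> (g *v y) = x \<bullet> y"
proof -
  have "orthogonal_transformation ((*v) g)"
    using assms by (simp add: orthogonal_transformation_matrix)
  then show ?thesis
    by (simp add: orthogonal_transformation_def)
qed

lemma orthogonal_matrix_norm_mult:
  fixes g :: "real^'n^'n"
  assumes "orthogonal_matrix g"
  shows "norm (g *v x) = norm x"
  using orthogonal_matrix_inner[OF assms, of x x] by (simp add: norm_eq_sqrt_inner)

text \<open>With the \<open>q i\<close> as rows of \<open>Q\<close>, orthonormality says
  \<open>Q ** transpose Q = mat 1\<close>; for square matrices the other product is then
  \<open>mat 1\<close> as well, and \<open>transpose Q *v (Q *v y)\<close> is the sum.\<close>

lemma orthonormal_family_expansion:
  fixes q :: "'n::finite \<Rightarrow> real^'n"
  assumes "\<And>i j. q i \<bullet> q j = (if i = j then 1 else 0)"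
  shows "y = (\<Sum>i\<in>UNIV. (q i \<bullet> y) *\<^sub>R q i)"
proof -
  define Q where "Q = (\<chi> i. q i)"
  have "Q ** transpose Q = mat 1"
    by (simp add: matrix_mult_transpose_dot_row row_def Q_def assms mat_def vec_eq_iff)
  then have Q: "transpose Q ** Q = mat 1"
    by (simp add: matrix_left_right_inverse)
  have "y = transpose Q *v (Q *v y)"
    using Q by (simp add: matrix_vector_mul_assoc)
  also have "\<dots> = (\<Sum>i\<in>UNIV. (q i \<bullet> y) *\<^sub>R q i)"
    unfolding matrix_mult_sum
    by (simp add: matrix_mult_dot Q_def row_def column_def transpose_def scalar_mult_eq_scaleR
        inner_vec_def mult.commute)
  finally show ?thesis .
qed

text \<open>The first vector stays unnormalised: it will be an equilibrium, whereas
  \<open>a\<close>, \<open>b\<close>, \<open>c\<close> are only directions. Its coefficient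
  therefore carries the quotient by \<open>x \<bullet> x\<close>.\<close>

lemma orthonormal_four_expansion:
  fixes x a b c y :: "real^4"
  assumes "norm a = 1" "norm b = 1" "norm c = 1" "x \<noteq> 0"
    and "x \<bullet> a = 0" "x \<bullet> b = 0" "x \<bullet> c = 0" "a \<bullet> b = 0" "a \<bullet> c = 0" "b \<bullet> c = 0"
  shows "y = (x \<bullet> y / (x \<bullet> x)) *\<^sub>R x + (a \<bullet> y) *\<^sub>R a + (b \<bullet> y) *\<^sub>R b + (c \<bullet> y) *\<^sub>R c"
proof -
  define e where "e = x /\<^sub>R norm x"
  have e: "norm e = 1" "e \<bullet> a = 0" "e \<bullet> b = 0" "e \<bullet> c = 0"
    using assms by (auto simp: e_def)
  define q where "q = (\<lambda>i::4. if i = 1 then e else if i = 2 then a else if i = 3 then b else c)"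
  have q: "q 1 = e" "q 2 = a" "q 3 = b" "q 4 = c"
    by (simp_all add: q_def)
  have "\<forall>i j. q i \<bullet> q j = (if i = j then 1 else 0)"
    using assms e by (simp add: forall_4 q inner_commute dot_square_norm)
  then have "y = (\<Sum>i\<in>UNIV. (q i \<bullet> y) *\<^sub>R q i)"
    by (intro orthonormal_family_expansion) auto
  moreover have "(e \<bullet> y) *\<^sub>R e = (x \<bullet> y / (x \<bullet> x)) *\<^sub>R x"
    by (simp add: e_def dot_square_norm power2_eq_square field_simps)
  ultimately show ?thesis
    by (simp add: sum_4 q)
qed

lemma prod_4: "prod f (UNIV::4 set) = f 1 * f 2 * f 3 * f 4"
  unfolding UNIV_4 by (simp add: ac_simps)

text \<open>In the orthonormal basis made of the normalised \<open>x\<close> and \<open>a\<close>,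
  \<open>b\<close>, \<open>c\<close>, the columns of \<open>Q\<close>, the matrix becomes diagonal:
  \<open>g ** Q = Q ** D\<close>, and \<open>det Q\<close> cancels. This rules out the sign patterns
  of determinant -1 in an isotropy group.\<close>

lemma det_orthonormal_four:
  fixes x a b c :: "real^4"
  assumes "norm a = 1" "norm b = 1" "norm c = 1" "x \<noteq> 0"
    and "x \<bullet> a = 0" "x \<bullet> b = 0" "x \<bullet> c = 0" "a \<bullet> b = 0" "a \<bullet> c = 0" "b \<bullet> c = 0"
    and g: "g *v x = x" "g *v a = \<alpha> *\<^sub>R a" "g *v b = \<beta> *\<^sub>R b" "g *v c = \<gamma> *\<^sub>R c"
  shows "det g = \<alpha> * \<beta> * \<gamma>"
proof -
  define e where "e = x /\<^sub>R norm x"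
  have e: "norm e = 1" "e \<bullet> a = 0" "e \<bullet> b = 0" "e \<bullet> c = 0" "g *v e = e"
    using assms by (auto simp: e_def matrix_vector_mult_scaleR)
  define q where "q = (\<lambda>i::4. if i = 1 then e else if i = 2 then a else if i = 3 then b else c)"
  define d where "d = (\<lambda>i::4. if i = 1 then 1 else if i = 2 then \<alpha> else if i = 3 then \<beta> else \<gamma>)"
  have q: "q 1 = e" "q 2 = a" "q 3 = b" "q 4 = c"
    by (simp_all add: q_def)
  have d: "d 1 = 1" "d 2 = \<alpha>" "d 3 = \<beta>" "d 4 = \<gamma>"
    by (simp_all add: d_def)
  have qq: "\<forall>i j. q i \<bullet> q j = (if i = j then 1 else 0)"
    using assms e by (simp add: forall_4 q inner_commute dot_square_norm)
  define Q where "Q = transpose (\<chi> i. q i)"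
  define D where "D = (\<chi> i j. if i = j then d i else 0)"
  have col: "column i Q = q i" for i
    by (simp add: Q_def column_def transpose_def vec_eq_iff)
  have "transpose Q ** Q = mat 1"
    by (simp add: matrix_mult_transpose_dot_column col qq mat_def vec_eq_iff)
  then have Q0: "det Q \<noteq> 0"
    by (metis det_I det_mul mult_zero_right zero_neq_one)
  have gq: "\<forall>i. g *v q i = d i *\<^sub>R q i"
    using assms e by (simp add: forall_4 q d)
  have "(g ** Q) $ i $ j = (Q ** D) $ i $ j" for i j
  proof -
    have "(g ** Q) $ i $ j = (g *v q j) $ i"
      by (simp add: matrix_matrix_mult_def matrix_vector_mult_def Q_def transpose_def)
    also have "\<dots> = d j * q j $ i"
      by (simp add: gq)
    also have "\<dots> = (Q ** D) $ i $ j"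
      by (simp add: matrix_matrix_mult_def D_def Q_def transpose_def if_distrib cong: if_cong)
    finally show ?thesis .
  qed
  then have "g ** Q = Q ** D"
    by (simp add: vec_eq_iff)
  then have "det g * det Q = det Q * det D"
    by (metis det_mul)
  moreover have "det D = (\<Prod>i\<in>UNIV. D $ i $ i)"
    by (rule det_diagonal) (simp add: D_def)
  then have "det D = (\<Prod>i\<in>UNIV. d i)"
    by (simp only: D_def vec_lambda_beta if_True simp_thms)
  moreover have "(\<Prod>i\<in>UNIV. d i) = \<alpha> * \<beta> * \<gamma>"
    by (simp only: prod_4 d mult_1)
  ultimately have "det g * det Q = (\<alpha> * \<beta> * \<gamma>) * det Q"
    by (simp only: mult.commute)
  then show ?thesis
    using Q0 by (simp only: mult_cancel_right) simp
qed

lemma span_singletonD: "y \<in> span {e} \<Longrightarrow> \<exists>k. y = k *\<^sub>R e"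
  by (auto simp: span_singleton)

section \<open>Isotropy groups with four one-dimensional isotypic components\<close>

text \<open>A nonzero invariant subspace of least dimension inside \<open>U\<close> has no proper
  nonzero invariant subspace.\<close>

lemma irreducible_subspace_exists:
  assumes "invariant_subspace H U" "U \<noteq> {0}"
  shows "\<exists>V. irreducible_subspace H V \<and> V \<subseteq> U"
proof -
  define S where "S V \<longleftrightarrow> invariant_subspace H V \<and> V \<noteq> {0} \<and> V \<subseteq> U" for V
  have "S U"
    using assms by (simp add: S_def)
  then obtain V where V: "S V" "\<And>W. S W \<Longrightarrow> dim V \<le> dim W"
    using ex_has_least_nat[of S U dim] by auto
  have "W = V" if W: "invariant_subspace H W" "W \<subseteq> V" "W \<noteq> {0}" for W
  proof (rule subspace_dim_equal)
    show "dim V \<le> dim W"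
      using V W by (auto simp: S_def)
  qed (use V W in \<open>auto simp: S_def invariant_subspace_def\<close>)
  then have "irreducible_subspace H V"
    using V by (auto simp: irreducible_subspace_def S_def)
  then show ?thesis
    using V by (auto simp: S_def)
qed

lemma equivalent_subspaces_refl: "equivalent_subspaces H V V"
  unfolding equivalent_subspaces_def by (rule exI[of _ id]) (auto simp: linear_id)

text \<open>An irreducible subspace lies in its own isotypic component, and so does every
  irreducible subspace equivalent to it; when the component is a line, all of them coincide with
  it.\<close>

lemma irreducible_subspace_line:
  assumes "\<forall>C\<in>isotypic_components H. dim C = 1"
    and V: "irreducible_subspace H V"
  shows "dim V = 1"
    and "irreducible_subspace H W \<Longrightarrow> equivalent_subspaces H V W \<Longrightarrow> W = V"
proof -
  let ?C = "\<lambda>V. span (\<Union>{W. irreducible_subspace H W \<and> equivalent_subspaces H V W})"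
  have *: "dim V = 1 \<and> ?C V = V" if V: "irreducible_subspace H V" for V
  proof -
    have "?C V \<in> isotypic_components H"
      using V by (auto simp: isotypic_components_def)
    then have C: "dim (?C V) = 1"
      using assms by blast
    have sub: "V \<subseteq> ?C V"
      using V equivalent_subspaces_refl by (intro subset_trans[OF _ span_superset]) blast
    have "subspace V" "V \<noteq> {0}"
      using V by (auto simp: irreducible_subspace_def invariant_subspace_def)
    then have "dim V \<noteq> 0"
      using subspace_0[of V] by (metis dim_eq_0 subset_singletonD empty_iff)
    then have "dim V = 1"
      using dim_subset[OF sub] C by linarith
    moreover have "V = ?C V"
      using subspace_dim_equal[OF \<open>subspace V\<close> subspace_span sub] C \<open>dim V = 1\<close> by simp
    ultimately show ?thesis
      by simp
  qed
  show "dim V = 1"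
    using * V by blast
  assume W: "irreducible_subspace H W" "equivalent_subspaces H V W"
  then have "W \<subseteq> ?C V"
    by (intro subset_trans[OF _ span_superset]) blast
  then have "W \<subseteq> V"
    using * V by blast
  moreover have "subspace W" "subspace V" "dim V = dim W"
    using *[OF V] *[OF W(1)] V W(1) by (simp_all add: irreducible_subspace_def invariant_subspace_def)
  ultimately show "W = V"
    by (intro subspace_dim_equal) auto
qed

lemma span_line_irreducible:
  assumes "e \<noteq> 0" "\<forall>g\<in>H. g *v e = e \<or> g *v e = - e"
  shows "irreducible_subspace H (span {e})"
proof -
  have "g *v y \<in> span {e}" if g: "g \<in> H" and y: "y \<in> span {e}" for g y
  proof -
    obtain k where "y = k *\<^sub>R e"
      using y span_singletonD by blast
    then have "g *v y = k *\<^sub>R (g *v e)"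
      by (simp add: matrix_vector_mult_scaleR)
    moreover have "g *v e \<in> span {e}"
      using assms g by (metis span_base span_neg insertI1)
    ultimately show ?thesis
      by (simp add: span_scale)
  qed
  then have inv: "invariant_subspace H (span {e})"
    by (auto simp: invariant_subspace_def act_def subspace_span)
  have "W = span {e}" if W: "invariant_subspace H W" "W \<subseteq> span {e}" "W \<noteq> {0}" for W
  proof (rule subspace_dim_equal)
    show "subspace W"
      using W by (simp add: invariant_subspace_def)
    then have "dim W \<noteq> 0"
      using W subspace_0[of W] by (metis dim_eq_0 subset_singletonD empty_iff)
    moreover have "dim (span {e}) = 1"
      using assms by (simp add: dim_span)
    ultimately show "dim (span {e}) \<le> dim W"
      by linarith
  qed (use W in \<open>auto simp: subspace_span\<close>)
  moreover have "span {e} \<noteq> {0}"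
    using assms by (metis insertI1 singletonD span_base)
  ultimately show ?thesis
    using inv by (auto simp: irreducible_subspace_def)
qed

text \<open>The intertwining map sends \<open>e\<close> to \<open>e'\<close>; it commutes with the
  group because every element acts on both vectors by the same sign.\<close>

lemma equal_characters_equivalent:
  assumes "norm e = 1" "norm e' = 1"
    and "\<And>g. g \<in> H \<Longrightarrow> (g *v e = e \<and> g *v e' = e') \<or> (g *v e = - e \<and> g *v e' = - e')"
  shows "equivalent_subspaces H (span {e}) (span {e'})"
proof -
  define h where "h y = (e \<bullet> y) *\<^sub>R e'" for y
  have lin: "linear h"
    unfolding h_def by (intro linearI) (auto simp: inner_right_distrib scaleR_left_distrib)
  have ee: "e \<bullet> e = 1"
    using assms by (simp add: dot_square_norm)
  have e'0: "e' \<noteq> 0"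
    using assms by auto
  have "inj_on h (span {e})"
    using e'0 ee by (auto simp: inj_on_def span_singleton h_def)
  moreover have "h ` span {e} = span {e'}"
    using ee by (force simp: span_singleton h_def image_iff)
  moreover have "h (g *v y) = g *v h y" if g: "g \<in> H" and y: "y \<in> span {e}" for g y
  proof -
    obtain k where k: "y = k *\<^sub>R e"
      using y span_singletonD by blast
    show ?thesis
      using assms(3)[OF g] ee by (auto simp: h_def k matrix_vector_mult_scaleR)
  qed
  ultimately show ?thesis
    unfolding equivalent_subspaces_def bij_betw_def using lin by blast
qed

text \<open>The orthogonal complement of \<open>S\<close> is invariant, because elements of
  \<open>H\<close> preserve inner products and act on \<open>S\<close> by signs, and it is nonzero,
  because fewer than four vectors cannot span. An irreducible part of it is a line, on which an
  orthogonal matrix can only act by a sign. Starting from \<open>{x}\<close>, three uses give a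
  whole frame.\<close>

lemma orthogonal_invariant_line_exists:
  fixes H :: "M4 set"
  assumes orth: "\<And>g. g \<in> H \<Longrightarrow> orthogonal_matrix g"
    and dim1: "\<forall>C\<in>isotypic_components H. dim C = 1"
    and S: "finite S" "card S < 4" "\<And>g v. g \<in> H \<Longrightarrow> v \<in> S \<Longrightarrow> g *v v = v \<or> g *v v = - v"
  shows "\<exists>e. norm e = 1 \<and> (\<forall>v\<in>S. v \<bullet> e = 0) \<and> (\<forall>g\<in>H. g *v e = e \<or> g *v e = - e)"
proof -
  define U where "U = {y. \<forall>v\<in>S. v \<bullet> y = 0}"
  have sub: "subspace U"
    by (auto simp: U_def subspace_def inner_right_distrib)
  have "g *v y \<in> U" if "g \<in> H" "y \<in> U" for g y
  proof -
    have "v \<bullet> (g *v y) = 0" if v: "v \<in> S" for v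
    proof -
      have "(g *v v) \<bullet> (g *v y) = 0"
        using orthogonal_matrix_inner[OF orth[OF \<open>g \<in> H\<close>]] \<open>y \<in> U\<close> v by (simp add: U_def)
      then show ?thesis
        using S(3)[OF \<open>g \<in> H\<close> v] by auto
    qed
    then show ?thesis
      by (simp add: U_def)
  qed
  then have inv: "invariant_subspace H U"
    using sub by (auto simp: invariant_subspace_def act_def)
  have "dim S < DIM(R4)"
    using dim_le_card'[OF S(1)] S(2) by simp
  then obtain y where "y \<noteq> 0" "\<And>v. v \<in> span S \<Longrightarrow> orthogonal y v"
    using orthogonal_to_subspace_exists by blast
  then have "y \<in> U" "y \<noteq> 0"
    by (auto simp: U_def span_base orthogonal_def inner_commute)
  then have "U \<noteq> {0}"
    by auto
  from irreducible_subspace_exists[OF inv this]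
  obtain V where V: "irreducible_subspace H V" "V \<subseteq> U"
    by blast
  have "dim V = 1"
    using irreducible_subspace_line(1)[OF dim1 V(1)] .
  moreover have sV: "subspace V"
    using V by (auto simp: irreducible_subspace_def invariant_subspace_def)
  ultimately obtain w where w: "w \<in> V" "w \<noteq> 0"
    by (metis dim_eq_0 insertI1 subsetI zero_neq_one)
  define e where "e = w /\<^sub>R norm w"
  have e: "norm e = 1" "e \<in> V"
    using w sV by (auto simp: e_def subspace_scale)
  have Ve: "V = span {e}"
  proof (rule sym, rule subspace_dim_equal)
    show "dim V \<le> dim (span {e})"
      using e \<open>dim V = 1\<close> by (cases "e = 0") (auto simp: dim_span)
    show "span {e} \<subseteq> V"
      using e sV by (simp add: span_minimal)
  qed (use sV in \<open>auto simp: subspace_span\<close>)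
  have "g *v e = e \<or> g *v e = - e" if "g \<in> H" for g
  proof -
    have "g *v e \<in> V"
      using V(1) that e by (auto simp: irreducible_subspace_def invariant_subspace_def act_def)
    then obtain k where k: "g *v e = k *\<^sub>R e"
      using span_singletonD unfolding Ve by blast
    have "norm (g *v e) = 1"
      using orthogonal_matrix_norm_mult[OF orth[OF that]] e by simp
    then have "\<bar>k\<bar> = 1"
      using k e by simp
    then show ?thesis
      using k by (auto simp: abs_if split: if_splits)
  qed
  then show ?thesis
    using e V(2) by (auto simp: U_def)
qed

text \<open>The isotropy group of \<open>x\<close> is the Klein four-group of even sign changes of
  \<open>a\<close>, \<open>b\<close>, \<open>c\<close>; the last conjunct excludes further elements.
  Elements are described by their action on the vectors, so that no coordinates are needed.\<close>

definition half_turn_frame :: "M4 set \<Rightarrow> R4 \<Rightarrow> R4 \<Rightarrow> R4 \<Rightarrow> R4 \<Rightarrow> bool" where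
  "half_turn_frame G x a b c \<longleftrightarrow> x \<noteq> 0 \<and> norm a = 1 \<and> norm b = 1 \<and> norm c = 1 \<and>
     x \<bullet> a = 0 \<and> x \<bullet> b = 0 \<and> x \<bullet> c = 0 \<and> a \<bullet> b = 0 \<and> a \<bullet> c = 0 \<and> b \<bullet> c = 0 \<and>
     (\<exists>g\<in>G. g *v x = x \<and> g *v a = a \<and> g *v b = - b \<and> g *v c = - c) \<and>
     (\<exists>g\<in>G. g *v x = x \<and> g *v a = - a \<and> g *v b = b \<and> g *v c = - c) \<and>
     (\<exists>g\<in>G. g *v x = x \<and> g *v a = - a \<and> g *v b = - b \<and> g *v c = c) \<and>
     (\<forall>g\<in>G. g *v x = x \<longrightarrow>
        g *v a = a \<and> g *v b = b \<and> g *v c = c \<or> g *v a = a \<and> g *v b = - b \<and> g *v c = - c \<or>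
        g *v a = - a \<and> g *v b = b \<and> g *v c = - c \<or> g *v a = - a \<and> g *v b = - b \<and> g *v c = c)"

text \<open>Facts about the plane of \<open>x\<close> and \<open>a\<close> carry over to the other
  two planes by rotating the frame, so they are proved once.\<close>

lemma half_turn_frame_rotate:
  assumes "half_turn_frame G x a b c"
  shows "half_turn_frame G x b c a"
proof -
  have E: "\<exists>g\<in>G. g *v x = x \<and> g *v a = a \<and> g *v b = - b \<and> g *v c = - c"
    "\<exists>g\<in>G. g *v x = x \<and> g *v a = - a \<and> g *v b = b \<and> g *v c = - c"
    "\<exists>g\<in>G. g *v x = x \<and> g *v a = - a \<and> g *v b = - b \<and> g *v c = c"
    using assms by (simp_all only: half_turn_frame_def)
  have "\<exists>g\<in>G. g *v x = x \<and> g *v b = b \<and> g *v c = - c \<and> g *v a = - a"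
    using E(2) by blast
  moreover have "\<exists>g\<in>G. g *v x = x \<and> g *v b = - b \<and> g *v c = c \<and> g *v a = - a"
    using E(3) by blast
  moreover have "\<exists>g\<in>G. g *v x = x \<and> g *v b = - b \<and> g *v c = - c \<and> g *v a = a"
    using E(1) by blast
  moreover have "g *v b = b \<and> g *v c = c \<and> g *v a = a \<or> g *v b = b \<and> g *v c = - c \<and> g *v a = - a \<or>
        g *v b = - b \<and> g *v c = c \<and> g *v a = - a \<or> g *v b = - b \<and> g *v c = - c \<and> g *v a = a"
    if g: "g \<in> G" "g *v x = x" for g
  proof -
    have "\<forall>g\<in>G. g *v x = x \<longrightarrow>
        g *v a = a \<and> g *v b = b \<and> g *v c = c \<or> g *v a = a \<and> g *v b = - b \<and> g *v c = - c \<or>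
        g *v a = - a \<and> g *v b = b \<and> g *v c = - c \<or> g *v a = - a \<and> g *v b = - b \<and> g *v c = c"
      using assms unfolding half_turn_frame_def by (elim conjE)
    then show ?thesis
      using g by blast
  qed
  ultimately show ?thesis
    using assms unfolding half_turn_frame_def by (simp add: inner_commute)
qed

text \<open>Lines with equal characters lie in one isotypic component, so on \<open>a\<close>,
  \<open>b\<close>, \<open>c\<close> the character differs from the trivial one on \<open>x\<close>:
  each of them is negated by some element. Determinant one admits only even numbers of sign changes,
  which leaves the three half-turns.\<close>

lemma half_turn_frame_exists:
  assumes G: "matrix_group G" "G \<subseteq> SO4" and x: "x \<noteq> 0"
    and dim1: "\<forall>C\<in>isotypic_components (isotropy G x). dim C = 1"
  shows "\<exists>a b c. half_turn_frame G x a b c"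
proof -
  let ?H = "isotropy G x"
  have orth: "orthogonal_matrix g" and det: "det g = 1" if "g \<in> ?H" for g
    using that G by (auto simp: isotropy_def SO4_def)
  have Hx: "g *v x = x" if "g \<in> ?H" for g
    using that by (simp add: isotropy_def)
  obtain a where a: "norm a = 1" "x \<bullet> a = 0" "\<And>g. g \<in> ?H \<Longrightarrow> g *v a = a \<or> g *v a = - a"
    using orthogonal_invariant_line_exists[OF orth dim1, of "{x}"] Hx by auto
  obtain b where b: "norm b = 1" "x \<bullet> b = 0" "a \<bullet> b = 0" "\<And>g. g \<in> ?H \<Longrightarrow> g *v b = b \<or> g *v b = - b"
  proof -
    have "\<exists>e. norm e = 1 \<and> (\<forall>v\<in>{x, a}. v \<bullet> e = 0) \<and> (\<forall>g\<in>?H. g *v e = e \<or> g *v e = - e)"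
      by (rule orthogonal_invariant_line_exists[OF orth dim1]) (use Hx a in \<open>auto simp: card_insert_if\<close>)
    then show thesis
      using that by auto
  qed
  obtain c where c: "norm c = 1" "x \<bullet> c = 0" "a \<bullet> c = 0" "b \<bullet> c = 0"
      "\<And>g. g \<in> ?H \<Longrightarrow> g *v c = c \<or> g *v c = - c"
  proof -
    have "\<exists>e. norm e = 1 \<and> (\<forall>v\<in>{x, a, b}. v \<bullet> e = 0) \<and> (\<forall>g\<in>?H. g *v e = e \<or> g *v e = - e)"
      by (rule orthogonal_invariant_line_exists[OF orth dim1]) (use Hx a b in \<open>auto simp: card_insert_if\<close>)
    then show thesis
      using that by auto
  qed
  have nz: "e \<noteq> - e" if "norm e = 1" for e :: R4
  proof
    assume "e = - e"
    then have "2 *\<^sub>R e = 0"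
      by (metis add.right_inverse scaleR_2)
    then show False
      using that by auto
  qed
  have nontriv: "\<exists>g\<in>?H. g *v e = - e"
    if e: "norm e = 1" "x \<bullet> e = 0" "\<And>g. g \<in> ?H \<Longrightarrow> g *v e = e \<or> g *v e = - e" for e
  proof (rule ccontr)
    define e' where "e' = x /\<^sub>R norm x"
    assume "\<not> ?thesis"
    then have all: "g *v e = e \<and> g *v e' = e'" if "g \<in> ?H" for g
      using e that Hx by (auto simp: e'_def matrix_vector_mult_scaleR)
    have n: "norm e' = 1"
      using x by (simp add: e'_def)
    have "equivalent_subspaces ?H (span {e}) (span {e'})"
      using all by (intro equal_characters_equivalent e n) auto
    moreover have "irreducible_subspace ?H (span {e})" "irreducible_subspace ?H (span {e'})"
      using all e n by (auto intro!: span_line_irreducible)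
    ultimately have "span {e'} = span {e}"
      using irreducible_subspace_line(2)[OF dim1] by blast
    then have "e \<in> span {e'}"
      by (simp add: span_base)
    then obtain k where "e = k *\<^sub>R e'"
      using span_singletonD by blast
    then have "e \<bullet> e = 0"
      using e(2) by (simp add: e'_def inner_commute)
    then show False
      using e(1) by auto
  qed
  have sgn: "g *v a = a \<and> g *v b = b \<and> g *v c = c \<or> g *v a = a \<and> g *v b = - b \<and> g *v c = - c \<or>
        g *v a = - a \<and> g *v b = b \<and> g *v c = - c \<or> g *v a = - a \<and> g *v b = - b \<and> g *v c = c"
    if g: "g \<in> ?H" for g
  proof -
    obtain \<alpha> \<beta> \<gamma> :: real where s: "g *v a = \<alpha> *\<^sub>R a" "g *v b = \<beta> *\<^sub>R b" "g *v c = \<gamma> *\<^sub>R c"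
        "\<alpha> = 1 \<or> \<alpha> = -1" "\<beta> = 1 \<or> \<beta> = -1" "\<gamma> = 1 \<or> \<gamma> = -1"
      using a(3)[OF g] b(4)[OF g] c(5)[OF g] by (metis scaleR_minus1_left scaleR_one)
    have "\<alpha> * \<beta> * \<gamma> = 1"
      using det_orthonormal_four[OF a(1) b(1) c(1) x a(2) b(2) c(2) b(3) c(3) c(4) Hx[OF g] s(1-3)]
        det[OF g] by simp
    then show ?thesis
      using s by (elim disjE) simp_all
  qed
  have mult: "g ** h \<in> ?H" if "g \<in> ?H" "h \<in> ?H" for g h
    using that G(1) by (auto simp: isotropy_def matrix_group_def matrix_vector_mul_assoc[symmetric])
  have not_eq: "a \<noteq> - a" "b \<noteq> - b" "c \<noteq> - c"
    using nz a(1) b(1) c(1) by auto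
  \<comment> \<open>With signs as real factors, the pattern of a product of two elements is the
    product of their patterns.\<close>
  define P where "P \<alpha> \<beta> \<gamma> \<longleftrightarrow>
    (\<exists>g\<in>?H. g *v a = \<alpha> *\<^sub>R a \<and> g *v b = \<beta> *\<^sub>R b \<and> g *v c = \<gamma> *\<^sub>R c)" for \<alpha> \<beta> \<gamma> :: real
  have P_I: "P \<alpha> \<beta> \<gamma>" if "g \<in> ?H" "g *v a = \<alpha> *\<^sub>R a" "g *v b = \<beta> *\<^sub>R b" "g *v c = \<gamma> *\<^sub>R c"
    for g \<alpha> \<beta> \<gamma>
    unfolding P_def using that by blast
  have P_mult: "P (\<alpha> * \<alpha>') (\<beta> * \<beta>') (\<gamma> * \<gamma>')" if g: "P \<alpha> \<beta> \<gamma>" and h: "P \<alpha>' \<beta>' \<gamma>'" for \<alpha> \<beta> \<gamma> \<alpha>' \<beta>' \<gamma>'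
  proof -
    obtain g where g: "g \<in> ?H" "g *v a = \<alpha> *\<^sub>R a" "g *v b = \<beta> *\<^sub>R b" "g *v c = \<gamma> *\<^sub>R c"
      using g by (auto simp: P_def)
    obtain h where h: "h \<in> ?H" "h *v a = \<alpha>' *\<^sub>R a" "h *v b = \<beta>' *\<^sub>R b" "h *v c = \<gamma>' *\<^sub>R c"
      using h by (auto simp: P_def)
    show ?thesis
      unfolding P_def
      by (rule bexI[of _ "g ** h"])
        (simp_all add: mult g h matrix_vector_mul_assoc[symmetric] matrix_vector_mult_scaleR)
  qed
  have P23: "P (-1) 1 (-1) \<or> P (-1) (-1) 1"
  proof -
    obtain g where g: "g \<in> ?H" "g *v a = - a"
      using nontriv[OF a] by blast
    have "g *v b = b \<and> g *v c = - c \<or> g *v b = - b \<and> g *v c = c"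
      using sgn[OF g(1)] not_eq g(2) by (elim disjE) simp_all
    then show ?thesis
      using P_I[OF g(1), of "-1" 1 "-1"] P_I[OF g(1), of "-1" "-1" 1] g(2) by (elim disjE) simp_all
  qed
  have P13: "P 1 (-1) (-1) \<or> P (-1) (-1) 1"
  proof -
    obtain g where g: "g \<in> ?H" "g *v b = - b"
      using nontriv[OF b(1,2,4)] by blast
    have "g *v a = a \<and> g *v c = - c \<or> g *v a = - a \<and> g *v c = c"
      using sgn[OF g(1)] not_eq g(2) by (elim disjE) simp_all
    then show ?thesis
      using P_I[OF g(1), of 1 "-1" "-1"] P_I[OF g(1), of "-1" "-1" 1] g(2) by (elim disjE) simp_all
  qed
  have P12: "P 1 (-1) (-1) \<or> P (-1) 1 (-1)"
  proof -
    obtain g where g: "g \<in> ?H" "g *v c = - c"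
      using nontriv[OF c(1,2,5)] by blast
    have "g *v a = a \<and> g *v b = - b \<or> g *v a = - a \<and> g *v b = b"
      using sgn[OF g(1)] not_eq g(2) by (elim disjE) simp_all
    then show ?thesis
      using P_I[OF g(1), of 1 "-1" "-1"] P_I[OF g(1), of "-1" 1 "-1"] g(2) by (elim disjE) simp_all
  qed
  \<comment> \<open>Of any two half-turns at least one is present, so at most one is missing, and it
    is the product of the other two.\<close>
  have "P 1 (-1) (-1)" "P (-1) 1 (-1)" "P (-1) (-1) 1"
    using P12 P13 P23 P_mult[of 1 "-1" "-1" "-1" 1 "-1"] P_mult[of 1 "-1" "-1" "-1" "-1" 1]
      P_mult[of "-1" 1 "-1" "-1" "-1" 1] by auto
  then have P: "\<exists>g\<in>G. g *v x = x \<and> g *v a = a \<and> g *v b = - b \<and> g *v c = - c"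
     "\<exists>g\<in>G. g *v x = x \<and> g *v a = - a \<and> g *v b = b \<and> g *v c = - c"
     "\<exists>g\<in>G. g *v x = x \<and> g *v a = - a \<and> g *v b = - b \<and> g *v c = c"
    unfolding P_def isotropy_def by auto
  have "half_turn_frame G x a b c"
    unfolding half_turn_frame_def
    using P a(1,2) b(1-3) c(1-4) x sgn by (simp add: isotropy_def)
  then show ?thesis
    by blast
qed

section \<open>Continuously differentiable vector fields\<close>

lemma smooth_differentiable: "smooth f \<Longrightarrow> f differentiable (at x)"
  unfolding smooth_def by (metis C_k.simps(2))

lemma smooth_has_derivative: "smooth f \<Longrightarrow> (f has_derivative frechet_derivative f (at x)) (at x)"
  using smooth_differentiable frechet_derivative_works by blast

lemma smooth_derivative_continuous:
  assumes "smooth f"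
  shows "continuous_on UNIV (\<lambda>x. frechet_derivative f (at x) v)"
proof -
  have "C_k (Suc 0) f"
    using assms by (simp add: smooth_def)
  then show ?thesis
    by simp
qed

lemma smooth_linear_derivative: "smooth f \<Longrightarrow> linear (frechet_derivative f (at x))"
  using smooth_differentiable linear_frechet_derivative by blast

text \<open>Smoothness is defined by continuity of the derivative in one direction at a time, while
  the mean value inequality needs the operator norm. This bound leads from one to the other.\<close>

lemma onorm_le_sum_Basis:
  fixes h :: "'a::euclidean_space \<Rightarrow> 'b::euclidean_space"
  assumes "linear h"
  shows "onorm h \<le> (\<Sum>b\<in>Basis. norm (h b))"
proof (rule onorm_bound)
  show "0 \<le> (\<Sum>b\<in>Basis. norm (h b))"
    by (simp add: sum_nonneg)
  fix x
  have "h x = h (\<Sum>b\<in>Basis. (x \<bullet> b) *\<^sub>R b)"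
    by (simp add: euclidean_representation)
  also have "\<dots> = (\<Sum>b\<in>Basis. (x \<bullet> b) *\<^sub>R h b)"
    using assms by (simp add: linear_sum linear_cmul)
  finally have "norm (h x) \<le> (\<Sum>b\<in>Basis. norm ((x \<bullet> b) *\<^sub>R h b))"
    by (simp add: norm_sum del: norm_scaleR)
  also have "\<dots> \<le> (\<Sum>b\<in>Basis. norm (h b) * norm x)"
  proof (rule sum_mono)
    fix b :: 'a assume "b \<in> Basis"
    then have "norm (h b) * \<bar>x \<bullet> b\<bar> \<le> norm (h b) * norm x"
      by (intro mult_left_mono Basis_le_norm) auto
    then show "norm ((x \<bullet> b) *\<^sub>R h b) \<le> norm (h b) * norm x"
      by (simp add: mult.commute)
  qed
  finally show "norm (h x) \<le> (\<Sum>b\<in>Basis. norm (h b)) * norm x"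
    by (simp add: sum_distrib_right)
qed

text \<open>The mean value inequality, applied to \<open>f\<close> minus its linear part at
  \<open>\<xi>\<close>. Comparing two arbitrary points near \<open>\<xi>\<close>, and not only a
  point with \<open>\<xi>\<close>, is what the estimate for differences of solutions needs.\<close>

lemma smooth_strictly_differentiable:
  fixes f :: "R4 \<Rightarrow> R4"
  assumes f: "smooth f" and "\<epsilon> > 0"
  shows "\<exists>r>0. \<forall>y\<in>ball \<xi> r. \<forall>z\<in>ball \<xi> r.
           norm (f y - f z - frechet_derivative f (at \<xi>) (y - z)) \<le> \<epsilon> * norm (y - z)"
proof -
  let ?D = "\<lambda>y. frechet_derivative f (at y)"
  define S where "S y = (\<Sum>b\<in>Basis. norm (?D y b - ?D \<xi> b))" for y
  have "continuous_on UNIV S"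
    unfolding S_def by (intro continuous_intros smooth_derivative_continuous f)
  then have "isCont S \<xi>"
    by (simp add: continuous_on_eq_continuous_at)
  moreover have "S \<xi> = 0"
    by (simp add: S_def)
  ultimately obtain r where r: "r > 0" "\<And>y. dist y \<xi> < r \<Longrightarrow> dist (S y) 0 < \<epsilon>"
    using \<open>\<epsilon> > 0\<close> unfolding continuous_at_eps_delta by (metis dist_norm)
  have lin: "linear (?D y)" for y
    by (rule smooth_linear_derivative[OF f])
  have "norm ((f y - ?D \<xi> y) - (f z - ?D \<xi> z)) \<le> \<epsilon> * norm (y - z)"
    if "y \<in> ball \<xi> r" "z \<in> ball \<xi> r" for y z
  proof (rule differentiable_bound[of "ball \<xi> r" "\<lambda>y. f y - ?D \<xi> y" "\<lambda>w v. ?D w v - ?D \<xi> v" \<epsilon>])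
    fix w assume w: "w \<in> ball \<xi> r"
    have "((\<lambda>y. f y - ?D \<xi> y) has_derivative (\<lambda>v. ?D w v - ?D \<xi> v)) (at w)"
      using linear_linear lin by (intro has_derivative_diff smooth_has_derivative f bounded_linear_imp_has_derivative) blast
    then show "((\<lambda>y. f y - ?D \<xi> y) has_derivative (\<lambda>v. ?D w v - ?D \<xi> v)) (at w within ball \<xi> r)"
      by (rule has_derivative_at_withinI)
    have "onorm (\<lambda>v. ?D w v - ?D \<xi> v) \<le> S w"
      unfolding S_def by (rule onorm_le_sum_Basis) (intro linear_compose_sub lin)
    also have "\<dots> \<le> \<epsilon>"
      using r(2)[of w] w by (simp add: dist_commute dist_norm)
    finally show "onorm (\<lambda>v. ?D w v - ?D \<xi> v) \<le> \<epsilon>" .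
  qed (use that in auto)
  moreover have "(f y - ?D \<xi> y) - (f z - ?D \<xi> z) = f y - f z - ?D \<xi> (y - z)" for y z
    using linear_diff[OF lin] by simp
  ultimately show ?thesis
    using r(1) by metis
qed

lemma smooth_lipschitz_cball:
  fixes f :: "R4 \<Rightarrow> R4"
  assumes f: "smooth f"
  shows "\<exists>L\<ge>0. \<forall>y\<in>cball 0 R. \<forall>z\<in>cball 0 R. norm (f y - f z) \<le> L * norm (y - z)"
proof -
  let ?D = "\<lambda>y. frechet_derivative f (at y)"
  define S where "S y = (\<Sum>b\<in>Basis. norm (?D y b))" for y
  have "continuous_on UNIV S"
    unfolding S_def by (intro continuous_intros smooth_derivative_continuous f)
  then have "continuous_on (cball 0 R) S"
    using continuous_on_subset by blast
  then have "bounded (S ` cball 0 R)"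
    by (intro compact_imp_bounded compact_continuous_image compact_cball)
  then obtain L where L: "L > 0" "\<forall>s\<in>S ` cball 0 R. norm s \<le> L"
    unfolding bounded_pos by blast
  have "norm (f y - f z) \<le> L * norm (y - z)" if "y \<in> cball 0 R" "z \<in> cball 0 R" for y z
  proof (rule differentiable_bound[of "cball 0 R" f ?D L])
    fix w :: R4 assume w: "w \<in> cball 0 R"
    show "(f has_derivative ?D w) (at w within cball 0 R)"
      by (rule has_derivative_at_withinI[OF smooth_has_derivative[OF f]])
    have "onorm (?D w) \<le> S w"
      unfolding S_def by (rule onorm_le_sum_Basis[OF smooth_linear_derivative[OF f]])
    moreover have "norm (S w) \<le> L"
      using L(2) w by blast
    ultimately show "onorm (?D w) \<le> L"
      by simp
  qed (use that in auto)
  then show ?thesis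
    using L(1) by (intro exI[of _ L]) auto
qed

section \<open>Solutions\<close>

lemma has_real_derivative_inner_self:
  fixes x :: "real \<Rightarrow> 'a::real_inner"
  assumes "(x has_vector_derivative x') (at t within S)"
  shows "((\<lambda>u. x u \<bullet> x u) has_real_derivative 2 * (x t \<bullet> x')) (at t within S)"
proof -
  have "((\<lambda>u. x u \<bullet> x u) has_derivative (\<lambda>h. x t \<bullet> (h *\<^sub>R x') + (h *\<^sub>R x') \<bullet> x t)) (at t within S)"
    using assms unfolding has_vector_derivative_def by (rule has_derivative_inner) (use assms in \<open>simp add: has_vector_derivative_def\<close>)
  then show ?thesis
    unfolding has_field_derivative_def
    by (rule has_derivative_eq_rhs) (auto simp: inner_commute algebra_simps)
qed

lemma derivative_nonneg_imp_le:
  fixes w :: "real \<Rightarrow> real"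
  assumes "s \<le> t" and "\<And>u. u \<in> {s..t} \<Longrightarrow> (w has_real_derivative w' u) (at u within {s..t})"
    and "\<And>u. u \<in> {s..t} \<Longrightarrow> 0 \<le> w' u"
  shows "w s \<le> w t"
proof (cases "s = t")
  case False
  then have "s < t"
    using assms by simp
  then obtain u where "u \<in> {s<..<t}" "w t - w s = w' u * (t - s)"
    using mvt_simple[of s t w "\<lambda>u h. w' u * h"] assms(2) by (auto simp: has_field_derivative_def)
  moreover have "0 \<le> w' u * (t - s)"
    using assms(3)[of u] \<open>s < t\<close> calculation(1) by simp
  ultimately show ?thesis
    by linarith
qed simp

lemma solution_on_subset: "solution_on f I x \<Longrightarrow> J \<subseteq> I \<Longrightarrow> solution_on f J x"
  unfolding solution_on_def by (meson has_vector_derivative_within_subset subsetD)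

lemma solution_on_continuous: "solution_on f I x \<Longrightarrow> continuous_on I x"
  unfolding solution_on_def continuous_on_eq_continuous_within
  using has_vector_derivative_continuous by blast

text \<open>A Gronwall argument: both solutions stay in a ball on the compact interval between
  \<open>s\<close> and \<open>t\<close>. With a Lipschitz constant \<open>L\<close> there, the
  squared distance times \<open>exp (-2 * L * u)\<close> does not increase, and times
  \<open>exp (2 * L * u)\<close> it does not decrease. The first serves for
  \<open>s \<le> t\<close>, the second for \<open>t < s\<close>.\<close>

lemma solution_unique:
  fixes f :: "R4 \<Rightarrow> R4"
  assumes f: "smooth f" and I: "is_interval I"
    and x: "solution_on f I x" and y: "solution_on f I y"
    and s: "s \<in> I" "x s = y s" and t: "t \<in> I"
  shows "x t = y t"
proof -
  define a b where "a = min s t" and "b = max s t"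
  have "\<forall>u\<in>{a..b}. u \<in> I"
    using I s(1) t unfolding is_interval_1 a_def b_def
    by (metis atLeastAtMost_iff max_def min_def)
  then have J: "{a..b} \<subseteq> I"
    by blast
  note xJ = solution_on_subset[OF x J] and yJ = solution_on_subset[OF y J]
  have "bounded (x ` {a..b} \<union> y ` {a..b})"
    by (simp add: compact_imp_bounded compact_continuous_image solution_on_continuous[OF xJ]
        solution_on_continuous[OF yJ])
  then obtain R where R: "\<forall>u\<in>x ` {a..b} \<union> y ` {a..b}. norm u \<le> R"
    unfolding bounded_iff by blast
  obtain L where L: "L \<ge> 0" "\<And>y z. y \<in> cball 0 R \<Longrightarrow> z \<in> cball 0 R \<Longrightarrow> norm (f y - f z) \<le> L * norm (y - z)"
    using smooth_lipschitz_cball[OF f, of R] by blast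
  define z where "z u = x u - y u" for u
  define z' where "z' u = f (x u) - f (y u)" for u
  have z: "(z has_vector_derivative z' u) (at u within {a..b})" if "u \<in> {a..b}" for u
    using xJ yJ that unfolding solution_on_def z_def z'_def
    by (intro has_vector_derivative_diff) auto
  have bnd: "\<bar>z u \<bullet> z' u\<bar> \<le> L * (z u \<bullet> z u)" if "u \<in> {a..b}" for u
  proof -
    have "norm (z' u) \<le> L * norm (z u)"
      unfolding z_def z'_def using R that by (intro L(2)) (auto simp: dist_norm)
    then have "norm (z u) * norm (z' u) \<le> norm (z u) * (L * norm (z u))"
      by (intro mult_left_mono) auto
    then show ?thesis
      using Cauchy_Schwarz_ineq2[of "z u" "z' u"]
      by (simp add: dot_square_norm power2_eq_square algebra_simps)
  qed
  have D: "((\<lambda>u. (z u \<bullet> z u) * exp (k * u)) has_real_derivative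
      (2 * (z u \<bullet> z' u) + k * (z u \<bullet> z u)) * exp (k * u)) (at u within {a..b})" if "u \<in> {a..b}" for u k
    by (rule derivative_eq_intros refl has_real_derivative_inner_self[OF z[OF that]] | simp add: algebra_simps)+
  have "z t \<bullet> z t \<le> 0"
  proof (cases "s \<le> t")
    case True
    then have ab: "a = s" "b = t"
      by (auto simp: a_def b_def)
    have "- ((z s \<bullet> z s) * exp ((- 2 * L) * s)) \<le> - ((z t \<bullet> z t) * exp ((- 2 * L) * t))"
    proof (rule derivative_nonneg_imp_le[where w = "\<lambda>u. - ((z u \<bullet> z u) * exp ((- 2 * L) * u))"
          and w' = "\<lambda>u. - ((2 * (z u \<bullet> z' u) + (- 2 * L) * (z u \<bullet> z u)) * exp ((- 2 * L) * u))", OF True])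
      fix u assume u: "u \<in> {s..t}"
      show "((\<lambda>u. - ((z u \<bullet> z u) * exp ((- 2 * L) * u))) has_real_derivative
          - ((2 * (z u \<bullet> z' u) + (- 2 * L) * (z u \<bullet> z u)) * exp ((- 2 * L) * u))) (at u within {s..t})"
        by (rule DERIV_minus) (use D u ab in blast)
      show "0 \<le> - ((2 * (z u \<bullet> z' u) + (- 2 * L) * (z u \<bullet> z u)) * exp ((- 2 * L) * u))"
        using bnd[of u] u ab by (simp add: mult_le_0_iff)
    qed
    then show ?thesis
      using s by (simp add: z_def mult_le_0_iff)
  next
    case False
    then have ab: "a = t" "b = s"
      by (auto simp: a_def b_def)
    have "(z t \<bullet> z t) * exp ((2 * L) * t) \<le> (z s \<bullet> z s) * exp ((2 * L) * s)"
    proof (rule derivative_nonneg_imp_le[where w = "\<lambda>u. (z u \<bullet> z u) * exp ((2 * L) * u)"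
          and w' = "\<lambda>u. (2 * (z u \<bullet> z' u) + (2 * L) * (z u \<bullet> z u)) * exp ((2 * L) * u)"])
      show "t \<le> s"
        using False by simp
      fix u assume u: "u \<in> {t..s}"
      show "((\<lambda>u. (z u \<bullet> z u) * exp ((2 * L) * u)) has_real_derivative
          ((2 * (z u \<bullet> z' u) + (2 * L) * (z u \<bullet> z u)) * exp ((2 * L) * u))) (at u within {t..s})"
        using D u ab by blast
      show "0 \<le> (2 * (z u \<bullet> z' u) + (2 * L) * (z u \<bullet> z u)) * exp ((2 * L) * u)"
        using bnd[of u] u ab by (simp add: zero_le_mult_iff)
    qed
    then show ?thesis
      using s by (simp add: z_def mult_le_0_iff)
  qed
  then have "z t \<bullet> z t = 0"
    using inner_ge_zero[of "z t"] by linarith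
  then show ?thesis
    by (simp add: z_def)
qed

lemma solution_on_shift:
  assumes "solution_on f UNIV x"
  shows "solution_on f UNIV (\<lambda>u. x (u + c))"
  unfolding solution_on_def
proof
  fix t
  have "((\<lambda>u. u + c) has_vector_derivative 1) (at t)"
    by (auto intro!: derivative_eq_intros simp: has_vector_derivative_def)
  moreover have "(x has_vector_derivative f (x (t + c))) (at (t + c))"
    using assms by (simp add: solution_on_def)
  ultimately have "(x \<circ> (\<lambda>u. u + c) has_vector_derivative 1 *\<^sub>R f (x (t + c))) (at t)"
    by (rule vector_diff_chain_at)
  then show "((\<lambda>u. x (u + c)) has_vector_derivative f (x (t + c))) (at t)"
    by (simp add: o_def)
qed

text \<open>The system is autonomous: after a shift of time the two solutions agree at one instant,
  hence always.\<close>

lemma solutions_meet_imp_range_eq: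
  fixes f :: "R4 \<Rightarrow> R4"
  assumes f: "smooth f" and x: "solution_on f UNIV x" and y: "solution_on f UNIV y"
    and "x s = y t"
  shows "x u = y (u + (t - s))" and "range x = range y"
proof -
  have *: "x u = y (u + (t - s))" for u
    by (rule solution_unique[OF f is_interval_univ x solution_on_shift[OF y], of s]) (use assms in auto)
  then show "x u = y (u + (t - s))" .
  have "y u = x (u + (s - t))" for u
    using * by simp
  with * show "range x = range y"
    by (metis (mono_tags, lifting) image_subset_iff rangeI subset_antisym)
qed

lemma solution_on_symmetry:
  assumes "\<And>x. f (g *v x) = g *v f x" and "solution_on f I x"
  shows "solution_on f I (\<lambda>t. g *v x t)"
  using assms bounded_linear.has_vector_derivative[OF matrix_vector_mul_bounded_linear[of g]]
  unfolding solution_on_def by simp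

lemma solution_on_const: "f \<xi> = 0 \<Longrightarrow> solution_on f I (\<lambda>_. \<xi>)"
  by (simp add: solution_on_def)

text \<open>Every symmetry in \<open>H\<close> maps the solution to a solution with the same value
  at \<open>s\<close>, which by uniqueness is the same one.\<close>

lemma solution_in_Fix:
  fixes f :: "R4 \<Rightarrow> R4"
  assumes f: "smooth f" and eq: "\<And>g x. g \<in> H \<Longrightarrow> f (g *v x) = g *v f x"
    and x: "solution_on f UNIV x" and "x s \<in> Fix H"
  shows "x t \<in> Fix H"
  unfolding Fix_def
proof safe
  fix g assume g: "g \<in> H"
  show "g *v x t = x t"
    by (rule solution_unique[OF f is_interval_univ solution_on_symmetry[OF eq[OF g] x] x, of s])
      (use assms g in \<open>auto simp: Fix_def\<close>)
qed

section \<open>Saddles\<close>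

text \<open>Near \<open>\<xi>\<close> the remainder of the linearisation is at most
  \<open>c * norm z\<close>, so the distance to \<open>\<xi>\<close> does not increase in time. As
  it tends to 0 at \<open>at_bot\<close>, it is 0 at early times.\<close>

lemma no_trajectory_leaves_sink:
  fixes f :: "R4 \<Rightarrow> R4"
  assumes f: "smooth f" and "f \<xi> = 0" and x: "solution_on f UNIV x"
    and lim: "(x \<longlongrightarrow> \<xi>) at_bot" and P: "subspace P" "\<xi> \<in> P" "\<And>t. x t \<in> P"
    and c: "c > 0" "\<And>v. v \<in> P \<Longrightarrow> v \<bullet> frechet_derivative f (at \<xi>) v \<le> - c * (v \<bullet> v)"
  shows "\<exists>t. x t = \<xi>"
proof -
  let ?A = "frechet_derivative f (at \<xi>)"
  obtain r where r: "r > 0" "\<forall>y\<in>ball \<xi> r. \<forall>z\<in>ball \<xi> r. norm (f y - f z - ?A (y - z)) \<le> c * norm (y - z)"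
    using smooth_strictly_differentiable[OF f c(1)] by blast
  from lim r(1) have "\<forall>\<^sub>F t in at_bot. dist (x t) \<xi> < r"
    by (rule tendstoD)
  then obtain T where T: "\<And>t. t \<le> T \<Longrightarrow> dist (x t) \<xi> < r"
    by (auto simp: eventually_at_bot_linorder)
  define z where "z t = x t - \<xi>" for t
  have z: "(z has_vector_derivative f (x t)) (at t within S)" for t S
  proof (rule has_vector_derivative_at_within)
    have "(x has_vector_derivative f (x t)) (at t)"
      using x by (simp add: solution_on_def)
    from has_vector_derivative_diff[OF this has_vector_derivative_const[of \<xi>]]
    show "(z has_vector_derivative f (x t)) (at t)"
      by (simp add: z_def[abs_def])
  qed
  have neg: "z t \<bullet> f (x t) \<le> 0" if "t \<le> T" for t
  proof -
    have "norm (f (x t) - f \<xi> - ?A (x t - \<xi>)) \<le> c * norm (x t - \<xi>)"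
      using r T[OF that] by (simp add: dist_commute)
    then have n: "norm (f (x t) - ?A (z t)) \<le> c * norm (z t)"
      by (simp add: assms(2) z_def)
    have "z t \<bullet> (f (x t) - ?A (z t)) \<le> norm (z t) * norm (f (x t) - ?A (z t))"
      by (rule norm_cauchy_schwarz)
    also have "\<dots> \<le> norm (z t) * (c * norm (z t))"
      using n by (rule mult_left_mono) simp
    also have "\<dots> = c * (z t \<bullet> z t)"
      by (simp add: dot_square_norm power2_eq_square)
    finally have "z t \<bullet> f (x t) \<le> z t \<bullet> ?A (z t) + c * (z t \<bullet> z t)"
      by (simp add: inner_diff_right)
    moreover have "z t \<bullet> ?A (z t) \<le> - c * (z t \<bullet> z t)"
      using P by (intro c(2)) (simp add: z_def subspace_diff)
    ultimately show ?thesis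
      by simp
  qed
  have le: "z T \<bullet> z T \<le> z s \<bullet> z s" if "s \<le> T" for s
  proof -
    have "- (z s \<bullet> z s) \<le> - (z T \<bullet> z T)"
    proof (rule derivative_nonneg_imp_le[where w = "\<lambda>u. - (z u \<bullet> z u)"
          and w' = "\<lambda>u. - (2 * (z u \<bullet> f (x u)))", OF that])
      fix u assume "u \<in> {s..T}"
      show "((\<lambda>u. - (z u \<bullet> z u)) has_real_derivative - (2 * (z u \<bullet> f (x u)))) (at u within {s..T})"
        by (rule DERIV_minus[OF has_real_derivative_inner_self[OF z]])
      show "0 \<le> - (2 * (z u \<bullet> f (x u)))"
        using neg[of u] \<open>u \<in> {s..T}\<close> by simp
    qed
    then show ?thesis
      by simp
  qed
  have "(z \<longlongrightarrow> 0) at_bot"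
    using tendsto_diff[OF lim tendsto_const[of \<xi>]] by (simp add: z_def[abs_def])
  then have "((\<lambda>t. z t \<bullet> z t) \<longlongrightarrow> 0) at_bot"
    using tendsto_inner by fastforce
  moreover have "\<forall>\<^sub>F s in at_bot. z T \<bullet> z T \<le> z s \<bullet> z s"
    using le by (auto simp: eventually_at_bot_linorder)
  ultimately have "z T \<bullet> z T \<le> 0"
    by (intro tendsto_lowerbound[of "\<lambda>t. z t \<bullet> z t" 0 at_bot]) auto
  then have "z T \<bullet> z T = 0"
    using inner_ge_zero[of "z T"] by linarith
  then have "x T = \<xi>"
    by (simp add: z_def)
  then show ?thesis ..
qed

lemma span_pairD:
  assumes "y \<in> span {u, v}"
  shows "\<exists>k l. y = k *\<^sub>R u + l *\<^sub>R v"
proof -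
  obtain k where "y - k *\<^sub>R u \<in> span {v}"
    using assms by (auto simp: span_breakdown_eq)
  then obtain l where "y - k *\<^sub>R u = l *\<^sub>R v"
    by (auto simp: span_singleton)
  then have "y = k *\<^sub>R u + l *\<^sub>R v"
    by (simp add: algebra_simps)
  then show ?thesis
    by blast
qed

text \<open>The cone condition: \<open>(\<delta> \<bullet> e)\<^sup>2 - (\<delta> \<bullet> u)\<^sup>2\<close> does not decrease along the difference \<open>\<delta>\<close> of two
  solutions near the saddle, and it vanishes in the limit \<open>t \<rightarrow> - \<infinity>\<close>.\<close>

lemma saddle_cone_condition:
  fixes f :: "R4 \<Rightarrow> R4"
  assumes f: "smooth f" and u: "norm u = 1" "norm e = 1" "u \<bullet> e = 0"
    and A: "frechet_derivative f (at \<xi>) u = - \<alpha> *\<^sub>R u" "frechet_derivative f (at \<xi>) e = \<beta> *\<^sub>R e"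
      "\<alpha> > 0" "\<beta> > 0"
  shows "\<exists>r>0. \<forall>x y. solution_on f UNIV x \<longrightarrow> solution_on f UNIV y \<longrightarrow>
      (x \<longlongrightarrow> \<xi>) at_bot \<longrightarrow> (y \<longlongrightarrow> \<xi>) at_bot \<longrightarrow>
      (\<forall>t\<le>0. x t \<in> ball \<xi> r \<and> y t \<in> ball \<xi> r \<and> x t - y t \<in> span {u, e}) \<longrightarrow>
      ((x 0 - y 0) \<bullet> u)\<^sup>2 \<le> ((x 0 - y 0) \<bullet> e)\<^sup>2"
proof -
  let ?A = "frechet_derivative f (at \<xi>)"
  define m where "m = min \<alpha> \<beta>"
  have m: "m > 0" "m \<le> \<alpha>" "m \<le> \<beta>"
    using A by (auto simp: m_def)
  \<comment> \<open>Two remainder terms, each at most \<open>m/2\<close> times the squared norm of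
    the difference, are outweighed by the linear part, which is at least \<open>m\<close> times
    it.\<close>
  obtain r where r: "r > 0" "\<forall>y\<in>ball \<xi> r. \<forall>z\<in>ball \<xi> r. norm (f y - f z - ?A (y - z)) \<le> (m/2) * norm (y - z)"
    using smooth_strictly_differentiable[OF f, of "m/2" \<xi>] m(1) by auto
  have "((x 0 - y 0) \<bullet> u)\<^sup>2 \<le> ((x 0 - y 0) \<bullet> e)\<^sup>2"
    if x: "solution_on f UNIV x" "solution_on f UNIV y" and lim: "(x \<longlongrightarrow> \<xi>) at_bot" "(y \<longlongrightarrow> \<xi>) at_bot"
      and near: "\<And>t. t \<le> 0 \<Longrightarrow> x t \<in> ball \<xi> r \<and> y t \<in> ball \<xi> r \<and> x t - y t \<in> span {u, e}"
    for x y
  proof -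
    define z where "z t = x t - y t" for t
    define z' where "z' t = f (x t) - f (y t)" for t
    define Q where "Q t = (z t \<bullet> e)\<^sup>2 - (z t \<bullet> u)\<^sup>2" for t
    have z: "(z has_vector_derivative z' t) (at t within S)" for t S
    proof (rule has_vector_derivative_at_within)
      show "(z has_vector_derivative z' t) (at t)"
        using x unfolding z_def[abs_def] z'_def solution_on_def
        by (intro has_vector_derivative_diff) simp_all
    qed
    have zi: "((\<lambda>t. z t \<bullet> w) has_real_derivative (z' t \<bullet> w)) (at t within S)" for t S w
      using bounded_linear.has_vector_derivative[OF bounded_linear_inner_left z, of w]
      by (simp add: has_real_derivative_iff_has_vector_derivative)
    have Q: "(Q has_real_derivative 2 * ((z t \<bullet> e) * (z' t \<bullet> e) - (z t \<bullet> u) * (z' t \<bullet> u))) (at t within S)" for t S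
      unfolding Q_def by (rule derivative_eq_intros zi refl | simp add: algebra_simps)+
    have nonneg: "0 \<le> 2 * ((z t \<bullet> e) * (z' t \<bullet> e) - (z t \<bullet> u) * (z' t \<bullet> u))" if t: "t \<le> 0" for t
    proof -
      define p q where "p = z t \<bullet> e" and "q = z t \<bullet> u"
      define d where "d = z' t - ?A (z t)"
      obtain k l where kl: "z t = k *\<^sub>R u + l *\<^sub>R e"
        using near[OF t] span_pairD unfolding z_def by blast
      have pq: "q = k" "p = l"
        using u by (simp_all add: p_def q_def kl inner_add_left inner_add_right inner_commute dot_square_norm)
      have lin: "linear ?A"
        by (rule smooth_linear_derivative[OF f])
      have "?A (z t) = (- \<alpha> * q) *\<^sub>R u + (\<beta> * p) *\<^sub>R e"
        by (simp add: kl pq linear_add[OF lin] linear_cmul[OF lin] A mult.commute)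
      then have Az: "?A (z t) \<bullet> u = - \<alpha> * q" "?A (z t) \<bullet> e = \<beta> * p"
        using u by (simp_all add: inner_add_left inner_add_right inner_diff_left inner_diff_right
            inner_commute dot_square_norm)
      have "u \<bullet> u = 1" "e \<bullet> e = 1"
        using u by (simp_all add: dot_square_norm)
      then have nz: "(norm (z t))\<^sup>2 = p\<^sup>2 + q\<^sup>2"
        unfolding pq kl power2_norm_eq_inner using u(3)
        by (simp add: inner_add_left inner_add_right inner_commute power2_eq_square)
      have nd: "norm d \<le> (m/2) * norm (z t)"
        using r(2) near[OF t] unfolding d_def z_def z'_def by blast
      have "\<bar>d \<bullet> e\<bar> \<le> norm d" "\<bar>d \<bullet> u\<bar> \<le> norm d"
        using Cauchy_Schwarz_ineq2[of d e] Cauchy_Schwarz_ineq2[of d u] u by simp_all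
      moreover have "\<bar>p\<bar> \<le> norm (z t)" "\<bar>q\<bar> \<le> norm (z t)"
        using Cauchy_Schwarz_ineq2[of "z t" e] Cauchy_Schwarz_ineq2[of "z t" u] u by (simp_all add: p_def q_def)
      ultimately have "\<bar>p * (d \<bullet> e)\<bar> \<le> norm (z t) * ((m/2) * norm (z t))"
          "\<bar>q * (d \<bullet> u)\<bar> \<le> norm (z t) * ((m/2) * norm (z t))"
        using nd unfolding abs_mult by (intro mult_mono; simp)+
      moreover have "norm (z t) * ((m/2) * norm (z t)) + norm (z t) * ((m/2) * norm (z t)) = m * (norm (z t))\<^sup>2"
        by (simp add: power2_eq_square algebra_simps)
      ultimately have "\<bar>p * (d \<bullet> e)\<bar> + \<bar>q * (d \<bullet> u)\<bar> \<le> m * (norm (z t))\<^sup>2"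
        by linarith
      then have 1: "\<bar>p * (d \<bullet> e)\<bar> + \<bar>q * (d \<bullet> u)\<bar> \<le> m * p\<^sup>2 + m * q\<^sup>2"
        by (simp add: nz algebra_simps)
      have arith: "0 \<le> 2 * X" if "X = A + B + a - b" "C \<le> A" "D \<le> B" "\<bar>a\<bar> + \<bar>b\<bar> \<le> C + D"
        for X A B C D a b :: real
        using that by linarith
      have zz: "z' t \<bullet> e = \<beta> * p + d \<bullet> e" "z' t \<bullet> u = - \<alpha> * q + d \<bullet> u"
        using Az by (simp_all add: d_def inner_diff_left)
      have "p * (z' t \<bullet> e) - q * (z' t \<bullet> u) = \<beta> * p\<^sup>2 + \<alpha> * q\<^sup>2 + p * (d \<bullet> e) - q * (d \<bullet> u)"
        unfolding zz by (simp add: algebra_simps power2_eq_square)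
      moreover have "m * p\<^sup>2 \<le> \<beta> * p\<^sup>2" "m * q\<^sup>2 \<le> \<alpha> * q\<^sup>2"
        using m by (auto intro: mult_right_mono)
      ultimately show ?thesis
        using 1 arith unfolding p_def[symmetric] q_def[symmetric] by blast
    qed
    have le: "Q s \<le> Q 0" if "s \<le> 0" for s
      by (rule derivative_nonneg_imp_le[OF that Q]) (use nonneg in auto)
    have "(z \<longlongrightarrow> 0) at_bot"
      using tendsto_diff[OF lim] by (simp add: z_def[abs_def])
    then have "(Q \<longlongrightarrow> (0 \<bullet> e)\<^sup>2 - (0 \<bullet> u)\<^sup>2) at_bot"
      unfolding Q_def by (intro tendsto_intros)
    moreover have "\<forall>\<^sub>F s in at_bot. Q s \<le> Q 0"
      using le by (auto simp: eventually_at_bot_linorder)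
    ultimately have "0 \<le> Q 0"
      by (intro tendsto_upperbound[of Q 0 at_bot]) auto
    then show ?thesis
      by (simp add: Q_def z_def)
  qed
  then show ?thesis
    using r(1) by blast
qed


text \<open>By the cone condition, early points of trajectories that leave \<open>\<xi>\<close>
  coincide once their \<open>e\<close>-coordinates agree, since shifts in time make both of them
  values at 0. These coordinates tend to 0 and, by comparison with the constant solution, do not
  vanish at early times. If they have the same sign, the intermediate value theorem makes the
  trajectories share a point; otherwise the signs stay opposite.\<close>

lemma saddle_branches_meet:
  fixes f :: "R4 \<Rightarrow> R4"
  assumes f: "smooth f" "f \<xi> = 0" and u: "norm u = 1" "norm e = 1" "u \<bullet> e = 0" "\<xi> \<in> span {u, e}"
    and A: "frechet_derivative f (at \<xi>) u = - \<alpha> *\<^sub>R u" "frechet_derivative f (at \<xi>) e = \<beta> *\<^sub>R e"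
      "\<alpha> > 0" "\<beta> > 0"
    and x: "solution_on f UNIV x" "(x \<longlongrightarrow> \<xi>) at_bot" "\<And>t. x t \<in> span {u, e}" "\<And>t. x t \<noteq> \<xi>"
    and y: "solution_on f UNIV y" "(y \<longlongrightarrow> \<xi>) at_bot" "\<And>t. y t \<in> span {u, e}" "\<And>t. y t \<noteq> \<xi>"
  shows "(\<exists>s t. x s = y t) \<or> (\<exists>T. \<forall>s\<le>T. \<forall>t\<le>T. ((x s - \<xi>) \<bullet> e) * ((y t - \<xi>) \<bullet> e) < 0)"
proof -
  obtain r where r: "r > 0" and cone: "\<And>x y. solution_on f UNIV x \<Longrightarrow> solution_on f UNIV y \<Longrightarrow>
      (x \<longlongrightarrow> \<xi>) at_bot \<Longrightarrow> (y \<longlongrightarrow> \<xi>) at_bot \<Longrightarrow>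
      (\<forall>t\<le>0. x t \<in> ball \<xi> r \<and> y t \<in> ball \<xi> r \<and> x t - y t \<in> span {u, e}) \<Longrightarrow>
      ((x 0 - y 0) \<bullet> u)\<^sup>2 \<le> ((x 0 - y 0) \<bullet> e)\<^sup>2"
    using saddle_cone_condition[OF f(1) u(1-3) A] by blast
  have "\<forall>\<^sub>F t in at_bot. dist (x t) \<xi> < r \<and> dist (y t) \<xi> < r"
    using tendstoD[OF x(2) r] tendstoD[OF y(2) r] by (rule eventually_conj)
  then obtain T where T: "\<And>t. t \<le> T \<Longrightarrow> x t \<in> ball \<xi> r \<and> y t \<in> ball \<xi> r"
    by (auto simp: eventually_at_bot_linorder dist_commute)
  have zero: "d = 0" if "d \<in> span {u, e}" "d \<bullet> e = 0" "(d \<bullet> u)\<^sup>2 \<le> (d \<bullet> e)\<^sup>2" for d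
  proof -
    obtain k l where kl: "d = k *\<^sub>R u + l *\<^sub>R e"
      using span_pairD[OF \<open>d \<in> span {u, e}\<close>] by blast
    have d: "d \<bullet> u = k" "d \<bullet> e = l"
      using u by (simp_all add: kl inner_add_left inner_add_right inner_commute dot_square_norm)
    have "l = 0" "k\<^sup>2 \<le> l\<^sup>2"
      using that(2,3) by (simp_all only: d)
    then show ?thesis
      using kl by simp
  qed
  have lim_shift: "((\<lambda>t. w (t + c)) \<longlongrightarrow> \<xi>) at_bot" if "(w \<longlongrightarrow> \<xi>) at_bot" for w :: "real \<Rightarrow> R4" and c
  proof (rule filterlim_compose[OF that])
    show "filterlim (\<lambda>t. t + c) at_bot at_bot"
      unfolding filterlim_at_bot
    proof
      fix Z :: real
      show "\<forall>\<^sub>F t in at_bot. t + c \<le> Z"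
        unfolding eventually_at_bot_linorder by (rule exI[of _ "Z - c"]) auto
    qed
  qed
  \<comment> \<open>Including the constant solution at \<open>\<xi>\<close> lets one statement give
    both the meeting of \<open>x\<close> with \<open>y\<close> and the nonvanishing of the
    coordinates.\<close>
  have eq: "v s = w t"
    if "v = x \<or> v = y \<or> v = (\<lambda>_. \<xi>)" "w = x \<or> w = y \<or> w = (\<lambda>_. \<xi>)" and st: "s \<le> T" "t \<le> T"
      and e: "(v s - w t) \<bullet> e = 0" for v w :: "real \<Rightarrow> R4" and s t
  proof -
    have props: "solution_on f UNIV z \<and> (z \<longlongrightarrow> \<xi>) at_bot \<and> (\<forall>t. z t \<in> span {u, e}) \<and> (\<forall>t\<le>T. z t \<in> ball \<xi> r)"
      if "z = x \<or> z = y \<or> z = (\<lambda>_. \<xi>)" for z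
      using that x(1-3) y(1-3) u(4) T r solution_on_const[of f \<xi>] f(2) by auto
    note v = props[OF that(1)] and w = props[OF that(2)]
    have "((v (0 + s) - w (0 + t)) \<bullet> u)\<^sup>2 \<le> ((v (0 + s) - w (0 + t)) \<bullet> e)\<^sup>2"
    proof (rule cone)
      show "solution_on f UNIV (\<lambda>r. v (r + s))" "solution_on f UNIV (\<lambda>r. w (r + t))"
        using v w by (simp_all add: solution_on_shift)
      show "((\<lambda>r. v (r + s)) \<longlongrightarrow> \<xi>) at_bot" "((\<lambda>r. w (r + t)) \<longlongrightarrow> \<xi>) at_bot"
        using v w lim_shift by blast+
      show "\<forall>ta\<le>0. v (ta + s) \<in> ball \<xi> r \<and> w (ta + t) \<in> ball \<xi> r \<and> v (ta + s) - w (ta + t) \<in> span {u, e}"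
        using v w st by (simp add: span_diff)
    qed
    then have "v s - w t = 0"
      using zero[of "v s - w t"] v w e by (simp add: span_diff)
    then show ?thesis
      by simp
  qed
  define V where "V s = (x s - \<xi>) \<bullet> e" for s
  define W where "W t = (y t - \<xi>) \<bullet> e" for t
  have cont: "continuous_on S V" "continuous_on S W" for S
    unfolding V_def W_def
    using solution_on_continuous[OF x(1)] solution_on_continuous[OF y(1)]
    by (auto intro!: continuous_intros intro: continuous_on_subset)
  have V0: "V s \<noteq> 0" if "s \<le> T" for s
    using eq[of x "\<lambda>_. \<xi>" s s] x(4) that by (auto simp: V_def)
  have W0: "W t \<noteq> 0" if "t \<le> T" for t
    using eq[of y "\<lambda>_. \<xi>" t t] y(4) that by (auto simp: W_def)
  have lim: "(V \<longlongrightarrow> 0) at_bot" "(W \<longlongrightarrow> 0) at_bot"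
  proof -
    have "((\<lambda>s. (x s - \<xi>) \<bullet> e) \<longlongrightarrow> (\<xi> - \<xi>) \<bullet> e) at_bot" "((\<lambda>s. (y s - \<xi>) \<bullet> e) \<longlongrightarrow> (\<xi> - \<xi>) \<bullet> e) at_bot"
      by (intro tendsto_intros x(2) y(2))+
    then show "(V \<longlongrightarrow> 0) at_bot" "(W \<longlongrightarrow> 0) at_bot"
      by (simp_all add: V_def[abs_def] W_def[abs_def])
  qed
  \<comment> \<open>The coordinate of smaller modulus at \<open>T\<close> is a value through which
    the other one passes, backwards in time, on its way to 0.\<close>
  have meet: "\<exists>s\<le>T. \<exists>t\<le>T. F s = G t"
    if F: "F T * G T > 0" "\<bar>F T\<bar> \<le> \<bar>G T\<bar>" and G: "continuous_on UNIV G" "(G \<longlongrightarrow> 0) at_bot" for F G :: "real \<Rightarrow> real"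
  proof -
    have "\<bar>F T\<bar> > 0"
      using F by (auto simp: zero_less_mult_iff)
    from tendstoD[OF G(2) this] obtain S where S: "\<And>t. t \<le> S \<Longrightarrow> \<bar>G t\<bar> < \<bar>F T\<bar>"
      by (auto simp: eventually_at_bot_linorder)
    define a where "a = min S T"
    have a: "a \<le> T" "\<bar>G a\<bar> < \<bar>F T\<bar>"
      using S by (auto simp: a_def)
    have "continuous_on {a..T} G"
      using G(1) continuous_on_subset by blast
    then have "\<exists>t\<ge>a. t \<le> T \<and> G t = F T"
    proof (cases "F T > 0")
      case True
      then have "G a \<le> F T" "F T \<le> G T"
        using a F by (auto simp: zero_less_mult_iff)
      then show ?thesis
        using IVT'[OF _ _ a(1) \<open>continuous_on {a..T} G\<close>] by blast
    next
      case False
      then have "F T \<le> G a" "G T \<le> F T"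
        using a F by (auto simp: zero_less_mult_iff)
      then show ?thesis
        using IVT2'[OF _ _ a(1) \<open>continuous_on {a..T} G\<close>] by blast
    qed
    then obtain t where "t \<le> T" "G t = F T"
      by blast
    then show ?thesis
      by (intro exI[of _ T] exI[of _ t] conjI) auto
  qed
  show ?thesis
  proof (cases "V T * W T > 0")
    case True
    have "\<exists>s\<le>T. \<exists>t\<le>T. V s = W t"
    proof (cases "\<bar>V T\<bar> \<le> \<bar>W T\<bar>")
      case le: True
      then show ?thesis
        using meet[of V W, OF True le cont(2) lim(2)] by blast
    next
      case False
      then have le: "\<bar>W T\<bar> \<le> \<bar>V T\<bar>" and pos: "W T * V T > 0"
        using True by (auto simp: mult.commute)
      then show ?thesis
        using meet[of W V, OF pos le cont(1) lim(1)] by metis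
    qed
    then obtain s t where st: "s \<le> T" "t \<le> T" "V s = W t"
      by blast
    have "x s = y t"
      using st by (intro eq) (auto simp: V_def W_def inner_diff_left)
    then show ?thesis
      by blast
  next
    case False
    then have neg: "V T * W T < 0"
      using V0[of T] W0[of T] by (metis less_eq_real_def linorder_not_less mult_eq_0_iff order_refl)
    have same: "F s * F T > 0"
      if F: "continuous_on UNIV F" "\<And>t. t \<le> T \<Longrightarrow> F t \<noteq> 0" and s: "s \<le> T" for F :: "real \<Rightarrow> real" and s
    proof (rule ccontr)
      assume *: "\<not> F s * F T > 0"
      have c: "continuous_on {s..T} F"
        using F(1) continuous_on_subset by blast
      have "F s \<noteq> 0" "F T \<noteq> 0"
        using F(2) s by auto
      with * have "F s \<le> 0 \<and> 0 \<le> F T \<or> F T \<le> 0 \<and> 0 \<le> F s"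
        by (auto simp: zero_less_mult_iff)
      then have "\<exists>t\<ge>s. t \<le> T \<and> F t = 0"
        using IVT'[OF _ _ s c, of 0] IVT2'[OF _ _ s c, of 0] by blast
      then show False
        using F(2) by blast
    qed
    have "V s * W t < 0" if "s \<le> T" "t \<le> T" for s t
      using same[of V, OF cont(1) V0 that(1)] same[of W, OF cont(2) W0 that(2)] neg
      by (auto simp: zero_less_mult_iff mult_less_0_iff)
    then show ?thesis
      unfolding V_def W_def by blast
  qed
qed

section \<open>Linearisation and zeros\<close>

text \<open>Just after \<open>a\<close> the function is negative, at a point \<open>c\<close>. The
  zeros beyond \<open>c\<close> form a compact set, and just before the least of them the function
  is positive; the intermediate value theorem then gives a still smaller zero.\<close>

lemma no_two_zeros_with_negative_derivative:
  fixes h :: "real \<Rightarrow> real"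
  assumes "a < b" "h a = 0" "h b = 0" and cont: "continuous_on {a..b} h"
    and neg: "\<And>u. u \<in> {a..b} \<Longrightarrow> h u = 0 \<Longrightarrow> \<exists>l<0. (h has_real_derivative l) (at u)"
  shows False
proof -
  obtain l where "l < 0" "(h has_real_derivative l) (at a)"
    using neg[of a] assms(1,2) by auto
  then obtain d where d: "d > 0" "\<And>\<epsilon>. 0 < \<epsilon> \<Longrightarrow> \<epsilon> < d \<Longrightarrow> h (a + \<epsilon>) < h a"
    using DERIV_neg_dec_right by blast
  define c where "c = a + min (d/2) ((b - a)/2)"
  have c: "a < c" "c < b" "h c < 0"
    using d(2)[of "min (d/2) ((b - a)/2)"] d(1) assms(1,2) by (auto simp: c_def min_def field_simps)
  define S where "S = {u \<in> {c..b}. h u = 0}"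
  have "continuous_on {c..b} h"
    using c by (intro continuous_on_subset[OF cont]) auto
  then have "closed S"
    unfolding S_def by (intro continuous_closed_preimage_constant) auto
  moreover have "bounded S"
    by (rule bounded_subset[of "{c..b}"]) (auto simp: S_def)
  ultimately have "compact S"
    by (simp add: compact_eq_bounded_closed)
  moreover have "b \<in> S"
    using c assms(3) by (auto simp: S_def)
  ultimately obtain m where m: "m \<in> S" "\<And>u. u \<in> S \<Longrightarrow> m \<le> u"
    using compact_attains_inf[of S] by auto
  then have m': "c < m" "m \<le> b" "h m = 0"
    using c by (auto simp: S_def less_le)
  obtain l where "l < 0" "(h has_real_derivative l) (at m)"
    using neg[of m] m' c by auto
  then obtain d' where d': "d' > 0" "\<And>\<epsilon>. 0 < \<epsilon> \<Longrightarrow> \<epsilon> < d' \<Longrightarrow> h m < h (m - \<epsilon>)"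
    using DERIV_neg_dec_left by blast
  define p where "p = m - min (d'/2) ((m - c)/2)"
  have p: "c \<le> p" "p < m" "h p > 0"
    using d'(2)[of "min (d'/2) ((m - c)/2)"] d'(1) m' by (auto simp: p_def min_def field_simps)
  have "continuous_on {c..p} h"
    using c p m' by (intro continuous_on_subset[OF cont]) auto
  then obtain q where "c \<le> q" "q \<le> p" "h q = 0"
    using IVT'[of h c 0 p] c p by auto
  then show False
    using m(2)[of q] p m' by (auto simp: S_def)
qed

lemma equivariant_derivative:
  fixes f :: "R4 \<Rightarrow> R4"
  assumes f: "smooth f" and eq: "\<And>x. f (g *v x) = g *v f x"
  shows "frechet_derivative f (at (g *v \<xi>)) (g *v v) = g *v frechet_derivative f (at \<xi>) v"
proof -
  have g: "((\<lambda>x. g *v x) has_derivative (\<lambda>x. g *v x)) (at x)" for x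
    by (rule bounded_linear_imp_has_derivative) (rule matrix_vector_mul_bounded_linear)
  have "((\<lambda>x. f (g *v x)) has_derivative (\<lambda>v. frechet_derivative f (at (g *v \<xi>)) (g *v v))) (at \<xi>)"
    using diff_chain_at[OF g smooth_has_derivative[OF f]] by (simp add: o_def)
  moreover have "((\<lambda>x. g *v f x) has_derivative (\<lambda>v. g *v frechet_derivative f (at \<xi>) v)) (at \<xi>)"
    using diff_chain_at[OF smooth_has_derivative[OF f] g] by (simp add: o_def)
  ultimately have "(\<lambda>v. frechet_derivative f (at (g *v \<xi>)) (g *v v)) = (\<lambda>v. g *v frechet_derivative f (at \<xi>) v)"
    unfolding eq by (rule has_derivative_unique)
  then show ?thesis
    by metis
qed

lemma jacobian_smooth_mult:
  fixes f :: "R4 \<Rightarrow> R4"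
  shows "smooth f \<Longrightarrow> jacobian f (at \<xi>) *v v = frechet_derivative f (at \<xi>) v"
  unfolding jacobian_def by (simp add: matrix_works smooth_linear_derivative)

text \<open>Hyperbolicity and sinks speak of complex eigenvalues, but the linearisations below are
  diagonal in a real frame, so real eigenvectors suffice. As a complex vector \<open>a\<close> has
  imaginary part 0, hence the premise \<open>0 \<in> P\<close>.\<close>

lemma real_eigenvalue_in_eigenvalues_on:
  assumes A: "A *v a = k *\<^sub>R a" and a: "a \<noteq> 0" "a \<in> P" "0 \<in> P"
  shows "complex_of_real k \<in> eigenvalues_on P A"
proof -
  define v :: "complex^4" where "v = (\<chi> i. complex_of_real (a $ i))"
  have "(\<chi> i. Re (v $ i)) = a" "(\<chi> i. Im (v $ i)) = 0"
    by (simp_all add: v_def vec_eq_iff)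
  moreover have "v \<noteq> 0"
    using a(1) by (auto simp: v_def vec_eq_iff)
  moreover have "(\<chi> i j. complex_of_real (A $ i $ j)) *v v = complex_of_real k *s v"
  proof -
    have "(\<Sum>j\<in>UNIV. complex_of_real (A $ i $ j) * complex_of_real (a $ j)) = complex_of_real k * complex_of_real (a $ i)" for i
    proof -
      have "(A *v a) $ i = k * a $ i"
        by (simp add: A)
      then have "(\<Sum>j\<in>UNIV. A $ i $ j * a $ j) = k * a $ i"
        by (simp add: matrix_vector_mult_def)
      then show ?thesis
        by (metis (mono_tags, lifting) of_real_mult of_real_sum sum.cong)
    qed
    then show ?thesis
      by (simp add: matrix_vector_mult_def v_def vec_eq_iff)
  qed
  ultimately show ?thesis
    unfolding eigenvalues_on_def using a by (intro CollectI exI[of _ v]) auto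
qed

text \<open>Inverses of group elements appear below as transposes acting on column vectors; the
  simplifier must not turn them into products with row vectors.\<close>

declare transpose_matrix_vector [simp del]

section \<open>Orbits of finite orthogonal groups\<close>

lemma act_mult: "act g (act h S) = act (g ** h) S"
  by (auto simp: act_def image_image matrix_vector_mul_assoc)

lemma act_one [simp]: "act (mat 1) S = S"
  by (simp add: act_def)

locale orthogonal_group =
  fixes G :: "M4 set"
  assumes fin: "finite G" and grp: "matrix_group G" and SO: "G \<subseteq> SO4"
begin

lemma one: "mat 1 \<in> G"
  using grp by (simp add: matrix_group_def)

lemma mult: "g \<in> G \<Longrightarrow> h \<in> G \<Longrightarrow> g ** h \<in> G"
  using grp by (simp add: matrix_group_def)

lemma orth: "g \<in> G \<Longrightarrow> orthogonal_matrix g"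
  using SO by (auto simp: SO4_def)

lemma inner_G: "g \<in> G \<Longrightarrow> (g *v x) \<bullet> (g *v y) = x \<bullet> y"
  using orth orthogonal_matrix_inner by blast

lemma transpose_cancel:
  assumes "g \<in> G"
  shows "transpose g ** g = mat 1" "g ** transpose g = mat 1"
  using orth[OF assms] by (auto simp: orthogonal_matrix_def)

lemma transpose_closed:
  assumes "g \<in> G"
  shows "transpose g \<in> G"
proof -
  obtain h where h: "h \<in> G" "g ** h = mat 1"
    using grp assms by (auto simp: matrix_group_def)
  have "h = (transpose g ** g) ** h"
    using transpose_cancel[OF assms] by simp
  also have "\<dots> = transpose g"
    by (simp add: matrix_mul_assoc[symmetric] h)
  finally show ?thesis
    using h by simp
qed

lemma transpose_mult_vec [simp]:
  assumes "g \<in> G"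
  shows "transpose g *v (g *v x) = x" "g *v (transpose g *v x) = x"
  using transpose_cancel[OF assms] by (simp_all add: matrix_vector_mul_assoc)

lemma act_transpose [simp]:
  assumes "g \<in> G"
  shows "act (transpose g) (act g S) = S" "act g (act (transpose g) S) = S"
  using transpose_cancel[OF assms] by (simp_all add: act_mult)

lemma mem_act_iff: "g \<in> G \<Longrightarrow> x \<in> act g S \<longleftrightarrow> transpose g *v x \<in> S"
  unfolding act_def by (metis (no_types, lifting) imageE image_eqI transpose_mult_vec)

lemma mult_mem_act: "g \<in> G \<Longrightarrow> g *v x \<in> act g S \<longleftrightarrow> x \<in> S"
  by (simp add: mem_act_iff)

text \<open>Stated for an arbitrary action because orbits of points, of sets and of connections all
  occur.\<close>

lemma orbit_eq_iff:
  fixes \<alpha> :: "M4 \<Rightarrow> 'b \<Rightarrow> 'b"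
  assumes one': "\<And>x. \<alpha> (mat 1) x = x" and mult': "\<And>g h x. \<alpha> (g ** h) x = \<alpha> g (\<alpha> h x)"
  shows "(\<lambda>g. \<alpha> g x) ` G = (\<lambda>g. \<alpha> g y) ` G \<longleftrightarrow> (\<exists>g\<in>G. y = \<alpha> g x)"
proof
  assume "(\<lambda>g. \<alpha> g x) ` G = (\<lambda>g. \<alpha> g y) ` G"
  moreover have "y \<in> (\<lambda>g. \<alpha> g y) ` G"
    using one one'[of y] by (metis image_eqI)
  ultimately show "\<exists>g\<in>G. y = \<alpha> g x"
    by auto
next
  assume "\<exists>g\<in>G. y = \<alpha> g x"
  then obtain g where g: "g \<in> G" "y = \<alpha> g x"
    by blast
  show "(\<lambda>g. \<alpha> g x) ` G = (\<lambda>g. \<alpha> g y) ` G"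
  proof (intro equalityI subsetI)
    fix z assume "z \<in> (\<lambda>g. \<alpha> g x) ` G"
    then obtain h where h: "h \<in> G" "z = \<alpha> h x"
      by blast
    have "z = \<alpha> (h ** transpose g) y"
      using h g transpose_cancel[OF g(1)]
      by (simp add: mult'[symmetric] matrix_mul_assoc[symmetric])
    then show "z \<in> (\<lambda>g. \<alpha> g y) ` G"
      using h g mult transpose_closed by blast
  next
    fix z assume "z \<in> (\<lambda>g. \<alpha> g y) ` G"
    then obtain h where h: "h \<in> G" "z = \<alpha> h y"
      by blast
    then have "z = \<alpha> (h ** g) x"
      using g by (simp add: mult')
    then show "z \<in> (\<lambda>g. \<alpha> g x) ` G"
      using h g mult by blast
  qed
qed

definition orb :: "R4 \<Rightarrow> R4 set" where
  "orb x = (\<lambda>g. g *v x) ` G"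

definition connection_orb :: "connection \<Rightarrow> connection set" where
  "connection_orb c = (\<lambda>g. act_connection g c) ` G"

lemma orb_eq_iff: "orb x = orb y \<longleftrightarrow> (\<exists>g\<in>G. y = g *v x)"
  unfolding orb_def by (rule orbit_eq_iff) (simp_all add: matrix_vector_mul_assoc)

lemma set_orbit_eq_iff: "set_orbit G S = set_orbit G T \<longleftrightarrow> (\<exists>g\<in>G. T = act g S)"
  unfolding set_orbit_def by (rule orbit_eq_iff) (simp_all add: act_mult)

lemma act_connection_mult: "act_connection g (act_connection h c) = act_connection (g ** h) c"
  by (simp add: act_connection_def act_mult matrix_vector_mul_assoc)

lemma act_connection_one [simp]: "act_connection (mat 1) c = c"
  by (simp add: act_connection_def)

lemma connection_orb_eq_iff: "connection_orb c = connection_orb d \<longleftrightarrow> (\<exists>g\<in>G. d = act_connection g c)"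
  unfolding connection_orb_def by (rule orbit_eq_iff) (simp_all add: act_connection_mult)

lemma orb_mult [simp]: "g \<in> G \<Longrightarrow> orb (g *v x) = orb x"
  using orb_eq_iff by metis

lemma isotropy_mult:
  assumes "g \<in> G"
  shows "h \<in> isotropy G (g *v x) \<longleftrightarrow> h \<in> G \<and> transpose g ** h ** g \<in> isotropy G x"
proof -
  have "h *v (g *v x) = g *v x \<longleftrightarrow> transpose g *v (h *v (g *v x)) = x"
    using transpose_mult_vec[OF assms] by metis
  moreover have "h \<in> G \<Longrightarrow> transpose g ** h ** g \<in> G"
    using assms mult transpose_closed by blast
  ultimately show ?thesis
    by (auto simp: isotropy_def matrix_vector_mul_assoc matrix_mul_assoc)
qed

text \<open>One inclusion is proved for all group elements and then used for \<open>g\<close> and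
  for its inverse \<open>transpose g\<close>.\<close>

lemma Fix_isotropy_mult:
  assumes g: "g \<in> G"
  shows "Fix (isotropy G (g *v x)) = act g (Fix (isotropy G x))"
proof -
  have *: "act g (Fix (isotropy G x)) \<subseteq> Fix (isotropy G (g *v x))" if g: "g \<in> G" for g x
  proof -
    have "h *v (g *v y) = g *v y" if y: "y \<in> Fix (isotropy G x)" and h: "h \<in> isotropy G (g *v x)" for y h
    proof -
      have "transpose g ** h ** g \<in> isotropy G x"
        using h isotropy_mult[OF g] by blast
      then have "transpose g *v (h *v (g *v y)) = y"
        using y by (auto simp: Fix_def matrix_vector_mul_assoc matrix_mul_assoc)
      then show ?thesis
        using transpose_mult_vec(2)[OF g] by metis
    qed
    then show ?thesis
      by (auto simp: act_def Fix_def)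
  qed
  have "act (transpose g) (Fix (isotropy G (g *v x))) \<subseteq> Fix (isotropy G x)"
    using *[OF transpose_closed[OF g], of "g *v x"] g by simp
  then have "act g (act (transpose g) (Fix (isotropy G (g *v x)))) \<subseteq> act g (Fix (isotropy G x))"
    by (auto simp: act_def)
  then show ?thesis
    using *[OF g, of x] g by auto
qed

lemma subspace_Fix: "subspace (Fix H)"
  by (auto simp: Fix_def subspace_def matrix_vector_right_distrib matrix_vector_mult_scaleR)

lemma dim_act: "g \<in> G \<Longrightarrow> dim (act g S) = dim S"
  unfolding act_def
proof (rule dim_image_eq)
  assume g: "g \<in> G"
  show "inj_on ((*v) g) (span S)"
    by (rule inj_onI) (metis transpose_mult_vec(1)[OF g])
qed simp

lemma subspace_act: "subspace S \<Longrightarrow> subspace (act g S)"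
  unfolding act_def by (intro linear_subspace_image) simp

lemma span_act: "act g (span S) = span ((*v) g ` S)"
  unfolding act_def by (rule linear_span_image[symmetric]) simp

lemma isotropy_spaces_act:
  assumes "g \<in> G" "L \<in> isotropy_spaces G d"
  shows "act g L \<in> isotropy_spaces G d"
  using assms Fix_isotropy_mult dim_act unfolding isotropy_spaces_def by fastforce

text \<open>If \<open>L\<close> is the fixed space of the isotropy group of some point, that group
  also fixes \<open>p\<close>; the larger isotropy group of \<open>p\<close> has the smaller fixed
  space.\<close>

lemma isotropy_space_minimal:
  assumes "L \<in> isotropy_spaces G d" "p \<in> L"
  shows "Fix (isotropy G p) \<subseteq> L"
  using assms by (fastforce simp: isotropy_spaces_def Fix_def isotropy_def)

end

section \<open>Semiaxes as open rays\<close>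

lemma components_punctured_line:
  assumes "x \<noteq> (0 :: 'a::euclidean_space)"
  shows "connected_component_set (span {x} - {0}) x = {t *\<^sub>R x | t. t > 0}"
proof (intro equalityI subsetI)
  fix y assume "y \<in> connected_component_set (span {x} - {0}) x"
  then obtain T where T: "topological_space_class.connected T" "T \<subseteq> span {x} - {0}" "x \<in> T" "y \<in> T"
    by (auto simp: connected_component_def)
  then obtain t where t: "y = t *\<^sub>R x"
    using span_singletonD[of y x] by blast
  have "t \<noteq> 0"
    using T t by auto
  have "t > 0"
  proof (rule ccontr)
    assume "\<not> t > 0"
    then have "x \<bullet> y \<le> 0" "0 \<le> x \<bullet> x"
      using t by (auto simp: mult_le_0_iff)
    \<comment> \<open>A connected set with points on both sides meets the hyperplane orthogonal to
      \<open>x\<close>; on the line of \<open>x\<close> that is the origin.\<close>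
    then obtain z where z: "z \<in> T" "x \<bullet> z = 0"
      using connected_ivt_hyperplane[OF T(1) T(4) T(3)] by blast
    then obtain k where "z = k *\<^sub>R x"
      using T(2) span_singletonD by blast
    then have "z = 0"
      using z assms by auto
    then show False
      using z T by blast
  qed
  then show "y \<in> {t *\<^sub>R x | t. t > 0}"
    using t by blast
next
  fix y assume "y \<in> {t *\<^sub>R x | t. t > 0}"
  then obtain t where t: "y = t *\<^sub>R x" "t > 0"
    by blast
  have "topological_space_class.connected ((\<lambda>t. t *\<^sub>R x) ` {0<..})"
    by (intro connected_continuous_image continuous_intros) auto
  moreover have "(\<lambda>t. t *\<^sub>R x) ` {0<..} \<subseteq> span {x} - {0}"
    using assms by (auto simp: span_base span_scale)
  moreover have "x \<in> (\<lambda>t. t *\<^sub>R x) ` {0<..}"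
    by (rule image_eqI[of _ _ 1]) auto
  moreover have "y \<in> (\<lambda>t. t *\<^sub>R x) ` {0<..}"
    using t by auto
  ultimately show "y \<in> connected_component_set (span {x} - {0}) x"
    unfolding connected_component_def mem_Collect_eq by blast
qed

definition ray :: "R4 \<Rightarrow> R4 set" where
  "ray x = {t *\<^sub>R x | t. t > 0}"

lemma act_ray: "act g (ray x) = ray (g *v x)"
  by (force simp: act_def ray_def matrix_vector_mult_scaleR)

lemma self_in_ray: "x \<in> ray x"
  unfolding ray_def by (rule CollectI, rule exI[of _ 1]) simp

lemma ray_subset_subspace: "subspace P \<Longrightarrow> ray x \<subseteq> P \<longleftrightarrow> x \<in> P"
  using self_in_ray by (auto simp: ray_def subspace_scale)

lemma ray_scale:
  assumes "t > 0"
  shows "ray (t *\<^sub>R x) = ray x"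
proof (intro equalityI subsetI)
  fix y assume "y \<in> ray x"
  then obtain s where "s > 0" "y = s *\<^sub>R x"
    by (auto simp: ray_def)
  then have "y = (s / t) *\<^sub>R (t *\<^sub>R x)" "s / t > 0"
    using assms by auto
  then show "y \<in> ray (t *\<^sub>R x)"
    unfolding ray_def by blast
next
  fix y assume "y \<in> ray (t *\<^sub>R x)"
  then obtain s where "s > 0" "y = (s * t) *\<^sub>R x"
    by (auto simp: ray_def)
  then show "y \<in> ray x"
    using assms unfolding ray_def by (intro CollectI exI[of _ "s * t"]) auto
qed

lemma one_dim_subspace_eq_span:
  fixes L :: "'a::euclidean_space set"
  assumes "subspace L" "dim L = 1" "x \<in> L" "x \<noteq> 0"
  shows "L = span {x}"
proof (rule sym, rule subspace_dim_equal)
  show "span {x} \<subseteq> L"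
    using assms by (simp add: span_minimal)
  show "dim L \<le> dim (span {x})"
    using assms by (simp add: dim_span)
qed (use assms in \<open>auto simp: subspace_span\<close>)

lemma (in orthogonal_group) isotropy_semiaxes_eq:
  "isotropy_semiaxes G = {ray x | x. x \<noteq> 0 \<and> span {x} \<in> isotropy_axes G}"
proof (intro equalityI subsetI)
  fix S assume "S \<in> isotropy_semiaxes G"
  then obtain L x where L: "L \<in> isotropy_axes G" "x \<in> L - {0}" "S = connected_component_set (L - {0}) x"
    by (auto simp: isotropy_semiaxes_def components_def)
  then have "L = span {x}"
    using subspace_Fix by (intro one_dim_subspace_eq_span) (auto simp: isotropy_axes_def isotropy_spaces_def)
  then show "S \<in> {ray x | x. x \<noteq> 0 \<and> span {x} \<in> isotropy_axes G}"
    using L components_punctured_line[of x] by (auto simp: ray_def)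
next
  fix S assume "S \<in> {ray x | x. x \<noteq> 0 \<and> span {x} \<in> isotropy_axes G}"
  then obtain x where x: "S = ray x" "x \<noteq> 0" "span {x} \<in> isotropy_axes G"
    by blast
  then have "S = connected_component_set (span {x} - {0}) x" "x \<in> span {x} - {0}"
    using components_punctured_line[of x] by (auto simp: ray_def span_base)
  then show "S \<in> isotropy_semiaxes G"
    using x unfolding isotropy_semiaxes_def components_def by blast
qed

section \<open>Isotropy planes through an equilibrium\<close>

lemma dim_span_orthogonal_pair:
  fixes x a :: "'a::euclidean_space"
  assumes "x \<noteq> 0" "a \<noteq> 0" "x \<bullet> a = 0"
  shows "dim (span {x, a}) = 2"
proof -
  have "x \<noteq> a"
    using assms by auto
  moreover have "independent {x, a}"
    using assms by (intro pairwise_orthogonal_independent)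
      (auto simp: pairwise_insert orthogonal_def inner_commute)
  ultimately show ?thesis
    by (simp add: dim_span dim_eq_card_independent)
qed

context orthogonal_group begin

lemma frame_expansion:
  assumes "half_turn_frame G x a b c"
  shows "v = (x \<bullet> v / (x \<bullet> x)) *\<^sub>R x + (a \<bullet> v) *\<^sub>R a + (b \<bullet> v) *\<^sub>R b + (c \<bullet> v) *\<^sub>R c"
  using assms unfolding half_turn_frame_def by (intro orthonormal_four_expansion) auto

lemma inner_zero_if_reflected:
  assumes "g \<in> G" "g *v v = v" "g *v b = - b"
  shows "b \<bullet> v = 0"
  using inner_G[OF assms(1), of b v] assms(2,3) by simp

lemma half_turn_Fix:
  assumes F: "half_turn_frame G x a b c"
    and g: "g \<in> G" "g *v b = - b" "g *v c = - c" "g *v v = v"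
  shows "v \<in> span {x, a}"
proof -
  have "b \<bullet> v = 0" "c \<bullet> v = 0"
    using inner_zero_if_reflected g by blast+
  then have "v = (x \<bullet> v / (x \<bullet> x)) *\<^sub>R x + (a \<bullet> v) *\<^sub>R a"
    using frame_expansion[OF F, of v] by simp
  also have "\<dots> \<in> span {x, a}"
    by (intro span_add span_scale span_base) auto
  finally show ?thesis .
qed

lemma Fix_isotropy_frame:
  assumes F: "half_turn_frame G x a b c"
  shows "Fix (isotropy G x) = span {x}"
proof (intro equalityI subsetI)
  fix v assume v: "v \<in> Fix (isotropy G x)"
  obtain g where g: "g \<in> isotropy G x" "g *v b = - b" "g *v c = - c"
    using F unfolding half_turn_frame_def isotropy_def by blast
  obtain h where h: "h \<in> isotropy G x" "h *v a = - a"
    using F unfolding half_turn_frame_def isotropy_def by blast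
  have "a \<bullet> v = 0" "b \<bullet> v = 0" "c \<bullet> v = 0"
    using v g h inner_zero_if_reflected[of g v b] inner_zero_if_reflected[of g v c] inner_zero_if_reflected[of h v a]
    by (auto simp: Fix_def isotropy_def)
  then have "v = (x \<bullet> v / (x \<bullet> x)) *\<^sub>R x"
    using frame_expansion[OF F, of v] by simp
  then show "v \<in> span {x}"
    by (metis insertI1 span_base span_scale)
next
  fix v assume "v \<in> span {x}"
  then show "v \<in> Fix (isotropy G x)"
    using span_singletonD[of v x] by (auto simp: Fix_def isotropy_def matrix_vector_mult_scaleR)
qed

text \<open>Some element of \<open>H\<close> acts nontrivially, as otherwise \<open>Fix H\<close>
  would be everything. It fixes \<open>x\<close>, so it is a half-turn, whose plane contains
  \<open>Fix H\<close> and has the same dimension. A general \<open>H\<close> is allowed because the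
  planes of a robust cycle are given as fixed spaces of subgroups, and only this lemma shows that
  they are isotropy planes.\<close>

lemma Fix_plane_in_frame:
  assumes F: "half_turn_frame G x a b c" and H: "H \<subseteq> G" "x \<in> Fix H" "dim (Fix H) = 2"
  shows "Fix H \<in> {span {x, a}, span {x, b}, span {x, c}}"
proof -
  note F' = half_turn_frame_rotate[OF F]
  note F'' = half_turn_frame_rotate[OF F']
  have nz: "x \<noteq> 0" "a \<noteq> 0" "b \<noteq> 0" "c \<noteq> 0" and ort: "x \<bullet> a = 0" "x \<bullet> b = 0" "x \<bullet> c = 0"
    using F unfolding half_turn_frame_def by auto
  have eq: "Fix H = span {x, e}" if e: "e \<noteq> 0" "x \<bullet> e = 0" and sub: "Fix H \<subseteq> span {x, e}" for e
    using sub H(3) dim_span_orthogonal_pair[OF nz(1) e]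
    by (intro subspace_dim_equal subspace_Fix subspace_span) auto
  have Hx: "h *v x = x" if "h \<in> H" for h
    using H(2) that by (simp add: Fix_def)
  have "\<exists>h\<in>H. \<not> (h *v a = a \<and> h *v b = b \<and> h *v c = c)"
  proof (rule ccontr)
    assume *: "\<not> ?thesis"
    have "v \<in> Fix H" for v
      unfolding Fix_def
    proof safe
      fix h assume h: "h \<in> H"
      show "h *v v = v"
        by (subst (1 2) frame_expansion[OF F, of v])
          (use * h Hx[OF h] in \<open>simp add: matrix_vector_right_distrib matrix_vector_mult_scaleR\<close>)
    qed
    then have "Fix H = UNIV"
      by blast
    then show False
      using H(3) by (simp add: dim_UNIV)
  qed
  then obtain h where h: "h \<in> H" "h \<in> G" "\<not> (h *v a = a \<and> h *v b = b \<and> h *v c = c)"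
    using H(1) by blast
  have cases: "h *v b = - b \<and> h *v c = - c \<or> h *v a = - a \<and> h *v c = - c \<or> h *v a = - a \<and> h *v b = - b"
    using F h Hx[OF h(1)] unfolding half_turn_frame_def by blast
  have fixh: "h *v v = v" if "v \<in> Fix H" for v
    using that h by (simp add: Fix_def)
  from cases show ?thesis
  proof (elim disjE conjE)
    assume "h *v b = - b" "h *v c = - c"
    then have "Fix H \<subseteq> span {x, a}"
      using half_turn_Fix[OF F h(2)] fixh by blast
    then show ?thesis
      using eq[OF nz(2) ort(1)] by simp
  next
    assume "h *v a = - a" "h *v c = - c"
    then have "Fix H \<subseteq> span {x, b}"
      using half_turn_Fix[OF F' h(2)] fixh by blast
    then show ?thesis
      using eq[OF nz(3) ort(2)] by simp
  next
    assume "h *v a = - a" "h *v b = - b"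
    then have "Fix H \<subseteq> span {x, c}"
      using half_turn_Fix[OF F'' h(2)] fixh by blast
    then show ?thesis
      using eq[OF nz(4) ort(3)] by simp
  qed
qed

text \<open>A generic point \<open>x + t *\<^sub>R a\<close> is fixed only by elements that fix the
  whole plane: two fixed points on this affine line force an element to fix \<open>x\<close> and
  \<open>a\<close>, so each of the finitely many other elements excludes at most one
  \<open>t\<close>.\<close>

lemma frame_plane_is_isotropy_plane:
  assumes F: "half_turn_frame G x a b c"
  shows "span {x, a} \<in> isotropy_planes G"
proof -
  have nz: "x \<noteq> 0" "a \<noteq> 0" "b \<noteq> 0" "x \<bullet> a = 0"
    using F unfolding half_turn_frame_def by auto
  define B where "B g = {t. g *v (x + t *\<^sub>R a) = x + t *\<^sub>R a}" for g
  define N where "N = {g \<in> G. \<not> (g *v x = x \<and> g *v a = a)}"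
  have "finite (B g)" if g: "g \<in> N" for g
  proof (rule ccontr)
    assume "infinite (B g)"
    then obtain s where s: "s \<in> B g"
      by (metis ex_in_conv finite.emptyI)
    have "infinite (B g - {s})"
      using \<open>infinite (B g)\<close> by simp
    then obtain t where t: "t \<in> B g" "t \<noteq> s"
      by (metis Diff_iff ex_in_conv finite.emptyI singletonI)
    have eqs: "g *v x + s *\<^sub>R (g *v a) = x + s *\<^sub>R a" "g *v x + t *\<^sub>R (g *v a) = x + t *\<^sub>R a"
      using s t by (simp_all add: B_def matrix_vector_right_distrib matrix_vector_mult_scaleR)
    then have "(t - s) *\<^sub>R (g *v a) = (t - s) *\<^sub>R a"
      unfolding scaleR_diff_left by (metis add_diff_cancel_left)
    then have ga: "g *v a = a"
      using t(2) by simp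
    then have "g *v x = x"
      using eqs(1) by simp
    with ga have "g *v x = x \<and> g *v a = a"
      by simp
    then show False
      using g by (simp add: N_def)
  qed
  then have "finite (\<Union>g\<in>N. B g)"
    using fin by (simp add: N_def)
  then obtain t where t: "t \<notin> (\<Union>g\<in>N. B g)"
    using infinite_UNIV_char_0 ex_new_if_finite by blast
  define p where "p = x + t *\<^sub>R a"
  have p: "g *v x = x \<and> g *v a = a" if "g \<in> isotropy G p" for g
    using t that by (auto simp: p_def isotropy_def B_def N_def)
  obtain g where g: "g \<in> G" "g *v x = x" "g *v a = a" "g *v b = - b" "g *v c = - c"
    using F unfolding half_turn_frame_def by blast
  then have "g \<in> isotropy G p"
    by (simp add: isotropy_def p_def matrix_vector_right_distrib matrix_vector_mult_scaleR)
  then have "Fix (isotropy G p) \<subseteq> span {x, a}"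
    using half_turn_Fix[OF F g(1,4,5)] by (auto simp: Fix_def)
  moreover have "span {x, a} \<subseteq> Fix (isotropy G p)"
    using p by (intro span_minimal subspace_Fix) (auto simp: Fix_def)
  ultimately show ?thesis
    using dim_span_orthogonal_pair[OF nz(1,2,4)]
    unfolding isotropy_planes_def isotropy_spaces_def by blast
qed

definition planes_through :: "R4 \<Rightarrow> R4 set set" where
  "planes_through x = {P \<in> isotropy_planes G. x \<in> P}"

lemma planes_through_frame:
  assumes F: "half_turn_frame G x a b c"
  shows "planes_through x = {span {x, a}, span {x, b}, span {x, c}}"
proof (intro equalityI subsetI)
  fix P assume "P \<in> planes_through x"
  then obtain p where p: "P = Fix (isotropy G p)" "dim P = 2" "x \<in> P"
    by (auto simp: planes_through_def isotropy_planes_def isotropy_spaces_def)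
  moreover have "isotropy G p \<subseteq> G"
    by (auto simp: isotropy_def)
  ultimately show "P \<in> {span {x, a}, span {x, b}, span {x, c}}"
    using Fix_plane_in_frame[OF F] by metis
next
  fix P assume "P \<in> {span {x, a}, span {x, b}, span {x, c}}"
  moreover have "x \<in> span {x, y}" for y
    by (simp add: span_base)
  ultimately show "P \<in> planes_through x"
    using frame_plane_is_isotropy_plane F half_turn_frame_rotate
    unfolding planes_through_def by blast
qed

lemma card_planes_through:
  assumes F: "half_turn_frame G x a b c"
  shows "card (planes_through x) = 3"
proof -
  have ne: "span {x, u} \<noteq> span {x, v}" if "x \<bullet> u = 0" "u \<bullet> v = 0" "norm u = 1" for u v
  proof
    assume "span {x, u} = span {x, v}"
    then have "u \<in> span {x, v}"
      using span_base[of u "{x, u}"] by simp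
    then obtain k l where kl: "u = k *\<^sub>R x + l *\<^sub>R v"
      using span_pairD by blast
    have "u \<bullet> u = u \<bullet> (k *\<^sub>R x + l *\<^sub>R v)"
      by (rule arg_cong[OF kl])
    then have "u \<bullet> u = k * (x \<bullet> u) + l * (u \<bullet> v)"
      by (simp only: inner_add_right inner_scaleR_right inner_commute[of x u])
    then show False
      using that by (simp add: dot_square_norm)
  qed
  have "span {x, a} \<noteq> span {x, b}" "span {x, a} \<noteq> span {x, c}" "span {x, b} \<noteq> span {x, c}"
    using ne[of a b] ne[of a c] ne[of b c] F unfolding half_turn_frame_def by simp_all
  then show ?thesis
    unfolding planes_through_frame[OF F] by simp
qed

lemma planes_through_cases:
  assumes F: "half_turn_frame G x a b c" and P: "P \<in> planes_through x"
  obtains a' b' c' where "half_turn_frame G x a' b' c'" "P = span {x, a'}"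
  using P F half_turn_frame_rotate unfolding planes_through_frame[OF F] by blast

text \<open>Elements fixing \<open>x\<close> act on the frame by signs. Hence the isotropy group
  never exchanges the three planes through \<open>x\<close>, which later keeps the arrows at a
  vertex apart.\<close>

lemma isotropy_preserves_planes_through:
  assumes F: "half_turn_frame G x a b c" and P: "P \<in> planes_through x"
    and g: "g \<in> G" "g *v x = x"
  shows "act g P = P"
proof -
  obtain a' b' c' where F': "half_turn_frame G x a' b' c'" and P': "P = span {x, a'}"
    using planes_through_cases[OF F P] by blast
  have "g *v a' = a' \<or> g *v a' = - a'"
    using F' g unfolding half_turn_frame_def by blast
  then have "(*v) g ` {x, a'} \<subseteq> span {x, a'}"
    using g by (auto simp: span_base span_neg)
  then have "act g P \<subseteq> P"
    unfolding P' span_act by (intro span_minimal subspace_span)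
  then show ?thesis
    unfolding P' using g by (intro subspace_dim_equal) (auto simp: dim_act subspace_act subspace_span)
qed

end

section \<open>Equilibria and connections of a simple maximal network\<close>

text \<open>The two manifolds only provide half-line solutions through the point \<open>x 0\<close>;
  by uniqueness they are the two halves of the full solution, which therefore has both
  limits.\<close>

lemma connecting_trajectory_solution:
  assumes f: "smooth f" and "connecting_trajectory f \<xi> \<kappa> \<eta>"
  shows "\<exists>x. solution_on f UNIV x \<and> \<kappa> = range x \<and> (x \<longlongrightarrow> \<xi>) at_bot \<and> (x \<longlongrightarrow> \<eta>) at_top \<and>
    (\<forall>t. f (x t) \<noteq> 0)"
proof -
  obtain x where x: "solution_on f UNIV x" "\<kappa> = range x"
    using assms(2) unfolding connecting_trajectory_def by blast
  have sub: "x 0 \<in> unstable_manifold f \<xi>" "x 0 \<in> stable_manifold f \<eta>" and nz: "\<forall>t. f (x t) \<noteq> 0"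
    using assms(2) x(2) by (auto simp: connecting_trajectory_def)
  obtain y where y: "solution_on f {..0} y" "y 0 = x 0" "(y \<longlongrightarrow> \<xi>) at_bot"
    using sub(1) by (auto simp: unstable_manifold_def)
  obtain z where z: "solution_on f {0..} z" "z 0 = x 0" "(z \<longlongrightarrow> \<eta>) at_top"
    using sub(2) by (auto simp: stable_manifold_def)
  have "y t = x t" if "t \<le> 0" for t
    using solution_unique[OF f _ y(1) solution_on_subset[OF x(1)], of 0 t] y(2) that
    by (simp add: is_interval_ic)
  then have "(x \<longlongrightarrow> \<xi>) at_bot"
    by (intro Lim_transform_eventually[OF y(3)]) (auto simp: eventually_at_bot_linorder)
  moreover have "z t = x t" if "0 \<le> t" for t
    using solution_unique[OF f _ z(1) solution_on_subset[OF x(1)], of 0 t] z(2) that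
    by (simp add: is_interval_ci)
  then have "(x \<longlongrightarrow> \<eta>) at_top"
    by (intro Lim_transform_eventually[OF z(3)]) (auto simp: eventually_at_top_linorder)
  ultimately show ?thesis
    using x nz by blast
qed

locale simple_maximal_network = orthogonal_group G for G +
  fixes f :: "R4 \<Rightarrow> R4" and E :: "R4 set" and K :: "connection set"
  assumes sm: "smooth f" and eqv: "equivariant G f"
    and simple: "simple_network G f E K" and maximal: "maximal_network G f E K"
begin

abbreviation L :: "R4 \<Rightarrow> R4 \<Rightarrow> R4" where
  "L x \<equiv> frechet_derivative f (at x)"

lemma f_mult: "g \<in> G \<Longrightarrow> f (g *v x) = g *v f x"
  using eqv by (simp add: equivariant_def)

lemma L_mult: "g \<in> G \<Longrightarrow> L (g *v x) (g *v v) = g *v L x v"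
  using equivariant_derivative[OF sm] f_mult by blast

lemma linear_L: "linear (L x)"
  by (rule smooth_linear_derivative[OF sm])

text \<open>Only real eigenvectors are considered. At an equilibrium of the network the
  linearisation has a real eigenbasis in every isotropy plane through it, so that being stable and
  being unstable become complementary.\<close>

definition stable_in :: "R4 \<Rightarrow> R4 set \<Rightarrow> bool" where
  "stable_in x P \<longleftrightarrow> (\<forall>v\<in>P. v \<noteq> 0 \<longrightarrow> (\<forall>l. L x v = l *\<^sub>R v \<longrightarrow> l < 0))"

definition unstable_in :: "R4 \<Rightarrow> R4 set \<Rightarrow> bool" where
  "unstable_in x P \<longleftrightarrow> (\<exists>v\<in>P. v \<noteq> 0 \<and> (\<exists>l>0. L x v = l *\<^sub>R v))"

lemma not_stable_and_unstable: "stable_in x P \<Longrightarrow> \<not> unstable_in x P"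
  unfolding stable_in_def unstable_in_def by (meson less_asym)

text \<open>The properties of an equilibrium that are kept once its cycle is forgotten. The negative
  \<open>r\<close> is the eigenvalue in the direction of the equilibrium itself.\<close>

definition equilibrium_data :: "R4 \<Rightarrow> bool" where
  "equilibrium_data x \<longleftrightarrow> x \<noteq> 0 \<and> f x = 0 \<and> span {x} \<in> isotropy_axes G \<and>
     (\<exists>a b c. half_turn_frame G x a b c) \<and> (\<exists>r<0. L x x = r *\<^sub>R x) \<and>
     (\<forall>v l. v \<noteq> 0 \<longrightarrow> L x v = l *\<^sub>R v \<longrightarrow> l \<noteq> 0)"

text \<open>That every point of the connection has the full plane as its isotropy space means that
  the connection never meets an isotropy axis; this is what confines it to a chamber.\<close>

definition connection_data :: "R4 \<Rightarrow> R4 set \<Rightarrow> R4 \<Rightarrow> R4 set \<Rightarrow> bool" where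
  "connection_data \<xi> \<kappa> \<eta> P \<longleftrightarrow>
     (\<exists>x. solution_on f UNIV x \<and> \<kappa> = range x \<and> (x \<longlongrightarrow> \<xi>) at_bot \<and> (x \<longlongrightarrow> \<eta>) at_top \<and> (\<forall>t. f (x t) \<noteq> 0)) \<and>
     P \<in> isotropy_planes G \<and> (\<forall>p\<in>\<kappa>. Fix (isotropy G p) = P) \<and> \<xi> \<in> P \<and> \<eta> \<in> P \<and> stable_in \<eta> P"

text \<open>The half-turn that fixes \<open>x\<close> and \<open>a\<close> leaves only a combination
  of them for \<open>L x a\<close>; an element negating \<open>a\<close> makes it orthogonal to
  \<open>x\<close>.\<close>

lemma frame_eigenvector:
  assumes F: "half_turn_frame G x a b c"
  shows "\<exists>l. L x a = l *\<^sub>R a"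
proof -
  obtain g where g: "g \<in> G" "g *v x = x" "g *v a = a" "g *v b = - b" "g *v c = - c"
    using F unfolding half_turn_frame_def by blast
  obtain h where h: "h \<in> G" "h *v x = x" "h *v a = - a"
    using F unfolding half_turn_frame_def by blast
  have "g *v L x a = L x a"
    using L_mult[OF g(1), of x a] g by simp
  then have "L x a \<in> span {x, a}"
    using half_turn_Fix[OF F g(1,4,5)] by blast
  then obtain k l where kl: "L x a = k *\<^sub>R x + l *\<^sub>R a"
    using span_pairD by blast
  have "h *v L x a = - L x a"
    using L_mult[OF h(1), of x a] h linear_neg[OF linear_L] by simp
  then have "x \<bullet> L x a = 0"
    using inner_G[OF h(1), of x "L x a"] h by simp
  then have "k = 0"
    using F unfolding kl half_turn_frame_def by (simp add: inner_add_right)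
  then show ?thesis
    using kl by auto
qed

lemma radial_eigenvector:
  assumes F: "half_turn_frame G x a b c"
  shows "\<exists>r. L x x = r *\<^sub>R x"
proof -
  have "L x x \<in> Fix (isotropy G x)"
    using L_mult[of _ x x] by (auto simp: Fix_def isotropy_def) metis
  then show ?thesis
    using span_singletonD unfolding Fix_isotropy_frame[OF F] by blast
qed

lemma half_turn_frame_mult:
  assumes F: "half_turn_frame G x a b c" and g: "g \<in> G"
  shows "half_turn_frame G (g *v x) (g *v a) (g *v b) (g *v c)"
proof -
  have neg: "g *v (- v) = - (g *v v)" for v
    by (metis matrix_vector_mult_scaleR scaleR_minus1_left)
  have conj: "\<exists>h\<in>G. h *v (g *v x) = g *v x \<and> h *v (g *v a) = s1 *\<^sub>R (g *v a) \<and>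
      h *v (g *v b) = s2 *\<^sub>R (g *v b) \<and> h *v (g *v c) = s3 *\<^sub>R (g *v c)"
    if h: "\<exists>h\<in>G. h *v x = x \<and> h *v a = s1 *\<^sub>R a \<and> h *v b = s2 *\<^sub>R b \<and> h *v c = s3 *\<^sub>R c" for s1 s2 s3
  proof -
    obtain h where h: "h \<in> G" "h *v x = x" "h *v a = s1 *\<^sub>R a" "h *v b = s2 *\<^sub>R b" "h *v c = s3 *\<^sub>R c"
      using h by blast
    have *: "(g ** h ** transpose g) *v (g *v v) = g *v (h *v v)" for v
      using transpose_mult_vec[OF g] by (simp add: matrix_vector_mul_assoc[symmetric])
    have "g ** h ** transpose g \<in> G"
      using h(1) g mult transpose_closed by blast
    then show ?thesis
      by (rule bexI[rotated]) (simp only: * h matrix_vector_mult_scaleR simp_thms)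
  qed
  have "\<exists>h\<in>G. h *v (g *v x) = g *v x \<and> h *v (g *v a) = g *v a \<and> h *v (g *v b) = - (g *v b) \<and> h *v (g *v c) = - (g *v c)"
    using conj[of 1 "-1" "-1"] F unfolding half_turn_frame_def by simp
  moreover have "\<exists>h\<in>G. h *v (g *v x) = g *v x \<and> h *v (g *v a) = - (g *v a) \<and> h *v (g *v b) = g *v b \<and> h *v (g *v c) = - (g *v c)"
    using conj[of "-1" 1 "-1"] F unfolding half_turn_frame_def by simp
  moreover have "\<exists>h\<in>G. h *v (g *v x) = g *v x \<and> h *v (g *v a) = - (g *v a) \<and> h *v (g *v b) = - (g *v b) \<and> h *v (g *v c) = g *v c"
    using conj[of "-1" "-1" 1] F unfolding half_turn_frame_def by simp
  moreover have "h *v (g *v a) = g *v a \<and> h *v (g *v b) = g *v b \<and> h *v (g *v c) = g *v c \<or>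
      h *v (g *v a) = g *v a \<and> h *v (g *v b) = - (g *v b) \<and> h *v (g *v c) = - (g *v c) \<or>
      h *v (g *v a) = - (g *v a) \<and> h *v (g *v b) = g *v b \<and> h *v (g *v c) = - (g *v c) \<or>
      h *v (g *v a) = - (g *v a) \<and> h *v (g *v b) = - (g *v b) \<and> h *v (g *v c) = g *v c"
    if h: "h \<in> G" "h *v (g *v x) = g *v x" for h
  proof -
    define k where "k = transpose g ** h ** g"
    have k: "k \<in> G"
      using h g mult transpose_closed by (simp add: k_def)
    have gk: "h *v (g *v v) = g *v (k *v v)" for v
      using transpose_mult_vec[OF g] by (simp add: k_def matrix_vector_mul_assoc[symmetric])
    have "k *v x = x"
      using h(2) transpose_mult_vec(1)[OF g, of x]
      by (simp add: k_def matrix_vector_mul_assoc[symmetric])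
    then have "k *v a = a \<and> k *v b = b \<and> k *v c = c \<or> k *v a = a \<and> k *v b = - b \<and> k *v c = - c \<or>
        k *v a = - a \<and> k *v b = b \<and> k *v c = - c \<or> k *v a = - a \<and> k *v b = - b \<and> k *v c = c"
      using F k unfolding half_turn_frame_def by blast
    then show ?thesis
      unfolding gk by (elim disjE conjE) (simp_all only: neg simp_thms)
  qed
  moreover have "g *v x \<noteq> 0"
    using F transpose_mult_vec(1)[OF g, of x] unfolding half_turn_frame_def by auto
  moreover have "norm (g *v v) = norm v" for v
    using orth[OF g] by (rule orthogonal_matrix_norm_mult)
  ultimately show ?thesis
    using F unfolding half_turn_frame_def by (simp only: inner_G[OF g] simp_thms) blast
qed

lemma stable_in_mult:
  assumes g: "g \<in> G" and "stable_in x P"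
  shows "stable_in (g *v x) (act g P)"
  unfolding stable_in_def
proof (intro ballI impI allI)
  fix v l assume v: "v \<in> act g P" "v \<noteq> 0" "L (g *v x) v = l *\<^sub>R v"
  obtain w where w: "w \<in> P" "v = g *v w"
    using v(1) by (auto simp: act_def)
  have "g *v L x w = g *v (l *\<^sub>R w)"
    using v(3) L_mult[OF g, of x w] w by (simp add: matrix_vector_mult_scaleR)
  then have "L x w = l *\<^sub>R w"
    by (metis transpose_mult_vec(1)[OF g])
  moreover have "w \<noteq> 0"
    using v w by auto
  ultimately show "l < 0"
    using assms(2) w unfolding stable_in_def by blast
qed

lemma unstable_in_mult:
  assumes g: "g \<in> G" and "unstable_in x P"
  shows "unstable_in (g *v x) (act g P)"
proof -
  obtain v l where v: "v \<in> P" "v \<noteq> 0" "l > 0" "L x v = l *\<^sub>R v"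
    using assms(2) by (auto simp: unstable_in_def)
  have "g *v v \<in> act g P" "g *v v \<noteq> 0"
    using v transpose_mult_vec(1)[OF g, of v] by (auto simp: act_def)
  moreover have "L (g *v x) (g *v v) = l *\<^sub>R (g *v v)"
    using L_mult[OF g] v by (simp add: matrix_vector_mult_scaleR)
  ultimately show ?thesis
    using v(3) unfolding unstable_in_def by blast
qed

lemma equilibrium_data_mult:
  assumes g: "g \<in> G" and x: "equilibrium_data x"
  shows "equilibrium_data (g *v x)"
proof -
  obtain a b c r where d: "x \<noteq> 0" "f x = 0" "span {x} \<in> isotropy_axes G" "half_turn_frame G x a b c"
      "r < 0" "L x x = r *\<^sub>R x" and nz: "\<And>v l. v \<noteq> 0 \<Longrightarrow> L x v = l *\<^sub>R v \<Longrightarrow> l \<noteq> 0"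
    using x unfolding equilibrium_data_def by blast
  note F = half_turn_frame_mult[OF d(4) g]
  have "act g (span {x}) = span {g *v x}"
    by (simp add: span_act)
  then have "span {g *v x} \<in> isotropy_axes G"
    using isotropy_spaces_act[OF g] d(3) unfolding isotropy_axes_def by metis
  moreover have "f (g *v x) = 0"
    using f_mult[OF g] d by simp
  moreover have "L (g *v x) (g *v x) = r *\<^sub>R (g *v x)"
    using L_mult[OF g, of x x] d by (simp add: matrix_vector_mult_scaleR)
  moreover have "l \<noteq> 0" if v: "v \<noteq> 0" "L (g *v x) v = l *\<^sub>R v" for v l
  proof -
    define w where "w = transpose g *v v"
    have w: "v = g *v w"
      using g by (simp add: w_def)
    have "g *v L x w = g *v (l *\<^sub>R w)"
      using v(2) L_mult[OF g, of x w] w by (simp add: matrix_vector_mult_scaleR)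
    then have "L x w = l *\<^sub>R w"
      by (metis transpose_mult_vec(1)[OF g])
    moreover have "w \<noteq> 0"
      using v w by auto
    ultimately show ?thesis
      using nz by blast
  qed
  moreover have "g *v x \<noteq> 0"
    using F unfolding half_turn_frame_def by blast
  ultimately show ?thesis
    unfolding equilibrium_data_def using F d(5) by blast
qed

lemma connection_data_mult:
  assumes g: "g \<in> G" and c: "connection_data \<xi> \<kappa> \<eta> P"
  shows "connection_data (g *v \<xi>) (act g \<kappa>) (g *v \<eta>) (act g P)"
proof -
  obtain x where x: "solution_on f UNIV x" "\<kappa> = range x" "(x \<longlongrightarrow> \<xi>) at_bot" "(x \<longlongrightarrow> \<eta>) at_top" "\<And>t. f (x t) \<noteq> 0"
    using c unfolding connection_data_def by blast
  have "solution_on f UNIV (\<lambda>t. g *v x t)"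
    by (rule solution_on_symmetry[OF f_mult[OF g] x(1)])
  moreover have "act g \<kappa> = range (\<lambda>t. g *v x t)"
    by (auto simp: act_def x(2))
  moreover have "((\<lambda>t. g *v x t) \<longlongrightarrow> g *v \<xi>) at_bot" "((\<lambda>t. g *v x t) \<longlongrightarrow> g *v \<eta>) at_top"
    using bounded_linear.tendsto[OF matrix_vector_mul_bounded_linear] x by blast+
  moreover have "f (g *v x t) \<noteq> 0" for t
    using f_mult[OF g] x(5)[of t] transpose_mult_vec(1)[OF g] by (metis matrix_vector_mult_0_right)
  moreover have "act g P \<in> isotropy_planes G"
    using c isotropy_spaces_act[OF g] unfolding connection_data_def isotropy_planes_def by blast
  moreover have "\<forall>p\<in>act g \<kappa>. Fix (isotropy G p) = act g P"
    using c Fix_isotropy_mult[OF g] unfolding connection_data_def by (auto simp: act_def[of g \<kappa>])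
  moreover have "g *v \<xi> \<in> act g P" "g *v \<eta> \<in> act g P" "stable_in (g *v \<eta>) (act g P)"
    using c stable_in_mult[OF g] unfolding connection_data_def by (auto simp: act_def)
  ultimately show ?thesis
    unfolding connection_data_def by blast
qed

text \<open>The equilibrium lies in \<open>P (j - 1)\<close>, where it is a sink, and in
  \<open>P j\<close>, as a limit of the connection in a closed subspace. So it spans their
  intersection, and the isotypic condition concerns its own isotropy group. Being a sink in a plane
  through its own line, it has a negative radial eigenvalue.\<close>

lemma simple_cycle_data:
  assumes sc: "simple_cycle G f M g \<xi> \<kappa>"
  shows "equilibrium_data (\<xi> j) \<and> (\<exists>P. connection_data (\<xi> j) (\<kappa> j) (\<xi> (j + 1)) P)"
proof -
  obtain P where het: "heteroclinic_cycle G f M g \<xi> \<kappa>" and R: "robust_via G f M g \<xi> \<kappa> P" and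
    dimP: "\<And>j. dim (P j) = 2" and nz: "\<And>j. \<xi> j \<noteq> 0" and
    once: "\<And>j C x y. C \<in> components (P (j - 1) \<inter> P j - {0}) \<Longrightarrow>
      x \<in> C \<inter> point_set (cycle_equilibria G \<xi>) (cycle_connections G \<xi> \<kappa>) \<Longrightarrow>
      y \<in> C \<inter> point_set (cycle_equilibria G \<xi>) (cycle_connections G \<xi> \<kappa>) \<Longrightarrow> x = y" and
    axis: "\<And>j. P (j - 1) \<inter> P j \<in> isotropy_axes G" and
    comps: "\<And>j. \<forall>V\<in>isotypic_components {g\<in>G. \<forall>x \<in> P (j - 1) \<inter> P j. g *v x = x}. dim V = 1"
    using sc unfolding simple_cycle_def Let_def by blast
  have PF: "\<exists>\<Sigma>. \<Sigma> \<subseteq> G \<and> P j = Fix \<Sigma>" and kP: "\<kappa> j \<subseteq> P j" and sink: "sink_in f (P j) (\<xi> (j + 1))" for j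
    using R unfolding robust_via_def by blast+
  have subP: "subspace (P j)" for j
    using PF subspace_Fix by metis
  have hyp: "hyperbolic_equilibrium f (\<xi> j)" and conn: "connecting_trajectory f (\<xi> j) (\<kappa> j) (\<xi> (j + 1))" for j
    using het unfolding heteroclinic_cycle_def by blast+
  have f0: "f (\<xi> j) = 0"
    using hyp by (simp add: hyperbolic_equilibrium_def)
  obtain X where X: "solution_on f UNIV X" "\<kappa> j = range X" "(X \<longlongrightarrow> \<xi> j) at_bot" "(X \<longlongrightarrow> \<xi> (j + 1)) at_top"
      "\<And>t. f (X t) \<noteq> 0"
    using connecting_trajectory_solution[OF sm conn] by blast
  have limit_mem: "\<xi> j \<in> S" if "subspace S" "\<And>t. X t \<in> S" for S
    by (rule Lim_in_closed_set[OF closed_subspace[OF that(1)] _ _ X(3)]) (use that in auto)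
  have "X t \<in> P j" for t
    using kP[of j] X(2) by blast
  then have \<xi>P: "\<xi> j \<in> P j"
    by (rule limit_mem[OF subP])
  have sink': "sink_in f (P (j - 1)) (\<xi> j)"
    using sink[of "j - 1"] by simp
  then have \<xi>P': "\<xi> j \<in> P (j - 1)"
    by (simp add: sink_in_def)
  have line: "P (j - 1) \<inter> P j = span {\<xi> j}"
    using axis \<xi>P \<xi>P' nz by (intro one_dim_subspace_eq_span subspace_inter subP)
      (auto simp: isotropy_axes_def isotropy_spaces_def)
  have "g *v v = v" if g: "g *v \<xi> j = \<xi> j" and v: "v \<in> span {\<xi> j}" for g v
  proof -
    obtain k where "v = k *\<^sub>R \<xi> j"
      using span_singletonD[OF v] by blast
    then show ?thesis
      using g by (simp add: matrix_vector_mult_scaleR)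
  qed
  moreover have "\<xi> j \<in> span {\<xi> j}"
    by (simp add: span_base)
  ultimately have "{g\<in>G. \<forall>x \<in> P (j - 1) \<inter> P j. g *v x = x} = isotropy G (\<xi> j)"
    unfolding line isotropy_def by blast
  then have "\<forall>V\<in>isotypic_components (isotropy G (\<xi> j)). dim V = 1"
    using comps[of j] by simp
  then obtain a b c where F: "half_turn_frame G (\<xi> j) a b c"
    using half_turn_frame_exists[OF grp SO nz] by blast
  have ev: "complex_of_real l \<in> eigenvalues_on Q (jacobian f (at x))"
    if "L x v = l *\<^sub>R v" "v \<noteq> 0" "v \<in> Q" "subspace Q" for x v l Q
    using that by (intro real_eigenvalue_in_eigenvalues_on[of _ v])
      (auto simp: jacobian_smooth_mult[OF sm] subspace_0)
  obtain r where r: "L (\<xi> j) (\<xi> j) = r *\<^sub>R \<xi> j"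
    using radial_eigenvector[OF F] by blast
  have "complex_of_real r \<in> eigenvalues_on (P (j - 1)) (jacobian f (at (\<xi> j)))"
    by (rule ev[OF r nz \<xi>P' subP])
  then have "r < 0"
    using sink' by (auto simp: sink_in_def)
  moreover have "l \<noteq> 0" if "v \<noteq> 0" "L (\<xi> j) v = l *\<^sub>R v" for v l
    using ev[OF that(2,1), of UNIV] hyp[of j] by (auto simp: hyperbolic_equilibrium_def)
  ultimately have eq: "equilibrium_data (\<xi> j)"
    using nz f0 F r axis[of j] unfolding equilibrium_data_def line by blast
  obtain \<Sigma> where \<Sigma>: "\<Sigma> \<subseteq> G" "P j = Fix \<Sigma>"
    using PF by blast
  have "P j \<in> planes_through (\<xi> j)"
    using Fix_plane_in_frame[OF F \<Sigma>(1)] \<xi>P dimP[of j] unfolding \<Sigma>(2) planes_through_frame[OF F] by blast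
  then have plane: "P j \<in> isotropy_planes G"
    by (simp add: planes_through_def)
  \<comment> \<open>A smaller isotropy space would be the line of \<open>\<xi> j\<close>, and by
    invariance it would contain the whole connection. At early times the connection would then lie
    on the semiaxis of \<open>\<xi> j\<close>, on which the cycle may have no second point.\<close>
  have isoP: "Fix (isotropy G p) = P j" if p: "p \<in> \<kappa> j" for p
  proof (rule ccontr)
    assume ne: "Fix (isotropy G p) \<noteq> P j"
    let ?Q = "Fix (isotropy G p)"
    have Q: "?Q \<subseteq> P j"
      using isotropy_space_minimal[of "P j" 2 p] plane kP p unfolding isotropy_planes_def by blast
    obtain s where s: "p = X s"
      using p X(2) by blast
    have XQ: "X t \<in> ?Q" for t
    proof (rule solution_in_Fix[OF sm _ X(1)])
      show "X s \<in> ?Q"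
        by (auto simp: s Fix_def isotropy_def)
    qed (auto simp: isotropy_def f_mult)
    then have xQ: "\<xi> j \<in> ?Q"
      using limit_mem[OF subspace_Fix] by blast
    then have "\<not> ?Q \<subseteq> {0}"
      using nz by auto
    then have "dim ?Q \<noteq> 0"
      unfolding dim_eq_0 .
    moreover have "\<not> 2 \<le> dim ?Q"
      using subspace_dim_equal[OF subspace_Fix subP Q] dimP[of j] ne by auto
    ultimately have "dim ?Q = 1"
      by linarith
    then have Qs: "?Q = span {\<xi> j}"
      using one_dim_subspace_eq_span[OF subspace_Fix _ xQ nz] by blast
    have "((\<lambda>t. X t \<bullet> \<xi> j) \<longlongrightarrow> \<xi> j \<bullet> \<xi> j) at_bot"
      by (intro tendsto_intros X(3))
    moreover have "0 < \<xi> j \<bullet> \<xi> j"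
      using nz by simp
    ultimately have "\<forall>\<^sub>F t in at_bot. 0 < X t \<bullet> \<xi> j"
      by (rule order_tendstoD(1))
    then obtain t where t: "0 < X t \<bullet> \<xi> j"
      by (auto simp: eventually_at_bot_linorder)
    obtain k where k: "X t = k *\<^sub>R \<xi> j"
      using XQ[of t] span_singletonD unfolding Qs by blast
    have "k > 0"
      using t k inner_ge_zero[of "\<xi> j"] by (auto simp: zero_less_mult_iff)
    define C where "C = connected_component_set (P (j - 1) \<inter> P j - {0}) (\<xi> j)"
    have Ceq: "C = ray (\<xi> j)"
      using components_punctured_line[OF nz, of j] by (simp add: C_def line ray_def)
    have "C \<in> components (P (j - 1) \<inter> P j - {0})"
      unfolding C_def components_def using \<xi>P \<xi>P' nz by blast
    moreover have "\<xi> j \<in> C" "X t \<in> C"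
      using self_in_ray k \<open>k > 0\<close> by (auto simp: Ceq ray_def)
    moreover have "\<xi> j \<in> cycle_equilibria G \<xi>"
      unfolding cycle_equilibria_def using one by (metis (mono_tags, lifting) matrix_vector_mul_lid mem_Collect_eq)
    moreover have "(\<xi> j, \<kappa> j, \<xi> (j + 1)) \<in> cycle_connections G \<xi> \<kappa>"
      unfolding cycle_connections_def using one act_connection_one by (metis (mono_tags, lifting) mem_Collect_eq)
    then have "X t \<in> point_set (cycle_equilibria G \<xi>) (cycle_connections G \<xi> \<kappa>)"
      unfolding point_set_def using X(2) by force
    ultimately have "\<xi> j = X t"
      by (intro once) (auto simp: point_set_def)
    then show False
      using f0 X(5)[of t] by simp
  qed
  have "stable_in (\<xi> (j + 1)) (P j)"
    unfolding stable_in_def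
    using ev[OF _ _ _ subP] sink[of j] by (fastforce simp: sink_in_def)
  moreover have "\<xi> (j + 1) \<in> P j"
    using sink[of j] by (simp add: sink_in_def)
  ultimately have "connection_data (\<xi> j) (\<kappa> j) (\<xi> (j + 1)) (P j)"
    unfolding connection_data_def using X plane isoP \<xi>P by blast
  then show ?thesis
    using eq by blast
qed

lemma network_cycles:
  obtains \<C> where "\<And>\<xi> \<kappa>. (\<xi>, \<kappa>) \<in> \<C> \<Longrightarrow> \<exists>M g. simple_cycle G f M g \<xi> \<kappa>"
    and "E = (\<Union>(\<xi>, \<kappa>)\<in>\<C>. cycle_equilibria G \<xi>)" and "K = (\<Union>(\<xi>, \<kappa>)\<in>\<C>. cycle_connections G \<xi> \<kappa>)"
proof -
  obtain \<C> where C: "\<forall>(\<xi>, \<kappa>)\<in>\<C>. \<exists>M g. heteroclinic_cycle G f M g \<xi> \<kappa>"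
    and E: "E = (\<Union>(\<xi>, \<kappa>)\<in>\<C>. cycle_equilibria G \<xi>)" and K: "K = (\<Union>(\<xi>, \<kappa>)\<in>\<C>. cycle_connections G \<xi> \<kappa>)"
    using simple unfolding simple_network_def heteroclinic_network_def by blast
  have "\<exists>M g. simple_cycle G f M g \<xi> \<kappa>" if mem: "(\<xi>, \<kappa>) \<in> \<C>" for \<xi> \<kappa>
  proof -
    obtain M g where "heteroclinic_cycle G f M g \<xi> \<kappa>"
      using C mem by blast
    moreover have "cycle_connections G \<xi> \<kappa> \<subseteq> K"
      using K mem by blast
    ultimately show ?thesis
      using simple unfolding simple_network_def by blast
  qed
  then show thesis
    using that E K by blast
qed

lemma equilibrium_in_cycle:
  assumes "x \<in> E"
  obtains M g \<xi> \<kappa> h j where "simple_cycle G f M g \<xi> \<kappa>" "cycle_equilibria G \<xi> \<subseteq> E" "cycle_connections G \<xi> \<kappa> \<subseteq> K"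
    "h \<in> G" "x = h *v \<xi> j"
proof -
  obtain \<C> where C: "\<And>\<xi> \<kappa>. (\<xi>, \<kappa>) \<in> \<C> \<Longrightarrow> \<exists>M g. simple_cycle G f M g \<xi> \<kappa>"
    "E = (\<Union>(\<xi>, \<kappa>)\<in>\<C>. cycle_equilibria G \<xi>)" "K = (\<Union>(\<xi>, \<kappa>)\<in>\<C>. cycle_connections G \<xi> \<kappa>)"
    using network_cycles by blast
  then obtain \<xi> \<kappa> where c: "(\<xi>, \<kappa>) \<in> \<C>" "x \<in> cycle_equilibria G \<xi>"
    using assms by blast
  then obtain M g h j where "simple_cycle G f M g \<xi> \<kappa>" "h \<in> G" "x = h *v \<xi> j"
    using C(1)[OF c(1)] by (auto simp: cycle_equilibria_def)
  then show thesis
    using that C(2,3) c(1) by blast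
qed

lemma connection_in_cycle:
  assumes "c \<in> K"
  obtains M g \<xi> \<kappa> h j where "simple_cycle G f M g \<xi> \<kappa>" "cycle_equilibria G \<xi> \<subseteq> E" "cycle_connections G \<xi> \<kappa> \<subseteq> K"
    "h \<in> G" "c = act_connection h (\<xi> j, \<kappa> j, \<xi> (j + 1))"
proof -
  obtain \<C> where C: "\<And>\<xi> \<kappa>. (\<xi>, \<kappa>) \<in> \<C> \<Longrightarrow> \<exists>M g. simple_cycle G f M g \<xi> \<kappa>"
    "E = (\<Union>(\<xi>, \<kappa>)\<in>\<C>. cycle_equilibria G \<xi>)" "K = (\<Union>(\<xi>, \<kappa>)\<in>\<C>. cycle_connections G \<xi> \<kappa>)"
    using network_cycles by blast
  then obtain \<xi> \<kappa> where c: "(\<xi>, \<kappa>) \<in> \<C>" "c \<in> cycle_connections G \<xi> \<kappa>"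
    using assms by blast
  then obtain M g h j where "simple_cycle G f M g \<xi> \<kappa>" "h \<in> G" "c = act_connection h (\<xi> j, \<kappa> j, \<xi> (j + 1))"
    using C(1)[OF c(1)] by (auto simp: cycle_connections_def)
  then show thesis
    using that C(2,3) c(1) by blast
qed

lemma cycle_equilibria_mult:
  assumes "x \<in> cycle_equilibria G \<xi>" and g: "g \<in> G"
  shows "g *v x \<in> cycle_equilibria G \<xi>"
proof -
  obtain h j where h: "h \<in> G" "x = h *v \<xi> j"
    using assms(1) unfolding cycle_equilibria_def by blast
  have "g *v x = (g ** h) *v \<xi> j"
    by (simp add: h matrix_vector_mul_assoc)
  then show ?thesis
    using mult[OF g h(1)] unfolding cycle_equilibria_def by blast
qed

lemma E_mult:
  assumes "x \<in> E" "g \<in> G"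
  shows "g *v x \<in> E"
proof -
  from assms(1) obtain M g' \<xi> \<kappa> h j where c: "simple_cycle G f M g' \<xi> \<kappa>" "cycle_equilibria G \<xi> \<subseteq> E"
    "cycle_connections G \<xi> \<kappa> \<subseteq> K" "h \<in> G" "x = h *v \<xi> j"
    by (rule equilibrium_in_cycle)
  then have "x \<in> cycle_equilibria G \<xi>"
    unfolding cycle_equilibria_def by blast
  then show ?thesis
    using cycle_equilibria_mult assms(2) c(2) by blast
qed

lemma K_mult:
  assumes "c \<in> K" "g \<in> G"
  shows "act_connection g c \<in> K"
proof -
  from assms(1) obtain M g' \<xi> \<kappa> h j where c: "simple_cycle G f M g' \<xi> \<kappa>" "cycle_equilibria G \<xi> \<subseteq> E"
    "cycle_connections G \<xi> \<kappa> \<subseteq> K" "h \<in> G" "c = act_connection h (\<xi> j, \<kappa> j, \<xi> (j + 1))"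
    by (rule connection_in_cycle)
  then have "act_connection g c = act_connection (g ** h) (\<xi> j, \<kappa> j, \<xi> (j + 1))"
    by (simp add: act_connection_mult)
  then show ?thesis
    using c(3) mult[OF assms(2) c(4)] unfolding cycle_connections_def by blast
qed

lemma equilibrium_data_E: "x \<in> E \<Longrightarrow> equilibrium_data x"
  by (erule equilibrium_in_cycle) (simp add: equilibrium_data_mult simple_cycle_data)

lemma K_data:
  assumes "(\<xi>, \<kappa>, \<eta>) \<in> K"
  shows "\<xi> \<in> E" "\<eta> \<in> E" "\<exists>P. connection_data \<xi> \<kappa> \<eta> P"
proof -
  from assms obtain M g X Y h j where c: "simple_cycle G f M g X Y" "cycle_equilibria G X \<subseteq> E"
    "cycle_connections G X Y \<subseteq> K" "h \<in> G" "(\<xi>, \<kappa>, \<eta>) = act_connection h (X j, Y j, X (j + 1))"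
    by (rule connection_in_cycle)
  then have eq: "\<xi> = h *v X j" "\<kappa> = act h (Y j)" "\<eta> = h *v X (j + 1)"
    by (simp_all add: act_connection_def)
  show "\<xi> \<in> E" "\<eta> \<in> E"
    using c(2,4) unfolding eq cycle_equilibria_def by blast+
  show "\<exists>P. connection_data \<xi> \<kappa> \<eta> P"
    using simple_cycle_data[OF c(1)] connection_data_mult[OF c(4)] unfolding eq by blast
qed

end

lemma eigenvalue_in_plane:
  fixes A :: "'a::real_inner \<Rightarrow> 'a"
  assumes A: "linear A" and x: "x \<noteq> 0" "e \<noteq> 0" "x \<bullet> e = 0" "A x = r *\<^sub>R x" "A e = l *\<^sub>R e"
    and v: "v = j *\<^sub>R x + k *\<^sub>R e" "v \<noteq> 0" "A v = m *\<^sub>R v"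
  shows "m = r \<or> m = l"
proof -
  have "(j * r) *\<^sub>R x + (k * l) *\<^sub>R e = m *\<^sub>R (j *\<^sub>R x + k *\<^sub>R e)"
    using v(3) x unfolding v(1) by (simp add: linear_add[OF A] linear_cmul[OF A])
  then have eq: "((j * r) *\<^sub>R x + (k * l) *\<^sub>R e) \<bullet> w = (m *\<^sub>R (j *\<^sub>R x + k *\<^sub>R e)) \<bullet> w" for w
    by simp
  have "j = 0 \<or> m = r"
    using eq[of x] x by (auto simp: inner_add_left inner_commute[of e x])
  moreover have "k = 0 \<or> m = l"
    using eq[of e] x by (auto simp: inner_add_left)
  moreover have "j \<noteq> 0 \<or> k \<noteq> 0"
    using v(1,2) by auto
  ultimately show ?thesis
    by blast
qed

context simple_maximal_network begin

section \<open>Equilibria on a semiaxis\<close>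

lemma E_D:
  assumes "x \<in> E"
  shows "x \<noteq> 0" "f x = 0" "span {x} \<in> isotropy_axes G" "\<exists>a b c. half_turn_frame G x a b c"
    "\<exists>r<0. L x x = r *\<^sub>R x"
  using equilibrium_data_E[OF assms] unfolding equilibrium_data_def by blast+

lemma E_I:
  assumes "x \<noteq> 0" "span {x} \<in> isotropy_axes G" "f x = 0"
  shows "x \<in> E"
proof -
  have "ray x \<in> isotropy_semiaxes G"
    using assms unfolding isotropy_semiaxes_eq by blast
  then have "x \<in> semiaxis_steady_states G f"
    using self_in_ray assms(3) unfolding semiaxis_steady_states_def by blast
  then show ?thesis
    using maximal unfolding maximal_network_def by blast
qed

lemma equilibrium_on_semiaxis:
  assumes "x \<noteq> 0" "span {x} \<in> isotropy_axes G"
  shows "\<exists>y\<in>E. ray y = ray x"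
proof -
  have "ray x \<in> isotropy_semiaxes G"
    using assms unfolding isotropy_semiaxes_eq by blast
  then obtain y where y: "y \<in> ray x" "y \<in> semiaxis_steady_states G f"
    using maximal unfolding maximal_network_def by blast
  then have "y \<in> E"
    using maximal unfolding maximal_network_def by blast
  moreover have "ray y = ray x"
    using y(1) ray_scale[of _ x] by (auto simp: ray_def[of x])
  ultimately show ?thesis
    by blast
qed

text \<open>On the line of \<open>x\<close> the field is radial, as it takes values in the fixed
  space of the isotropy group of \<open>x\<close>; so zeros of \<open>h\<close> are equilibria. By
  maximality they belong to \<open>E\<close>, where the radial eigenvalue is negative, and
  \<open>h\<close> would have two zeros with negative derivative at every zero between them.\<close>

lemma one_equilibrium_per_semiaxis_aux:
  assumes x: "x \<in> E" and t: "1 < t" "t *\<^sub>R x \<in> E"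
  shows False
proof -
  define h where "h u = f (u *\<^sub>R x) \<bullet> x" for u :: real
  obtain a b c where F: "half_turn_frame G x a b c"
    using E_D[OF x] by blast
  have x0: "x \<noteq> 0" "x \<bullet> x > 0"
    using E_D[OF x] by auto
  have der: "(h has_real_derivative (L (u *\<^sub>R x) x \<bullet> x)) (at u)" for u
  proof -
    have "((\<lambda>u. u *\<^sub>R x) has_vector_derivative x) (at u)"
      by (auto intro!: derivative_eq_intros simp: has_vector_derivative_def)
    then have "(f \<circ> (\<lambda>u. u *\<^sub>R x) has_vector_derivative L (u *\<^sub>R x) x) (at u)"
      by (rule vector_derivative_diff_chain_within[where S = UNIV, simplified])
        (rule smooth_has_derivative[OF sm, THEN has_derivative_at_withinI])
    then show ?thesis
      unfolding h_def has_real_derivative_iff_has_vector_derivative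
      using bounded_linear.has_vector_derivative[OF bounded_linear_inner_left] by (simp add: o_def)
  qed
  have E_u: "u *\<^sub>R x \<in> E" if u: "u \<ge> 1" "h u = 0" for u
  proof (rule E_I)
    show "u *\<^sub>R x \<noteq> 0"
      using u x0 by simp
    have "span {x} = span {u *\<^sub>R x}"
      using u x0 by (intro one_dim_subspace_eq_span subspace_span) (auto simp: dim_span span_base span_scale)
    then show "span {u *\<^sub>R x} \<in> isotropy_axes G"
      using E_D(3)[OF x] by simp
    have "f (u *\<^sub>R x) \<in> Fix (isotropy G x)"
      unfolding Fix_def isotropy_def using f_mult[of _ "u *\<^sub>R x"]
      by (auto simp: matrix_vector_mult_scaleR) metis
    then obtain k where k: "f (u *\<^sub>R x) = k *\<^sub>R x"
      using span_singletonD unfolding Fix_isotropy_frame[OF F] by blast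
    then have "k * (x \<bullet> x) = 0"
      using u(2) by (simp add: h_def)
    then show "f (u *\<^sub>R x) = 0"
      using k x0 by simp
  qed
  have neg: "\<exists>l<0. (h has_real_derivative l) (at u)" if u: "u \<in> {1..t}" "h u = 0" for u
  proof -
    obtain r where r: "r < 0" "L (u *\<^sub>R x) (u *\<^sub>R x) = r *\<^sub>R (u *\<^sub>R x)"
      using E_D(5)[OF E_u] u by auto
    then have "u *\<^sub>R L (u *\<^sub>R x) x = u *\<^sub>R (r *\<^sub>R x)"
      using linear_cmul[OF linear_L] by (simp add: mult.commute)
    moreover have "u \<noteq> 0"
      using u by auto
    ultimately have "L (u *\<^sub>R x) x = r *\<^sub>R x"
      by (simp only: scaleR_cancel_left) simp
    then have "L (u *\<^sub>R x) x \<bullet> x < 0"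
      using r(1) x0 by (simp add: mult_less_0_iff)
    then show ?thesis
      using der by blast
  qed
  show False
  proof (rule no_two_zeros_with_negative_derivative[OF t(1) _ _ _ neg])
    show "h 1 = 0" "h t = 0"
      using E_D(2)[OF x] E_D(2)[OF t(2)] by (simp_all add: h_def)
    show "continuous_on {1..t} h"
      using der by (meson DERIV_isCont continuous_at_imp_continuous_on)
  qed
qed

lemma one_equilibrium_per_semiaxis:
  assumes x: "x \<in> E" and t: "0 < t" "t *\<^sub>R x \<in> E"
  shows "t *\<^sub>R x = x"
proof -
  have "\<not> 1 < t"
    using one_equilibrium_per_semiaxis_aux assms by blast
  moreover have "\<not> t < 1"
  proof
    assume "t < 1"
    then have "1 < 1 / t" "(1 / t) *\<^sub>R (t *\<^sub>R x) \<in> E"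
      using t x by simp_all
    then show False
      using one_equilibrium_per_semiaxis_aux[OF t(2)] by blast
  qed
  ultimately show ?thesis
    by simp
qed

lemma ray_inj_on_E:
  assumes "x \<in> E" "y \<in> E" "y \<in> ray x"
  shows "x = y"
proof -
  obtain t where "t > 0" "y = t *\<^sub>R x"
    using assms(3) by (auto simp: ray_def)
  then show ?thesis
    using one_equilibrium_per_semiaxis[of x t] assms by simp
qed

section \<open>Stability and connections in an isotropy plane\<close>

lemma plane_frame:
  assumes x: "x \<in> E" and P: "P \<in> isotropy_planes G" "x \<in> P"
  obtains e \<rho> l r where "norm e = 1" "x \<bullet> e = 0" "P = span {x, e}" "\<rho> \<in> G" "\<rho> *v x = x" "\<rho> *v e = - e"
    "act \<rho> P = P" "L x e = l *\<^sub>R e" "l \<noteq> 0" "L x x = r *\<^sub>R x" "r < 0"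
proof -
  have Px: "P \<in> planes_through x"
    using P by (simp add: planes_through_def)
  obtain a0 b0 c0 where F0: "half_turn_frame G x a0 b0 c0"
    using E_D[OF x] by blast
  from F0 Px obtain a b c where F: "half_turn_frame G x a b c" "P = span {x, a}"
    by (rule planes_through_cases)
  have a: "norm a = 1" "x \<bullet> a = 0"
    using F(1) unfolding half_turn_frame_def by blast+
  \<comment> \<open>This half-turn acts on \<open>P\<close> as the reflection in the line of
    \<open>x\<close>.\<close>
  obtain \<rho> where \<rho>: "\<rho> \<in> G" "\<rho> *v x = x" "\<rho> *v a = - a"
    using F(1) unfolding half_turn_frame_def by blast
  obtain l where l: "L x a = l *\<^sub>R a"
    using frame_eigenvector[OF F(1)] by blast
  have "a \<noteq> 0"
    using a by auto
  then have "l \<noteq> 0"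
    using l equilibrium_data_E[OF x] unfolding equilibrium_data_def by blast
  obtain r where r: "r < 0" "L x x = r *\<^sub>R x"
    using E_D[OF x] by blast
  have "act \<rho> P = P"
    by (rule isotropy_preserves_planes_through[OF F0 Px \<rho>(1,2)])
  then show thesis
    using that a F(2) \<rho> l \<open>l \<noteq> 0\<close> r by blast
qed

text \<open>The radial eigenvalue is negative in any case, so the sign of the transverse eigenvalue
  \<open>l\<close>, which is not 0 by hyperbolicity, decides.\<close>

lemma stable_or_unstable:
  assumes x: "x \<in> E" and P: "P \<in> isotropy_planes G" "x \<in> P"
  shows "stable_in x P \<or> unstable_in x P"
proof -
  from x P obtain e \<rho> l r where e: "norm e = 1" "x \<bullet> e = 0" "P = span {x, e}" "\<rho> \<in> G" "\<rho> *v x = x" "\<rho> *v e = - e"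
    "act \<rho> P = P" "L x e = l *\<^sub>R e" "l \<noteq> 0" "L x x = r *\<^sub>R x" "r < 0"
    by (rule plane_frame)
  have x0: "x \<bullet> x \<noteq> 0"
    using E_D(1)[OF x] by simp
  have e0: "e \<noteq> 0" "e \<bullet> e = 1"
    using e(1) by (auto simp: dot_square_norm)
  show ?thesis
  proof (cases "l > 0")
    case True
    have "e \<in> P"
      by (simp add: e(3) span_base)
    then show ?thesis
      using e(8) e0 True unfolding unstable_in_def by blast
  next
    case False
    have "m < 0" if v: "v \<in> P" "v \<noteq> 0" "L x v = m *\<^sub>R v" for v m
    proof -
      obtain j k where jk: "v = j *\<^sub>R x + k *\<^sub>R e"
        using v(1) span_pairD unfolding e(3) by blast
      have "m = r \<or> m = l"
        by (rule eigenvalue_in_plane[OF linear_L E_D(1)[OF x] e0(1) e(2,10,8) jk v(2,3)])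
      then show ?thesis
        using e(9,11) False by auto
    qed
    then show ?thesis
      unfolding stable_in_def by blast
  qed
qed

text \<open>Otherwise both eigenvalues in \<open>P\<close> are negative. In the orthogonal basis
  \<open>\<xi>\<close>, \<open>e\<close> the quadratic form of the linearisation is then at most
  \<open>- min (- l) (- r)\<close> times the squared norm, and no nonconstant trajectory in
  \<open>P\<close> leaves \<open>\<xi>\<close>.\<close>

lemma connection_starts_unstable:
  assumes x: "\<xi> \<in> E" and c: "connection_data \<xi> \<kappa> \<eta> P"
  shows "unstable_in \<xi> P"
proof (rule ccontr)
  assume nu: "\<not> unstable_in \<xi> P"
  have P: "P \<in> isotropy_planes G" "\<xi> \<in> P"
    using c unfolding connection_data_def by blast+
  from x P obtain e \<rho> l r where e: "norm e = 1" "\<xi> \<bullet> e = 0" "P = span {\<xi>, e}" "\<rho> \<in> G" "\<rho> *v \<xi> = \<xi>" "\<rho> *v e = - e"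
    "act \<rho> P = P" "L \<xi> e = l *\<^sub>R e" "l \<noteq> 0" "L \<xi> \<xi> = r *\<^sub>R \<xi>" "r < 0"
    by (rule plane_frame)
  have e0: "e \<noteq> 0" "e \<bullet> e = 1"
    using e(1) by (auto simp: dot_square_norm)
  have "e \<in> P"
    by (simp add: e(3) span_base)
  then have "\<not> l > 0"
    using nu e(8) e0 unfolding unstable_in_def by blast
  then have l: "l < 0"
    using e(9) by simp
  obtain x where X: "solution_on f UNIV x" "\<kappa> = range x" "(x \<longlongrightarrow> \<xi>) at_bot" "\<And>t. f (x t) \<noteq> 0"
    using c unfolding connection_data_def by blast
  have "x t \<in> Fix (isotropy G (x t))" for t
    by (simp add: Fix_def isotropy_def)
  then have xP: "x t \<in> P" for t
    using c X(2) unfolding connection_data_def by blast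
  have "\<exists>t. x t = \<xi>"
  proof (rule no_trajectory_leaves_sink[OF sm E_D(2)[OF x] X(1,3) _ P(2) xP, where c = "min (- l) (- r)"])
    show "subspace P"
      by (simp add: e(3) subspace_span)
    show "0 < min (- l) (- r)"
      using l e(11) by simp
    fix v assume "v \<in> P"
    then obtain j k where jk: "v = j *\<^sub>R \<xi> + k *\<^sub>R e"
      using span_pairD unfolding e(3) by blast
    have Lv: "L \<xi> v = (j * r) *\<^sub>R \<xi> + (k * l) *\<^sub>R e"
      unfolding jk by (simp add: linear_add[OF linear_L] linear_cmul[OF linear_L] e(8,10))
    have "v \<bullet> L \<xi> v = r * (j\<^sup>2 * (\<xi> \<bullet> \<xi>)) + l * k\<^sup>2"
      unfolding Lv unfolding jk using e(2) e0
      by (simp add: inner_add_left inner_add_right inner_commute[of e \<xi>] power2_eq_square)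
    also have "\<dots> \<le> - min (- l) (- r) * (j\<^sup>2 * (\<xi> \<bullet> \<xi>)) + - min (- l) (- r) * k\<^sup>2"
      by (intro add_mono mult_right_mono) auto
    also have "\<dots> = - min (- l) (- r) * (v \<bullet> v)"
      unfolding jk using e(2) e0
      by (simp add: inner_add_left inner_add_right inner_commute[of e \<xi>] power2_eq_square algebra_simps)
    finally show "v \<bullet> L \<xi> v \<le> - min (- l) (- r) * (v \<bullet> v)" .
  qed
  then show False
    using X(4) E_D(2)[OF x] by metis
qed

text \<open>The trajectory \<open>Y\<close> is compared together with its mirror image
  \<open>Z\<close> in the line of \<open>\<xi>\<close>. As \<open>Y\<close> and \<open>Z\<close>
  leave on opposite sides, \<open>X\<close> cannot be opposite to both, so it meets one of them;
  meeting trajectories have the same range and the same limit.\<close>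

lemma connection_unique_in_plane:
  assumes x: "\<xi> \<in> E" and c: "connection_data \<xi> \<kappa> \<eta> P" and c': "connection_data \<xi> \<kappa>' \<eta>' P"
  shows "\<exists>g\<in>G. act_connection g (\<xi>, \<kappa>', \<eta>') = (\<xi>, \<kappa>, \<eta>)"
proof -
  have P: "P \<in> isotropy_planes G" "\<xi> \<in> P"
    using c unfolding connection_data_def by blast+
  from x P obtain e \<rho> l r where e: "norm e = 1" "\<xi> \<bullet> e = 0" "P = span {\<xi>, e}" "\<rho> \<in> G" "\<rho> *v \<xi> = \<xi>" "\<rho> *v e = - e"
    "act \<rho> P = P" "L \<xi> e = l *\<^sub>R e" "l \<noteq> 0" "L \<xi> \<xi> = r *\<^sub>R \<xi>" "r < 0"
    by (rule plane_frame)
  have x0: "\<xi> \<noteq> 0" "f \<xi> = 0"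
    using E_D[OF x] by blast+
  \<comment> \<open>As \<open>\<xi>\<close> is not stable in \<open>P\<close> and \<open>r\<close>
    is negative, the positive eigenvalue is the transverse one.\<close>
  have "l > 0"
  proof -
    have "\<not> stable_in \<xi> P"
      using connection_starts_unstable[OF x c] not_stable_and_unstable by blast
    then obtain v m where v: "v \<in> P" "v \<noteq> 0" "L \<xi> v = m *\<^sub>R v" "\<not> m < 0"
      unfolding stable_in_def by blast
    obtain j k where jk: "v = j *\<^sub>R \<xi> + k *\<^sub>R e"
      using v(1) span_pairD unfolding e(3) by blast
    have "e \<noteq> 0"
      using e(1) by auto
    then have "m = r \<or> m = l"
      by (rule eigenvalue_in_plane[OF linear_L x0(1) _ e(2,10,8) jk v(2,3)])
    then show ?thesis
      using v(4) e(9,11) by auto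
  qed
  define u where "u = \<xi> /\<^sub>R norm \<xi>"
  have u: "norm u = 1" "u \<bullet> e = 0"
    using x0 e(2) by (simp_all add: u_def)
  have Lu: "L \<xi> u = - (- r) *\<^sub>R u"
    by (simp add: u_def linear_cmul[OF linear_L] e(10) mult.commute)
  have "norm \<xi> *\<^sub>R u \<in> span {u, e}"
    by (intro span_scale span_base) simp
  then have \<xi>u: "\<xi> \<in> span {u, e}"
    using x0 by (simp add: u_def)
  have Pu: "P \<subseteq> span {u, e}"
    unfolding e(3) using \<xi>u by (intro span_minimal subspace_span) (auto simp: span_base)
  have sol: "\<exists>y. solution_on f UNIV y \<and> k = range y \<and> (y \<longlongrightarrow> \<xi>) at_bot \<and> (y \<longlongrightarrow> z) at_top \<and>
      (\<forall>t. y t \<noteq> \<xi>) \<and> (\<forall>t. y t \<in> P)" if d: "connection_data \<xi> k z P" for k z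
  proof -
    obtain y where y: "solution_on f UNIV y" "k = range y" "(y \<longlongrightarrow> \<xi>) at_bot" "(y \<longlongrightarrow> z) at_top" "\<And>t. f (y t) \<noteq> 0"
      using d unfolding connection_data_def by blast
    have "y t \<in> Fix (isotropy G (y t))" for t
      by (simp add: Fix_def isotropy_def)
    then have "y t \<in> P" for t
      using d y(2) unfolding connection_data_def by blast
    moreover have "y t \<noteq> \<xi>" for t
      using y(5)[of t] x0 by auto
    ultimately show ?thesis
      using y by blast
  qed
  obtain X where X: "solution_on f UNIV X" "\<kappa> = range X" "(X \<longlongrightarrow> \<xi>) at_bot" "(X \<longlongrightarrow> \<eta>) at_top"
      "\<And>t. X t \<noteq> \<xi>" "\<And>t. X t \<in> P"
    using sol[OF c] by blast
  obtain Y where Y: "solution_on f UNIV Y" "\<kappa>' = range Y" "(Y \<longlongrightarrow> \<xi>) at_bot" "(Y \<longlongrightarrow> \<eta>') at_top"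
      "\<And>t. Y t \<noteq> \<xi>" "\<And>t. Y t \<in> P"
    using sol[OF c'] by blast
  define Z where "Z t = \<rho> *v Y t" for t
  have c'': "connection_data \<xi> (act \<rho> \<kappa>') (\<rho> *v \<eta>') P"
    using connection_data_mult[OF e(4) c'] e(5,7) by simp
  have Z: "solution_on f UNIV Z" "act \<rho> \<kappa>' = range Z" "(Z \<longlongrightarrow> \<xi>) at_bot" "(Z \<longlongrightarrow> \<rho> *v \<eta>') at_top"
      "\<And>t. Z t \<noteq> \<xi>" "\<And>t. Z t \<in> P"
  proof -
    show "solution_on f UNIV Z"
      unfolding Z_def by (rule solution_on_symmetry[OF f_mult[OF e(4)] Y(1)])
    show "act \<rho> \<kappa>' = range Z"
      by (auto simp: act_def Y(2) Z_def)
    have "(Z \<longlongrightarrow> \<rho> *v \<xi>) at_bot" "(Z \<longlongrightarrow> \<rho> *v \<eta>') at_top"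
      unfolding Z_def using bounded_linear.tendsto[OF matrix_vector_mul_bounded_linear] Y(3,4) by blast+
    then show "(Z \<longlongrightarrow> \<xi>) at_bot" "(Z \<longlongrightarrow> \<rho> *v \<eta>') at_top"
      by (simp_all add: e(5))
    show "Z t \<noteq> \<xi>" for t
      using Y(5)[of t] transpose_mult_vec(1)[OF e(4)] e(5) unfolding Z_def by metis
    show "Z t \<in> P" for t
      using Y(6)[of t] mult_mem_act[OF e(4), of "Y t" P] by (simp add: Z_def e(7))
  qed
  have branches: "(\<exists>s t. X s = W t) \<or> (\<exists>T. \<forall>s\<le>T. \<forall>t\<le>T. ((X s - \<xi>) \<bullet> e) * ((W t - \<xi>) \<bullet> e) < 0)"
    if W: "solution_on f UNIV W" "(W \<longlongrightarrow> \<xi>) at_bot" "\<And>t. W t \<noteq> \<xi>" "\<And>t. W t \<in> P" for W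
  proof (rule saddle_branches_meet[OF sm x0(2) u(1) e(1) u(2) \<xi>u Lu e(8) _ \<open>l > 0\<close> X(1,3) _ X(5) W(1,2) _ W(3)])
    show "- r > 0"
      using e(11) by simp
    show "X t \<in> span {u, e}" "W t \<in> span {u, e}" for t
      using X(6) W(4) Pu by blast+
  qed
  have same: "range X = range W \<and> \<eta> = z"
    if W: "solution_on f UNIV W" "(W \<longlongrightarrow> z) at_top" and meet: "X s = W t" for W z s t
  proof -
    have "X = (\<lambda>v. W (v + (t - s)))"
      by (rule ext) (rule solutions_meet_imp_range_eq(1)[OF sm X(1) W(1) meet])
    moreover have "((\<lambda>v. W (v + (t - s))) \<longlongrightarrow> z) at_top"
      by (rule filterlim_compose[OF W(2)])
        (use filterlim_tendsto_add_at_top[OF tendsto_const[of "t - s"] filterlim_ident] in \<open>simp add: add.commute\<close>)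
    ultimately have "(X \<longlongrightarrow> z) at_top"
      by simp
    then have "\<eta> = z"
      using X(4) tendsto_unique trivial_limit_at_top_linorder by blast
    then show ?thesis
      using solutions_meet_imp_range_eq(2)[OF sm X(1) W(1) meet] by blast
  qed
  consider s t where "X s = Y t" | s t where "X s = Z t"
    | T T' where "\<And>s t. s \<le> T \<Longrightarrow> t \<le> T \<Longrightarrow> ((X s - \<xi>) \<bullet> e) * ((Y t - \<xi>) \<bullet> e) < 0"
      "\<And>s t. s \<le> T' \<Longrightarrow> t \<le> T' \<Longrightarrow> ((X s - \<xi>) \<bullet> e) * ((Z t - \<xi>) \<bullet> e) < 0"
    using branches[OF Y(1,3,5,6)] branches[OF Z(1,3,5,6)] by blast
  then show ?thesis
  proof cases
    case 1
    then have "act_connection (mat 1) (\<xi>, \<kappa>', \<eta>') = (\<xi>, \<kappa>, \<eta>)"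
      using same[OF Y(1,4)] X(2) Y(2) by simp
    then show ?thesis
      using one by blast
  next
    case 2
    then have "act_connection \<rho> (\<xi>, \<kappa>', \<eta>') = (\<xi>, \<kappa>, \<eta>)"
      using same[OF Z(1,4)] X(2) Z(2) e(5) by (simp add: act_connection_def)
    then show ?thesis
      using e(4) by blast
  next
    case 3
    define v where "v = min T T'"
    have "(Z v - \<xi>) \<bullet> e = (\<rho> *v (Y v - \<xi>)) \<bullet> e"
      by (simp add: Z_def matrix_vector_mult_diff_distrib e(5))
    also have "\<dots> = - ((\<rho> *v (Y v - \<xi>)) \<bullet> (\<rho> *v e))"
      by (simp add: e(6))
    also have "\<dots> = - ((Y v - \<xi>) \<bullet> e)"
      by (simp only: inner_G[OF e(4)])
    finally have "(Z v - \<xi>) \<bullet> e = - ((Y v - \<xi>) \<bullet> e)" .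
    then have "((X v - \<xi>) \<bullet> e) * ((Z v - \<xi>) \<bullet> e) = - (((X v - \<xi>) \<bullet> e) * ((Y v - \<xi>) \<bullet> e))"
      by simp
    moreover have "((X v - \<xi>) \<bullet> e) * ((Y v - \<xi>) \<bullet> e) < 0" "((X v - \<xi>) \<bullet> e) * ((Z v - \<xi>) \<bullet> e) < 0"
      using 3 by (simp_all add: v_def)
    ultimately show ?thesis
      by linarith
  qed
qed


text \<open>The lines spanned by the equilibria in \<open>P\<close> are mirrors of reflections of \<open>P\<close>, and a connection
  lies in one of the chambers that they bound.\<close>

lemma mirror_side:
  assumes y: "y \<in> E" "y \<in> P" and c: "connection_data \<xi> \<kappa> \<eta> P" and p: "p \<in> \<kappa>" and s: "s \<in> P"
    and max: "\<And>g. g \<in> G \<Longrightarrow> act g P = P \<Longrightarrow> (g *v s) \<bullet> p \<le> s \<bullet> p"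
  obtains n where "norm n = 1" "y \<bullet> n = 0" "P = span {y, n}" "0 \<le> n \<bullet> s" "0 \<le> n \<bullet> \<xi>" "0 \<le> n \<bullet> \<eta>"
proof -
  have P: "P \<in> isotropy_planes G"
    using c unfolding connection_data_def by blast
  from y(1) P y(2) obtain e \<rho> l r where e: "norm e = 1" "y \<bullet> e = 0" "P = span {y, e}" "\<rho> \<in> G" "\<rho> *v y = y"
    "\<rho> *v e = - e" "act \<rho> P = P" "L y e = l *\<^sub>R e" "l \<noteq> 0" "L y y = r *\<^sub>R y" "r < 0"
    by (rule plane_frame)
  obtain x where X: "solution_on f UNIV x" "\<kappa> = range x" "(x \<longlongrightarrow> \<xi>) at_bot" "(x \<longlongrightarrow> \<eta>) at_top"
    using c unfolding connection_data_def by blast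
  have iso: "Fix (isotropy G q) = P" if "q \<in> \<kappa>" for q
    using c that unfolding connection_data_def by blast
  have q_mem: "q \<in> P" if q: "q \<in> \<kappa>" for q
  proof -
    have "q \<in> Fix (isotropy G q)"
      by (simp add: Fix_def isotropy_def)
    then show ?thesis
      using iso[OF q] by simp
  qed
  \<comment> \<open>A point on the line of \<open>y\<close> has its isotropy space inside this axis,
    but along the connection the isotropy space is all of \<open>P\<close>.\<close>
  have off: "e \<bullet> q \<noteq> 0" if q: "q \<in> \<kappa>" for q
  proof
    assume 0: "e \<bullet> q = 0"
    obtain j k where jk: "q = j *\<^sub>R y + k *\<^sub>R e"
      using q_mem[OF q] span_pairD unfolding e(3) by blast
    have "k = 0"
      using 0 e(1,2) unfolding jk by (simp add: inner_add_right inner_commute[of e y] dot_square_norm)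
    then have "q \<in> span {y}"
      by (simp add: jk span_base span_scale)
    then have "P \<subseteq> span {y}"
      using isotropy_space_minimal[of "span {y}" 1 q] E_D(3)[OF y(1)] iso[OF q]
      unfolding isotropy_axes_def by blast
    then have "dim P \<le> dim (span {y})"
      by (rule dim_subset)
    moreover have "dim P = 2"
      using P by (simp add: isotropy_planes_def isotropy_spaces_def)
    ultimately show False
      using dim_singleton[of y] by (simp add: dim_span split: if_splits)
  qed
  \<comment> \<open>The normal of the mirror points to the side of \<open>p\<close>, and by
    connectedness the whole connection stays on that side.\<close>
  define n where "n = sgn (e \<bullet> p) *\<^sub>R e"
  have sg: "\<bar>sgn (e \<bullet> p)\<bar> = 1"
    using off[OF p] by (simp add: abs_sgn_eq)
  have n: "norm n = 1" "y \<bullet> n = 0" "n \<bullet> p > 0" "\<rho> *v n = - n" "\<And>q. n \<bullet> q = sgn (e \<bullet> p) * (e \<bullet> q)"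
    using sg e off[OF p] by (simp_all add: n_def matrix_vector_mult_scaleR sgn_if)
  have Pn: "P = span {y, n}"
  proof -
    have "span {y, n} \<subseteq> span {y, e}"
      by (intro span_minimal subspace_span) (auto simp: n_def span_base span_scale)
    moreover have "n \<noteq> 0" "e \<noteq> 0"
      using n(1) e(1) by auto
    then have "dim (span {y, n}) = 2" "dim (span {y, e}) = 2"
      using dim_span_orthogonal_pair E_D(1)[OF y(1)] n(2) e(2) by blast+
    ultimately have "span {y, n} = span {y, e}"
      by (intro subspace_dim_equal subspace_span) simp_all
    then show ?thesis
      by (simp add: e(3))
  qed
  have pos: "n \<bullet> q > 0" if q: "q \<in> \<kappa>" for q
  proof (rule ccontr)
    assume "\<not> n \<bullet> q > 0"
    moreover have "topological_space_class.connected \<kappa>"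
      unfolding X(2) by (intro connected_continuous_image solution_on_continuous[OF X(1)] connected_UNIV)
    ultimately obtain z where "z \<in> \<kappa>" "n \<bullet> z = 0"
      using connected_ivt_hyperplane[of \<kappa> q p n 0] q p n(3) by auto
    then show False
      using off[of z] sg n(5)[of z] by auto
  qed
  have lim_nonneg: "0 \<le> n \<bullet> w" if w: "(x \<longlongrightarrow> w) F" "F \<noteq> bot" for w F
  proof (rule tendsto_lowerbound[of "\<lambda>t. n \<bullet> x t"])
    show "((\<lambda>t. n \<bullet> x t) \<longlongrightarrow> n \<bullet> w) F"
      by (intro tendsto_intros w)
    show "\<forall>\<^sub>F t in F. 0 \<le> n \<bullet> x t"
      using pos X(2) by (intro always_eventually) (auto intro: less_imp_le)
    show "F \<noteq> bot"
      by (rule w(2))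
  qed
  \<comment> \<open>Reflecting \<open>s\<close> in the mirror must not increase the inner product
    with \<open>p\<close>, so \<open>s\<close> is on the side of \<open>p\<close>.\<close>
  have "0 \<le> n \<bullet> s"
  proof -
    obtain j k where jk: "s = j *\<^sub>R y + k *\<^sub>R n"
      using s span_pairD unfolding Pn by blast
    have \<rho>s: "\<rho> *v s = j *\<^sub>R y - k *\<^sub>R n"
      using e(5) n(4) by (simp add: jk matrix_vector_right_distrib matrix_vector_mult_scaleR)
    have "(\<rho> *v s) \<bullet> p \<le> s \<bullet> p"
      by (rule max[OF e(4,7)])
    then have "0 \<le> k * (n \<bullet> p)"
      unfolding \<rho>s unfolding jk by (simp add: inner_add_left inner_diff_left)
    then have "0 \<le> k"
      using n(3) by (simp add: zero_le_mult_iff)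
    moreover have "n \<bullet> s = k"
      unfolding jk using n(1,2) by (simp add: inner_add_right inner_commute[of n y] dot_square_norm)
    ultimately show ?thesis
      by simp
  qed
  moreover have "0 \<le> n \<bullet> \<xi>" "0 \<le> n \<bullet> \<eta>"
    using lim_nonneg X(3,4) by simp_all
  ultimately show thesis
    using that n(1,2) Pn by blast
qed

lemma parallel_if_orthogonal_in_plane:
  assumes "P = span {y, n}" "norm n = 1" "y \<bullet> n = 0" "z \<in> P" "n \<bullet> z = 0"
  shows "\<exists>t. z = t *\<^sub>R y"
proof -
  obtain j k where jk: "z = j *\<^sub>R y + k *\<^sub>R n"
    using assms(1,4) span_pairD by blast
  have "k = 0"
    using assms(2,3,5) unfolding jk by (simp add: inner_add_right inner_commute[of n y] dot_square_norm)
  then show ?thesis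
    using jk by auto
qed

text \<open>For each of the mirrors through \<open>\<xi>\<close>, \<open>\<eta>\<close> and
  \<open>s\<close>, all three points lie on the same closed side. The walls through
  \<open>\<xi>\<close> and \<open>\<eta>\<close> bound a sector containing \<open>s\<close>; if
  \<open>s\<close> were in its interior, its own mirror would separate \<open>\<xi>\<close> from
  \<open>\<eta>\<close>. So \<open>s\<close> lies on one of the two bounding rays, and each ray
  carries only one equilibrium.\<close>

lemma chamber_equilibrium:
  assumes \<xi>: "\<xi> \<in> E" and \<eta>: "\<eta> \<in> E" and c: "connection_data \<xi> \<kappa> \<eta> P" and s: "s \<in> E" "s \<in> P"
    and p: "p \<in> \<kappa>" and max: "\<And>g. g \<in> G \<Longrightarrow> act g P = P \<Longrightarrow> (g *v s) \<bullet> p \<le> s \<bullet> p"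
  shows "s = \<xi> \<or> s = \<eta>"
proof -
  have mem: "\<xi> \<in> P" "\<eta> \<in> P" and st: "stable_in \<eta> P"
    using c unfolding connection_data_def by blast+
  have "\<xi> \<noteq> \<eta>"
    using connection_starts_unstable[OF \<xi> c] st not_stable_and_unstable by blast
  have nz: "\<xi> \<noteq> 0" "\<eta> \<noteq> 0" "s \<noteq> 0"
    using E_D(1) \<xi> \<eta> s by blast+
  from \<xi> mem(1) c p s(2) max obtain a where a: "norm a = 1" "\<xi> \<bullet> a = 0" "P = span {\<xi>, a}" "0 \<le> a \<bullet> s" "0 \<le> a \<bullet> \<xi>" "0 \<le> a \<bullet> \<eta>"
    by (rule mirror_side)
  from \<eta> mem(2) c p s(2) max obtain b where b: "norm b = 1" "\<eta> \<bullet> b = 0" "P = span {\<eta>, b}" "0 \<le> b \<bullet> s" "0 \<le> b \<bullet> \<xi>" "0 \<le> b \<bullet> \<eta>"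
    by (rule mirror_side)
  from s c p s(2) max obtain d where d: "norm d = 1" "s \<bullet> d = 0" "P = span {s, d}" "0 \<le> d \<bullet> s" "0 \<le> d \<bullet> \<xi>" "0 \<le> d \<bullet> \<eta>"
    by (rule mirror_side)
  have same: "z = y" if "y \<in> E" "z \<in> E" "z = t *\<^sub>R y" "t > 0" for y z t
    using one_equilibrium_per_semiaxis[of y t] that by simp
  show ?thesis
  proof (cases "a \<bullet> \<eta> = 0")
    \<comment> \<open>Two equilibria on one line lie on opposite rays, and the sector is a
      half-plane: \<open>d\<close> is nonnegative on both rays, hence orthogonal to them.\<close>
    case True
    obtain t where t: "\<eta> = t *\<^sub>R \<xi>"
      using parallel_if_orthogonal_in_plane[OF a(3,1,2) mem(2) True] by blast
    have "\<not> t > 0"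
      using same[OF \<xi> \<eta> t] \<open>\<xi> \<noteq> \<eta>\<close> by blast
    then have "t < 0"
      using t nz by (cases "t = 0") auto
    have "d \<bullet> \<eta> = t * (d \<bullet> \<xi>)"
      by (simp add: t)
    then have "d \<bullet> \<xi> = 0"
      using d(5,6) \<open>t < 0\<close> by (smt (verit) mult_neg_pos)
    then have "\<exists>u. \<xi> = u *\<^sub>R s"
      by (rule parallel_if_orthogonal_in_plane[OF d(3,1,2) mem(1)])
    then obtain u where u: "\<xi> = u *\<^sub>R s" "u \<noteq> 0"
      using nz by auto
    show ?thesis
    proof (cases "u > 0")
      case True
      then show ?thesis
        using same[OF s(1) \<xi> u(1)] by simp
    next
      case False
      have "\<eta> = (t * u) *\<^sub>R s"
        using t u by simp
      moreover have "t * u > 0"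
        using \<open>t < 0\<close> u(2) False by (simp add: zero_less_mult_iff)
      ultimately have "\<eta> = s"
        by (rule same[OF s(1) \<eta>])
      then show ?thesis
        by simp
    qed
  next
    case False
    then have a\<eta>: "a \<bullet> \<eta> > 0"
      using a(6) by simp
    \<comment> \<open>The coordinates \<open>q\<close> and \<open>p'\<close> of \<open>s\<close>
      along \<open>\<eta>\<close> and \<open>\<xi>\<close> are nonnegative by the two walls; the
      mirror of \<open>s\<close> makes
      \<open>q * (d \<bullet> \<eta>) + p' * (d \<bullet> \<xi>)\<close> a vanishing sum of
      nonnegative terms.\<close>
    define q where "q = (a \<bullet> s) / (a \<bullet> \<eta>)"
    have q: "q \<ge> 0"
      using a a\<eta> by (simp add: q_def)
    have "a \<bullet> (s - q *\<^sub>R \<eta>) = 0"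
      using a\<eta> by (simp add: inner_diff_right q_def)
    moreover have "s - q *\<^sub>R \<eta> \<in> P"
      using s(2) mem unfolding a(3) by (intro span_diff span_scale)
    ultimately obtain p' where "s - q *\<^sub>R \<eta> = p' *\<^sub>R \<xi>"
      using parallel_if_orthogonal_in_plane[OF a(3,1,2)] by blast
    then have seq: "s = q *\<^sub>R \<eta> + p' *\<^sub>R \<xi>"
      by (simp add: algebra_simps)
    have indep: "t = 0 \<or> u = 0" if "\<eta> = t *\<^sub>R z" "\<xi> = u *\<^sub>R z" for t u z
    proof -
      have "0 < t * (a \<bullet> z)" "u * (a \<bullet> z) = 0"
        using a\<eta> a(2) that by (simp_all add: inner_commute)
      then show ?thesis
        by (cases "a \<bullet> z = 0") simp_all
    qed
    have "b \<bullet> \<xi> \<noteq> 0"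
    proof
      assume "b \<bullet> \<xi> = 0"
      then obtain t where t: "\<xi> = t *\<^sub>R \<eta>"
        using parallel_if_orthogonal_in_plane[OF b(3,1,2) mem(1)] by blast
      then have "t = 0"
        using indep[of 1 \<eta> t] by simp
      then show False
        using t nz by simp
    qed
    then have "b \<bullet> \<xi> > 0"
      using b(5) by simp
    moreover have "b \<bullet> s = p' * (b \<bullet> \<xi>)"
      using b(2) by (simp add: seq inner_add_right inner_commute)
    ultimately have p': "p' \<ge> 0"
      using b(4) by (simp add: zero_le_mult_iff)
    have "d \<bullet> s = q * (d \<bullet> \<eta>) + p' * (d \<bullet> \<xi>)"
      by (subst seq) (simp add: inner_add_right)
    then have "q * (d \<bullet> \<eta>) + p' * (d \<bullet> \<xi>) = 0"
      using d(2) by (simp add: inner_commute)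
    moreover have "q * (d \<bullet> \<eta>) \<ge> 0" "p' * (d \<bullet> \<xi>) \<ge> 0"
      using q p' d by simp_all
    ultimately have z: "q = 0 \<or> d \<bullet> \<eta> = 0" "p' = 0 \<or> d \<bullet> \<xi> = 0"
      by (auto simp: add_nonneg_eq_0_iff)
    have "q = 0 \<or> p' = 0"
    proof (rule ccontr)
      assume "\<not> ?thesis"
      then obtain t u where "\<eta> = t *\<^sub>R s" "\<xi> = u *\<^sub>R s"
        using z parallel_if_orthogonal_in_plane[OF d(3,1,2)] mem by metis
      then show False
        using indep nz by (metis scaleR_zero_left)
    qed
    then show ?thesis
    proof
      assume "q = 0"
      then have "s = p' *\<^sub>R \<xi>" "p' > 0"
        using seq nz p' by (auto simp: less_le)
      then have "s = \<xi>"
        by (rule same[OF \<xi> s(1)])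
      then show ?thesis
        by simp
    next
      assume "p' = 0"
      then have "s = q *\<^sub>R \<eta>" "q > 0"
        using seq nz q by (auto simp: less_le)
      then have "s = \<eta>"
        by (rule same[OF \<eta> s(1)])
      then show ?thesis
        by simp
    qed
  qed
qed

text \<open>This is the usual way to move a point into a chamber: among the images of
  \<open>s\<close> under the finite stabiliser of \<open>P\<close>, one with largest inner product
  with a point \<open>p\<close> of the connection is on the side of \<open>p\<close> for every
  mirror through an equilibrium.\<close>

lemma equilibrium_in_connection_plane:
  assumes \<xi>: "\<xi> \<in> E" and \<eta>: "\<eta> \<in> E" and c: "connection_data \<xi> \<kappa> \<eta> P" and s: "s \<in> E" "s \<in> P"
  shows "\<exists>g\<in>G. act g P = P \<and> (g *v s = \<xi> \<or> g *v s = \<eta>)"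
proof -
  obtain x :: "real \<Rightarrow> R4" where "\<kappa> = range x"
    using c unfolding connection_data_def by blast
  then obtain p where p: "p \<in> \<kappa>"
    by blast
  define N where "N = {g \<in> G. act g P = P}"
  have N: "finite N" "N \<noteq> {}"
    using fin one by (auto simp: N_def)
  define F where "F h = (h *v s) \<bullet> p" for h
  have "Max (F ` N) \<in> F ` N"
    using N by (intro Max_in) auto
  then obtain g where "g \<in> N" "F g = Max (F ` N)"
    by auto
  moreover have "F h \<le> Max (F ` N)" if "h \<in> N" for h
    using N that by (intro Max_ge) auto
  ultimately have g: "g \<in> N" "\<And>h. h \<in> N \<Longrightarrow> (h *v s) \<bullet> p \<le> (g *v s) \<bullet> p"
    by (simp_all add: F_def)
  have gG: "g \<in> G" "act g P = P"
    using g(1) by (auto simp: N_def)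
  have "g *v s = \<xi> \<or> g *v s = \<eta>"
  proof (rule chamber_equilibrium[OF \<xi> \<eta> c _ _ p])
    show "g *v s \<in> E"
      using E_mult s gG by blast
    show "g *v s \<in> P"
      using mult_mem_act[OF gG(1), of s P] s gG by simp
    fix h assume h: "h \<in> G" "act h P = P"
    have "act (h ** g) P = P"
      using h gG by (simp add: act_mult[symmetric])
    then have "h ** g \<in> N"
      using mult h gG by (simp add: N_def)
    then show "(h *v (g *v s)) \<bullet> p \<le> (g *v s) \<bullet> p"
      using g(2) by (simp add: matrix_vector_mul_assoc)
  qed
  then show ?thesis
    using gG by blast
qed

end

section \<open>The digraph of the network and the graph of the group\<close>

context simple_maximal_network begin

text \<open>Any point of the connection determines the plane as its isotropy space, so for
  connections of the network the description is unique.\<close>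

definition plane_of :: "connection \<Rightarrow> R4 set" where
  "plane_of c = (THE P. connection_data (fst c) (fst (snd c)) (snd (snd c)) P)"

lemma connection_plane: "connection_data \<xi> \<kappa> \<eta> P \<Longrightarrow> p \<in> \<kappa> \<Longrightarrow> P = Fix (isotropy G p)"
  by (simp add: connection_data_def)

lemma connection_nonempty: "connection_data \<xi> \<kappa> \<eta> P \<Longrightarrow> \<exists>p. p \<in> \<kappa>"
  by (auto simp: connection_data_def)

lemma plane_of_eq:
  assumes c: "connection_data \<xi> \<kappa> \<eta> P"
  shows "plane_of (\<xi>, \<kappa>, \<eta>) = P"
proof -
  obtain p where p: "p \<in> \<kappa>"
    using connection_nonempty[OF c] by blast
  show ?thesis
    unfolding plane_of_def fst_conv snd_conv
  proof (rule the_equality[where P = "connection_data \<xi> \<kappa> \<eta>", OF c])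
    fix Q assume "connection_data \<xi> \<kappa> \<eta> Q"
    then show "Q = P"
      using connection_plane[OF c p] connection_plane[OF _ p] by metis
  qed
qed

lemma plane_of_data:
  assumes "c \<in> K"
  shows "connection_data (fst c) (fst (snd c)) (snd (snd c)) (plane_of c)"
proof -
  obtain \<xi> \<kappa> \<eta> where c: "c = (\<xi>, \<kappa>, \<eta>)"
    by (cases c)
  obtain P where "connection_data \<xi> \<kappa> \<eta> P"
    using K_data(3) assms unfolding c by blast
  then show ?thesis
    using plane_of_eq by (simp add: c)
qed

lemma plane_of_props:
  assumes "c \<in> K"
  shows "fst c \<in> E" "snd (snd c) \<in> E" "plane_of c \<in> isotropy_planes G" "fst c \<in> plane_of c"
    "snd (snd c) \<in> plane_of c" "unstable_in (fst c) (plane_of c)" "stable_in (snd (snd c)) (plane_of c)"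
proof -
  note d = plane_of_data[OF assms]
  show E: "fst c \<in> E" "snd (snd c) \<in> E"
    using K_data(1,2)[of "fst c" "fst (snd c)" "snd (snd c)"] assms by simp_all
  show "plane_of c \<in> isotropy_planes G" "fst c \<in> plane_of c"
    "snd (snd c) \<in> plane_of c" "stable_in (snd (snd c)) (plane_of c)"
    using d unfolding connection_data_def by blast+
  show "unstable_in (fst c) (plane_of c)"
    by (rule connection_starts_unstable[OF E(1) d])
qed

lemma plane_of_act:
  assumes "c \<in> K" "g \<in> G"
  shows "plane_of (act_connection g c) = act g (plane_of c)"
  unfolding act_connection_def
  by (rule plane_of_eq) (rule connection_data_mult[OF assms(2) plane_of_data[OF assms(1)]])

text \<open>Maximality gives a connection contained in \<open>P\<close>. Its own plane is the
  isotropy space of one of its points, hence contained in \<open>P\<close>, and the dimensions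
  agree.\<close>

lemma connection_in_isotropy_plane:
  assumes P: "P \<in> isotropy_planes G"
  shows "\<exists>c\<in>K. plane_of c = P"
proof -
  have "plane_connections G f P \<noteq> {}" "plane_connections G f P \<subseteq> K"
    using maximal P by (simp_all add: maximal_network_def)
  then obtain \<xi> \<kappa> \<eta> where k: "(\<xi>, \<kappa>, \<eta>) \<in> K" "\<kappa> \<subseteq> P"
    unfolding plane_connections_def by blast
  define Q where "Q = plane_of (\<xi>, \<kappa>, \<eta>)"
  have d: "connection_data \<xi> \<kappa> \<eta> Q"
    using plane_of_data[OF k(1)] by (simp add: Q_def)
  then obtain p where "p \<in> \<kappa>"
    using connection_nonempty by blast
  then have Q: "Q = Fix (isotropy G p)" "p \<in> P"
    using connection_plane[OF d] k(2) by auto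
  have "Q \<subseteq> P"
    using isotropy_space_minimal[of P 2 p] P Q unfolding isotropy_planes_def by blast
  moreover have "Q \<in> isotropy_planes G"
    using d unfolding connection_data_def by blast
  then have "dim P \<le> dim Q"
    using P by (simp add: isotropy_planes_def isotropy_spaces_def)
  moreover have "subspace P"
    using P subspace_Fix by (auto simp: isotropy_planes_def isotropy_spaces_def)
  ultimately have "Q = P"
    by (intro subspace_dim_equal) (simp_all add: Q(1) subspace_Fix)
  then show ?thesis
    using k(1) by (auto simp: Q_def)
qed

text \<open>After applying a group element both connections lie in one plane \<open>P\<close>. The
  stabiliser of \<open>P\<close> takes the start of \<open>d\<close> to the start or to the end of
  the other; the end is excluded, being stable in \<open>P\<close>. With a common start, uniqueness
  in the plane applies.\<close>

lemma connection_orb_eqI: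
  assumes c: "c \<in> K" and d: "d \<in> K" and eq: "set_orbit G (plane_of c) = set_orbit G (plane_of d)"
  shows "connection_orb c = connection_orb d"
proof -
  obtain h where h: "h \<in> G" "plane_of d = act h (plane_of c)"
    using eq unfolding set_orbit_eq_iff by blast
  define c' where "c' = act_connection h c"
  define P where "P = plane_of d"
  have c': "c' \<in> K" "plane_of c' = P"
    using K_mult[OF c h(1)] plane_of_act[OF c h(1)] h(2) by (simp_all add: c'_def P_def)
  note C = plane_of_props[OF c'(1)] plane_of_data[OF c'(1)] and Dd = plane_of_props[OF d] plane_of_data[OF d]
  obtain g where g: "g \<in> G" "act g P = P" "g *v fst d = fst c' \<or> g *v fst d = snd (snd c')"
    using equilibrium_in_connection_plane[OF C(1,2,8) Dd(1)] Dd(4) c'(2) P_def by auto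
  have "unstable_in (g *v fst d) P"
    using unstable_in_mult[OF g(1) Dd(6)] g(2) by (simp add: P_def)
  moreover have "\<not> unstable_in (snd (snd c')) P"
    using C(7) c'(2) not_stable_and_unstable by simp
  ultimately have gd: "g *v fst d = fst c'"
    using g(3) by auto
  have "connection_data (fst c') (act g (fst (snd d))) (g *v snd (snd d)) P"
    using connection_data_mult[OF g(1) Dd(8)] g(2) by (simp add: gd P_def)
  then obtain k where k: "k \<in> G" "act_connection k (fst c', act g (fst (snd d)), g *v snd (snd d)) = c'"
    using connection_unique_in_plane[OF C(1)] C(8) c'(2) by fastforce
  have "(fst c', act g (fst (snd d)), g *v snd (snd d)) = act_connection g d"
    by (simp add: act_connection_def gd)
  then have "c' = act_connection (k ** g) d"
    using k(2) by (simp add: act_connection_mult)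
  then have "connection_orb d = connection_orb c'"
    using connection_orb_eq_iff mult[OF k(1) g(1)] by blast
  moreover have "connection_orb c = connection_orb c'"
    using connection_orb_eq_iff h(1) c'_def by blast
  ultimately show ?thesis
    by simp
qed

abbreviation D where
  "D \<equiv> network_digraph G E K"

lemma verts_D: "verts D = orb ` E"
  by (simp add: network_digraph_def orb_def)

lemma arcs_D: "arcs D = connection_orb ` K"
  by (simp add: network_digraph_def connection_orb_def)

lemma tail_D: "tail D a = fst ` a"
  by (simp add: network_digraph_def)

lemma head_D: "head D a = (\<lambda>c. snd (snd c)) ` a"
  by (simp add: network_digraph_def)

lemma image_connection_orb:
  assumes "\<And>g. g \<in> G \<Longrightarrow> en (act_connection g c) = g *v en c"
  shows "en ` connection_orb c = orb (en c)"
  using assms by (simp add: connection_orb_def orb_def image_image)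

lemma tail_connection_orb: "tail D (connection_orb c) = orb (fst c)"
  unfolding tail_D by (rule image_connection_orb) (simp add: act_connection_def)

lemma head_connection_orb: "head D (connection_orb c) = orb (snd (snd c))"
  unfolding head_D by (rule image_connection_orb[where en = "\<lambda>c. snd (snd c)"]) (simp add: act_connection_def)

lemma wf_D: "wf_digraph D"
proof
  fix a assume "a \<in> arcs D"
  then obtain c where "c \<in> K" "a = connection_orb c"
    by (auto simp: arcs_D)
  then show "tail D a \<in> verts D" "head D a \<in> verts D"
    using plane_of_props(1,2) by (simp_all add: verts_D tail_connection_orb head_connection_orb)
qed

lemma image_ray_orb: "ray ` orb x = set_orbit G (ray x)"
  by (simp add: orb_def set_orbit_def image_image act_ray)

lemma image_plane_of_connection_orb:
  "c \<in> K \<Longrightarrow> plane_of ` connection_orb c = set_orbit G (plane_of c)"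
  by (simp add: connection_orb_def set_orbit_def image_image plane_of_act)

text \<open>Injective because a semiaxis carries only one equilibrium, surjective because by
  maximality it carries at least one.\<close>

lemma verts_bij: "bij_betw ((`) ray) (verts D) (graph_vertices G)"
  unfolding bij_betw_def
proof
  show "inj_on ((`) ray) (verts D)"
  proof (rule inj_onI)
    fix u v assume "u \<in> verts D" "v \<in> verts D" and eq: "ray ` u = ray ` v"
    then obtain x y where xy: "u = orb x" "v = orb y" "x \<in> E" "y \<in> E"
      by (auto simp: verts_D)
    then have "set_orbit G (ray x) = set_orbit G (ray y)"
      using eq by (simp add: image_ray_orb)
    then have "\<exists>g\<in>G. ray y = ray (g *v x)"
      by (simp only: set_orbit_eq_iff act_ray)
    then obtain g where g: "g \<in> G" "ray y = ray (g *v x)"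
      by blast
    have "y \<in> ray (g *v x)"
      unfolding g(2)[symmetric] by (rule self_in_ray)
    then have "g *v x = y"
      by (rule ray_inj_on_E[OF E_mult[OF xy(3) g(1)] xy(4)])
    then show "u = v"
      using xy orb_mult[OF g(1), of x] by simp
  qed
  show "(`) ray ` verts D = graph_vertices G"
  proof (intro equalityI subsetI)
    fix w assume "w \<in> (`) ray ` verts D"
    then obtain x where x: "x \<in> E" "w = set_orbit G (ray x)"
      by (auto simp: verts_D image_ray_orb)
    then have "ray x \<in> isotropy_semiaxes G"
      using E_D(1,3)[OF x(1)] by (auto simp: isotropy_semiaxes_eq)
    then show "w \<in> graph_vertices G"
      using x by (simp add: graph_vertices_def)
  next
    fix w assume "w \<in> graph_vertices G"
    then obtain x where x: "x \<noteq> 0" "span {x} \<in> isotropy_axes G" "w = set_orbit G (ray x)"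
      by (auto simp: graph_vertices_def isotropy_semiaxes_eq)
    then obtain y where "y \<in> E" "ray y = ray x"
      using equilibrium_on_semiaxis by blast
    then have "w = ray ` orb y" "orb y \<in> verts D"
      using x by (simp_all add: image_ray_orb verts_D)
    then show "w \<in> (`) ray ` verts D"
      by blast
  qed
qed

text \<open>Injective because connections in equivalent planes are equivalent, surjective because by
  maximality every isotropy plane contains a connection of the network.\<close>

lemma arcs_bij: "bij_betw ((`) plane_of) (arcs D) (graph_lines G)"
  unfolding bij_betw_def
proof
  show "inj_on ((`) plane_of) (arcs D)"
  proof (rule inj_onI)
    fix a b assume "a \<in> arcs D" "b \<in> arcs D" and eq: "plane_of ` a = plane_of ` b"
    then obtain c d where cd: "c \<in> K" "d \<in> K" "a = connection_orb c" "b = connection_orb d"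
      unfolding arcs_D by blast
    then show "a = b"
      using connection_orb_eqI[OF cd(1,2)] eq by (simp add: image_plane_of_connection_orb)
  qed
  show "(`) plane_of ` arcs D = graph_lines G"
  proof (intro equalityI subsetI)
    fix w assume "w \<in> (`) plane_of ` arcs D"
    then obtain c where "c \<in> K" "w = set_orbit G (plane_of c)"
      by (auto simp: arcs_D image_plane_of_connection_orb)
    then show "w \<in> graph_lines G"
      using plane_of_props(3) by (simp add: graph_lines_def)
  next
    fix w assume "w \<in> graph_lines G"
    then obtain P where P: "P \<in> isotropy_planes G" "w = set_orbit G P"
      by (auto simp: graph_lines_def)
    then obtain c where "c \<in> K" "plane_of c = P"
      using connection_in_isotropy_plane by blast
    then have "w = plane_of ` connection_orb c" "connection_orb c \<in> arcs D"
      using P by (simp_all add: image_plane_of_connection_orb arcs_D)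
    then show "w \<in> (`) plane_of ` arcs D"
      by blast
  qed
qed

text \<open>A translate of \<open>x\<close> in the plane of the connection is moved to one of its
  two ends by the stabiliser of the plane, so a line of the graph has no vertices besides the ends
  of the arrow.\<close>

lemma lies_on_iff:
  assumes "v \<in> verts D" "a \<in> arcs D"
  shows "lies_on (ray ` v) (plane_of ` a) \<longleftrightarrow> v = tail D a \<or> v = head D a"
proof -
  obtain x c where x: "x \<in> E" "v = orb x" and c: "c \<in> K" "a = connection_orb c"
    using assms by (auto simp: verts_D arcs_D)
  note C = plane_of_props[OF c(1)]
  have sub: "subspace (plane_of c)"
    using C(3) subspace_Fix by (auto simp: isotropy_planes_def isotropy_spaces_def)
  have "lies_on (ray ` v) (plane_of ` a) \<longleftrightarrow> (\<exists>g\<in>G. \<exists>h\<in>G. ray (g *v x) \<subseteq> act h (plane_of c))"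
    unfolding lies_on_def x(2) c(2) image_ray_orb image_plane_of_connection_orb[OF c(1)]
    by (simp add: set_orbit_def act_ray)
  also have "\<dots> \<longleftrightarrow> (\<exists>g\<in>G. \<exists>h\<in>G. g *v x \<in> act h (plane_of c))"
    using ray_subset_subspace[OF subspace_act[OF sub]] by simp
  also have "\<dots> \<longleftrightarrow> orb x = orb (fst c) \<or> orb x = orb (snd (snd c))"
  proof
    assume "\<exists>g\<in>G. \<exists>h\<in>G. g *v x \<in> act h (plane_of c)"
    then obtain g h where gh: "g \<in> G" "h \<in> G" "g *v x \<in> act h (plane_of c)"
      by blast
    define y where "y = transpose h *v (g *v x)"
    have y: "y \<in> E" "y \<in> plane_of c" "orb y = orb x"
      using gh x E_mult transpose_closed by (simp_all add: y_def mem_act_iff)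
    obtain k where "k \<in> G" "k *v y = fst c \<or> k *v y = snd (snd c)"
      using equilibrium_in_connection_plane[OF C(1,2) plane_of_data[OF c(1)] y(1,2)] by blast
    then show "orb x = orb (fst c) \<or> orb x = orb (snd (snd c))"
      using y(3) by (metis orb_mult)
  next
    assume "orb x = orb (fst c) \<or> orb x = orb (snd (snd c))"
    then obtain g where "g \<in> G" "fst c = g *v x \<or> snd (snd c) = g *v x"
      unfolding orb_eq_iff by blast
    then have "g \<in> G" "g *v x \<in> act (mat 1) (plane_of c)"
      using C(4,5) by auto
    then show "\<exists>g\<in>G. \<exists>h\<in>G. g *v x \<in> act h (plane_of c)"
      using one by blast
  qed
  finally show ?thesis
    by (simp add: x(2) c(2) tail_connection_orb head_connection_orb)
qed

text \<open>Written for an arbitrary end \<open>en\<close> and stability type \<open>T\<close>, to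
  count outgoing and incoming arrows alike. Each plane through \<open>x\<close> of type
  \<open>T\<close> is matched with the orbit of a connection in it; by \<open>key\<close>,
  equilibria of type \<open>T\<close> in that plane can be moved to the chosen end.\<close>

lemma card_arcs_at_vertex:
  fixes en :: "connection \<Rightarrow> R4"
  assumes en: "\<And>c g. g \<in> G \<Longrightarrow> en (act_connection g c) = g *v en c"
    and enK: "\<And>c. c \<in> K \<Longrightarrow> en c \<in> E \<and> en c \<in> plane_of c \<and> T (en c) (plane_of c)"
    and T: "\<And>g x P. g \<in> G \<Longrightarrow> T x P \<Longrightarrow> T (g *v x) (act g P)"
    and key: "\<And>c x. c \<in> K \<Longrightarrow> x \<in> E \<Longrightarrow> x \<in> plane_of c \<Longrightarrow> T x (plane_of c) \<Longrightarrow>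
      \<exists>g\<in>G. act g (plane_of c) = plane_of c \<and> g *v x = en c"
    and x: "x \<in> E"
  shows "card {a \<in> arcs D. en ` a = orb x} = card {P \<in> planes_through x. T x P}"
proof -
  have "\<exists>c. \<forall>P\<in>isotropy_planes G. c P \<in> K \<and> plane_of (c P) = P"
    using connection_in_isotropy_plane by (metis (no_types))
  then obtain c where c: "\<And>P. P \<in> isotropy_planes G \<Longrightarrow> c P \<in> K" "\<And>P. P \<in> isotropy_planes G \<Longrightarrow> plane_of (c P) = P"
    by blast
  have en_orb: "en ` connection_orb d = orb (en d)" for d
    by (rule image_connection_orb[OF en])
  let ?S = "{P \<in> planes_through x. T x P}"
  have S: "P \<in> isotropy_planes G" "x \<in> P" "T x P" if "P \<in> ?S" for P
    using that by (auto simp: planes_through_def)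
  have "bij_betw (\<lambda>P. connection_orb (c P)) ?S {a \<in> arcs D. en ` a = orb x}"
    unfolding bij_betw_def
  proof
    show "inj_on (\<lambda>P. connection_orb (c P)) ?S"
    proof (rule inj_onI)
      fix P Q assume P: "P \<in> ?S" and Q: "Q \<in> ?S" and eq: "connection_orb (c P) = connection_orb (c Q)"
      then obtain g where g: "g \<in> G" "c Q = act_connection g (c P)"
        using connection_orb_eq_iff by blast
      then have gP: "act g P = Q"
        using plane_of_act[of "c P" g] c S(1)[OF P] S(1)[OF Q] by metis
      have gx: "g *v x \<in> E" "g *v x \<in> Q" "T (g *v x) Q"
        using E_mult[OF x g(1)] S(2,3)[OF P] mult_mem_act[OF g(1), of x P] T[OF g(1), of x P] gP by simp_all
      obtain n where n: "n \<in> G" "act n Q = Q" "n *v (g *v x) = en (c Q)"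
        using key[of "c Q" "g *v x"] gx c S(1)[OF Q] by auto
      obtain m where m: "m \<in> G" "act m Q = Q" "m *v x = en (c Q)"
        using key[of "c Q" x] x c S[OF Q] by auto
      \<comment> \<open>When \<open>g\<close> carries the connection in \<open>P\<close> to that in
        \<open>Q\<close>, the points \<open>g *v x\<close> and \<open>x\<close> of \<open>Q\<close>
        may still differ; correcting by the stabiliser of \<open>Q\<close> gives an element that
        fixes \<open>x\<close> and takes \<open>P\<close> to \<open>Q\<close>. Fixing
        \<open>x\<close>, it preserves \<open>P\<close>.\<close>
      define k where "k = transpose m ** (n ** g)"
      have k: "k \<in> G"
        using m n g mult transpose_closed by (simp add: k_def)
      have "k *v x = transpose m *v (m *v x)"
        by (simp add: k_def m(3) n(3) matrix_vector_mul_assoc[symmetric])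
      then have kx: "k *v x = x"
        using m(1) by simp
      have "act k P = act (transpose m) (act n (act g P))"
        by (simp add: k_def act_mult)
      also have "\<dots> = act (transpose m) (act m Q)"
        by (simp add: gP n(2) m(2))
      finally have "act k P = Q"
        using m(1) by simp
      moreover have "act k P = P"
        using E_D(4)[OF x] isotropy_preserves_planes_through[OF _ _ k kx] P by blast
      ultimately show "P = Q"
        by simp
    qed
    show "(\<lambda>P. connection_orb (c P)) ` ?S = {a \<in> arcs D. en ` a = orb x}"
    proof (intro equalityI subsetI)
      fix a assume "a \<in> (\<lambda>P. connection_orb (c P)) ` ?S"
      then obtain P where P: "P \<in> ?S" "a = connection_orb (c P)"
        by blast
      have cP: "c P \<in> K" "plane_of (c P) = P"
        using c S(1)[OF P(1)] by auto
      obtain m where "m \<in> G" "m *v x = en (c P)"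
        using key[OF cP(1) x] S[OF P(1)] cP(2) by auto
      then have "orb (en (c P)) = orb x"
        by (metis orb_mult)
      then show "a \<in> {a \<in> arcs D. en ` a = orb x}"
        using P cP(1) by (simp add: arcs_D en_orb)
    next
      fix a assume "a \<in> {a \<in> arcs D. en ` a = orb x}"
      then obtain d where d: "d \<in> K" "a = connection_orb d" "orb (en d) = orb x"
        by (auto simp: arcs_D en_orb)
      then obtain h where h: "h \<in> G" "x = h *v en d"
        unfolding orb_eq_iff by blast
      define d' where "d' = act_connection h d"
      have d': "d' \<in> K" "en d' = x" "connection_orb d' = a"
        using K_mult[OF d(1) h(1)] en[OF h(1)] h connection_orb_eq_iff[of d d'] d(2) by (auto simp: d'_def)
      define P where "P = plane_of d'"
      have P: "P \<in> ?S"
        using plane_of_props(3)[OF d'(1)] enK[OF d'(1)] d'(2) by (simp add: P_def planes_through_def)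
      have "connection_orb (c P) = connection_orb d'"
        using c S(1)[OF P] d'(1) by (intro connection_orb_eqI) (simp_all add: P_def)
      then show "a \<in> (\<lambda>P. connection_orb (c P)) ` ?S"
        using P d'(3) by blast
    qed
  qed
  then show ?thesis
    using bij_betw_same_card by fastforce
qed

text \<open>Arrows leaving \<open>v\<close> correspond to the planes through \<open>x\<close> in
  which \<open>x\<close> is unstable, arrows entering it to those in which it is stable, and there
  are three planes in all. A loop would count in both summands.\<close>

lemma degree_D:
  assumes "v \<in> verts D"
  shows "card {a \<in> arcs D. tail D a = v} + card {a \<in> arcs D. head D a = v} = 3"
proof -
  obtain x where x: "x \<in> E" "v = orb x"
    using assms by (auto simp: verts_D)
  have key: "\<exists>g\<in>G. act g (plane_of c) = plane_of c \<and> (g *v y = fst c \<or> g *v y = snd (snd c)) \<and>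
      (unstable_in y (plane_of c) \<longrightarrow> unstable_in (g *v y) (plane_of c)) \<and>
      (stable_in y (plane_of c) \<longrightarrow> stable_in (g *v y) (plane_of c))"
    if c: "c \<in> K" and y: "y \<in> E" "y \<in> plane_of c" for c y
  proof -
    obtain g where g: "g \<in> G" "act g (plane_of c) = plane_of c" "g *v y = fst c \<or> g *v y = snd (snd c)"
      using equilibrium_in_connection_plane[OF plane_of_props(1,2)[OF c] plane_of_data[OF c] y] by blast
    then show ?thesis
      using unstable_in_mult[OF g(1), of y "plane_of c"] stable_in_mult[OF g(1), of y "plane_of c"] by auto
  qed
  have "card {a \<in> arcs D. fst ` a = orb x} = card {P \<in> planes_through x. unstable_in x P}"
  proof (rule card_arcs_at_vertex)
    show "\<exists>g\<in>G. act g (plane_of c) = plane_of c \<and> g *v y = fst c"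
      if "c \<in> K" "y \<in> E" "y \<in> plane_of c" "unstable_in y (plane_of c)" for c y
      using key[OF that(1-3)] that(4) plane_of_props(7)[OF that(1)] not_stable_and_unstable by metis
  qed (use x in \<open>simp_all add: act_connection_def plane_of_props unstable_in_mult\<close>)
  moreover have "card {a \<in> arcs D. (\<lambda>c. snd (snd c)) ` a = orb x} = card {P \<in> planes_through x. stable_in x P}"
  proof (rule card_arcs_at_vertex)
    show "\<exists>g\<in>G. act g (plane_of c) = plane_of c \<and> g *v y = snd (snd c)"
      if "c \<in> K" "y \<in> E" "y \<in> plane_of c" "stable_in y (plane_of c)" for c y
      using key[OF that(1-3)] that(4) plane_of_props(6)[OF that(1)] not_stable_and_unstable by metis
  qed (use x in \<open>simp_all add: act_connection_def plane_of_props stable_in_mult\<close>)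
  moreover have "card {P \<in> planes_through x. unstable_in x P} + card {P \<in> planes_through x. stable_in x P} = 3"
  proof -
    obtain a b c where F: "half_turn_frame G x a b c"
      using E_D(4)[OF x(1)] by blast
    have "finite (planes_through x)"
      by (simp add: planes_through_frame[OF F])
    then have "card {P \<in> planes_through x. unstable_in x P} + card {P \<in> planes_through x. stable_in x P} =
        card ({P \<in> planes_through x. unstable_in x P} \<union> {P \<in> planes_through x. stable_in x P})"
      using not_stable_and_unstable by (intro card_Un_disjoint[symmetric]) auto
    also have "{P \<in> planes_through x. unstable_in x P} \<union> {P \<in> planes_through x. stable_in x P} = planes_through x"
      using stable_or_unstable[OF x(1)] by (auto simp: planes_through_def)
    finally show ?thesis
      by (simp add: card_planes_through[OF F])
  qed
  ultimately show ?thesis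
    by (simp add: x(2) tail_D head_D)
qed

section \<open>Closed walks in the network\<close>

lemma arc_of_connection:
  assumes "c \<in> K"
  shows "(orb (fst c), orb (snd (snd c))) \<in> arcs_ends D"
  using assms unfolding arcs_ends_def arc_to_ends_def
  by (intro image_eqI[of _ _ "connection_orb c"]) (simp_all add: tail_connection_orb head_connection_orb arcs_D)

text \<open>A cycle closes up to a group element, so the orbits along its lift repeat after
  \<open>M\<close> steps, and following the lift leads from the head of an arrow back to its
  tail.\<close>

lemma arcs_on_closed_walks:
  assumes "a \<in> arcs D"
  shows "(head D a, tail D a) \<in> (arcs_ends D)\<^sup>*"
proof -
  obtain d where d: "d \<in> K" "a = connection_orb d"
    using assms by (auto simp: arcs_D)
  from d(1) obtain M g \<xi> \<kappa> h j where c: "simple_cycle G f M g \<xi> \<kappa>" "cycle_equilibria G \<xi> \<subseteq> E"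
    "cycle_connections G \<xi> \<kappa> \<subseteq> K" "h \<in> G" "d = act_connection h (\<xi> j, \<kappa> j, \<xi> (j + 1))"
    by (rule connection_in_cycle)
  have step: "(orb (\<xi> i), orb (\<xi> (i + 1))) \<in> arcs_ends D" for i
  proof -
    have "(\<xi> i, \<kappa> i, \<xi> (i + 1)) = act_connection (mat 1) (\<xi> i, \<kappa> i, \<xi> (i + 1))"
      by simp
    then have "(\<xi> i, \<kappa> i, \<xi> (i + 1)) \<in> cycle_connections G \<xi> \<kappa>"
      unfolding cycle_connections_def using one by blast
    then show ?thesis
      using arc_of_connection c(3) by fastforce
  qed
  have walk: "(orb (\<xi> (j + 1)), orb (\<xi> (j + 1 + int n))) \<in> (arcs_ends D)\<^sup>*" for n
  proof (induction n)
    case (Suc n)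
    have "(orb (\<xi> (j + 1 + int n)), orb (\<xi> (j + 1 + int (Suc n)))) \<in> arcs_ends D"
      using step[of "j + 1 + int n"] by (simp add: add.assoc add.commute)
    with Suc show ?case
      by (rule rtrancl_into_rtrancl)
  qed simp
  have M: "M > 0" "g \<in> G" "\<xi> (j + int M) = g *v \<xi> j"
    using c(1) unfolding simple_cycle_def heteroclinic_cycle_def by blast+
  \<comment> \<open>The walk starts at \<open>\<xi> (j + 1)\<close>, so \<open>M - 1\<close> steps
    lead to \<open>\<xi> (j + int M)\<close>, which is in the orbit of
    \<open>\<xi> j\<close>.\<close>
  have "j + 1 + int (M - 1) = j + int M"
    using M(1) by simp
  then have "(orb (\<xi> (j + 1)), orb (\<xi> j)) \<in> (arcs_ends D)\<^sup>*"
    using walk[of "M - 1"] M(2,3) by simp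
  then show ?thesis
    using c(4) by (simp add: d(2) c(5) tail_connection_orb head_connection_orb act_connection_def)
qed

lemma vertex_is_tail:
  assumes "v \<in> verts D"
  shows "\<exists>a\<in>arcs D. tail D a = v"
proof -
  obtain x where x: "x \<in> E" "v = orb x"
    using assms by (auto simp: verts_D)
  from x(1) obtain M g \<xi> \<kappa> h j where c: "simple_cycle G f M g \<xi> \<kappa>" "cycle_equilibria G \<xi> \<subseteq> E"
    "cycle_connections G \<xi> \<kappa> \<subseteq> K" "h \<in> G" "x = h *v \<xi> j"
    by (rule equilibrium_in_cycle)
  define d where "d = act_connection h (\<xi> j, \<kappa> j, \<xi> (j + 1))"
  have "d \<in> K"
    using c(3,4) unfolding d_def cycle_connections_def by blast
  moreover have "tail D (connection_orb d) = v"
    by (simp add: tail_connection_orb d_def act_connection_def x(2) c(5))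
  ultimately show ?thesis
    by (auto simp: arcs_D)
qed

end

section \<open>Orientations of a multigraph\<close>

lemma arcs_ends_digraph_of: "arcs_ends (digraph_of n arrs) = set arrs"
proof -
  have "arcs_ends (digraph_of n arrs) = (!) arrs ` {..<length arrs}"
    by (simp add: arcs_ends_def arc_to_ends_def digraph_of_def)
  then show ?thesis
    by (auto simp: set_conv_nth)
qed

lemma wf_digraph_of:
  assumes "\<And>x. x \<in> set arrs \<Longrightarrow> fst x \<in> {1..n} \<and> snd x \<in> {1..n}"
  shows "wf_digraph (digraph_of n arrs)"
proof
  fix i assume "i \<in> arcs (digraph_of n arrs)"
  then have "arrs ! i \<in> set arrs"
    by (simp add: digraph_of_def)
  then show "tail (digraph_of n arrs) i \<in> verts (digraph_of n arrs)"
    "head (digraph_of n arrs) i \<in> verts (digraph_of n arrs)"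
    using assms by (simp_all add: digraph_of_def)
qed

text \<open>The bijections go from \<open>H\<close> to \<open>D\<close>, since \<open>H\<close> will
  be a digraph on numbered vertices and arcs; the isomorphism consists of their inverses.\<close>

lemma digraph_isoI:
  assumes wf: "wf_digraph D" and \<alpha>: "bij_betw \<alpha> (verts H) (verts D)" and \<beta>: "bij_betw \<beta> (arcs H) (arcs D)"
    and ends: "\<And>i. i \<in> arcs H \<Longrightarrow> tail D (\<beta> i) = \<alpha> (tail H i) \<and> head D (\<beta> i) = \<alpha> (head H i)"
    and H: "\<And>i. i \<in> arcs H \<Longrightarrow> tail H i \<in> verts H \<and> head H i \<in> verts H"
  shows "digraph_iso D H"
proof -
  let ?v = "the_inv_into (verts H) \<alpha>" and ?a = "the_inv_into (arcs H) \<beta>"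
  define hom where "hom = \<lparr>iso_verts = ?v, iso_arcs = ?a, iso_head = head H, iso_tail = tail H\<rparr>"
  have v: "bij_betw ?v (verts D) (verts H)" and a: "bij_betw ?a (arcs D) (arcs H)"
    using \<alpha> \<beta> by (simp_all add: bij_betw_the_inv_into)
  have "?v (tail D e) = tail H (?a e) \<and> ?v (head D e) = head H (?a e)" if e: "e \<in> arcs D" for e
  proof -
    obtain i where i: "i \<in> arcs H" "e = \<beta> i"
      using \<beta> e by (auto simp: bij_betw_def)
    have "?a e = i"
      using \<beta> i by (simp add: bij_betw_def the_inv_into_f_f)
    moreover have "?v (\<alpha> u) = u" if "u \<in> verts H" for u
      using \<alpha> that by (simp add: bij_betw_def the_inv_into_f_f)
    ultimately show ?thesis
      using ends[OF i(1)] H[OF i(1)] i(2) by simp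
  qed
  then have "pre_digraph.digraph_isomorphism D hom"
    using wf v a by (simp add: pre_digraph.digraph_isomorphism_def hom_def bij_betw_def)
  moreover have "H = app_iso hom D"
    using v a by (simp add: app_iso_def hom_def bij_betw_def)
  ultimately show ?thesis
    unfolding digraph_iso_def by blast
qed

text \<open>Arcs of a list digraph are positions, and equal multisets of arrows provide a
  permutation of positions, which is the map on arcs. Multisets instead of sets keep track of
  parallel arrows.\<close>

lemma digraph_of_iso_relabelling:
  assumes t: "\<And>x. x \<in> set t \<Longrightarrow> fst x \<in> {1..n} \<and> snd x \<in> {1..n}"
    and p: "bij_betw p {1..n} {1..n}"
    and ms: "mset (map (map_prod p p) t) = mset arrs"
  shows "digraph_iso (digraph_of n arrs) (digraph_of n t)"
proof -
  from ms obtain \<sigma> where \<sigma>: "\<sigma> permutes {..<length arrs}" "permute_list \<sigma> arrs = map (map_prod p p) t"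
    by (rule mset_eq_permutation)
  have len: "length t = length arrs"
    using mset_eq_length[OF ms] by simp
  have arrs: "fst x \<in> {1..n} \<and> snd x \<in> {1..n}" if x: "x \<in> set arrs" for x
  proof -
    have "x \<in> map_prod p p ` set t"
      using x mset_eq_setD[OF ms] by simp
    then show ?thesis
      using t bij_betwE[OF p] by force
  qed
  have nth: "arrs ! \<sigma> i = map_prod p p (t ! i)" if i: "i < length t" for i
  proof -
    have "permute_list \<sigma> arrs ! i = arrs ! \<sigma> i"
      using permute_list_nth[OF \<sigma>(1)] i len by simp
    then show ?thesis
      using \<sigma>(2) i by simp
  qed
  show ?thesis
  proof (rule digraph_isoI[where \<alpha> = p and \<beta> = \<sigma>])
    show "wf_digraph (digraph_of n arrs)"
      by (rule wf_digraph_of) (rule arrs)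
    show "bij_betw p (verts (digraph_of n t)) (verts (digraph_of n arrs))"
      using p by (simp add: digraph_of_def)
    show "bij_betw \<sigma> (arcs (digraph_of n t)) (arcs (digraph_of n arrs))"
      using permutes_imp_bij[OF \<sigma>(1)] len by (simp add: digraph_of_def)
  next
    fix i assume "i \<in> arcs (digraph_of n t)"
    then have i: "i < length t"
      by (simp add: digraph_of_def)
    show "tail (digraph_of n arrs) (\<sigma> i) = p (tail (digraph_of n t) i) \<and>
        head (digraph_of n arrs) (\<sigma> i) = p (head (digraph_of n t) i)"
      using nth[OF i] by (simp add: digraph_of_def)
    show "tail (digraph_of n t) i \<in> verts (digraph_of n t) \<and> head (digraph_of n t) i \<in> verts (digraph_of n t)"
      using t[OF nth_mem[OF i]] by (simp add: digraph_of_def)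
  qed
qed

fun orientations :: "('a \<times> 'a) list \<Rightarrow> ('a \<times> 'a) list list" where
  "orientations [] = [[]]"
| "orientations (e # es) = map ((#) e) (orientations es) @ map ((#) (prod.swap e)) (orientations es)"

lemma mem_orientations_iff:
  "os \<in> set (orientations es) \<longleftrightarrow> list_all2 (\<lambda>x e. x = e \<or> x = prod.swap e) os es"
  by (induction es arbitrary: os) (auto simp: list_all2_Cons2)

text \<open>The digraph and the prescribed graph describe the same incidences through
  \<open>V\<close> and \<open>M\<close>. As the two vertices of an edge differ, they are exactly the
  tail and the head of the arc, in one order or the other; this order is the orientation.\<close>

lemma orientation_of_multigraph:
  fixes D :: "('a, 'b) pre_digraph"
  assumes wf: "wf_digraph D"
    and \<Phi>: "bij_betw \<Phi> (verts D) V" and \<Psi>: "bij_betw \<Psi> (arcs D) M"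
    and inc: "\<And>v a. v \<in> verts D \<Longrightarrow> a \<in> arcs D \<Longrightarrow> inc (\<Phi> v) (\<Psi> a) \<longleftrightarrow> v = tail D a \<or> v = head D a"
    and \<phi>: "bij_betw \<phi> {1..n} V" and \<psi>: "bij_betw \<psi> {..<length es} M"
    and inc': "\<And>v i. v \<in> {1..n} \<Longrightarrow> i < length es \<Longrightarrow> inc (\<phi> v) (\<psi> i) \<longleftrightarrow> v = fst (es ! i) \<or> v = snd (es ! i)"
    and es: "\<And>x. x \<in> set es \<Longrightarrow> fst x \<in> {1..n} \<and> snd x \<in> {1..n} \<and> fst x \<noteq> snd x"
  shows "\<exists>os\<in>set (orientations es). digraph_iso D (digraph_of n os)"
proof -
  define \<alpha> where "\<alpha> = the_inv_into (verts D) \<Phi> \<circ> \<phi>"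
  define \<beta> where "\<beta> = the_inv_into (arcs D) \<Psi> \<circ> \<psi>"
  have \<alpha>: "bij_betw \<alpha> {1..n} (verts D)" and \<beta>: "bij_betw \<beta> {..<length es} (arcs D)"
    unfolding \<alpha>_def \<beta>_def using bij_betw_trans \<phi> \<psi> bij_betw_the_inv_into \<Phi> \<Psi> by blast+
  have \<Phi>\<alpha>: "\<Phi> (\<alpha> v) = \<phi> v" if "v \<in> {1..n}" for v
    unfolding \<alpha>_def o_def using \<Phi> bij_betwE[OF \<phi>] that by (intro f_the_inv_into_f) (auto simp: bij_betw_def)
  have \<Psi>\<beta>: "\<Psi> (\<beta> i) = \<psi> i" if "i < length es" for i
    unfolding \<beta>_def o_def using \<Psi> bij_betwE[OF \<psi>] that by (intro f_the_inv_into_f) (auto simp: bij_betw_def)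
  have iff: "\<alpha> v = tail D (\<beta> i) \<or> \<alpha> v = head D (\<beta> i) \<longleftrightarrow> v = fst (es ! i) \<or> v = snd (es ! i)"
    if "v \<in> {1..n}" "i < length es" for v i
    using inc[of "\<alpha> v" "\<beta> i"] inc'[OF that] \<Phi>\<alpha>[OF that(1)] \<Psi>\<beta>[OF that(2)] bij_betwE[OF \<alpha>] bij_betwE[OF \<beta>] that
    by simp
  define orient where "orient i = (if tail D (\<beta> i) = \<alpha> (fst (es ! i)) then es ! i else prod.swap (es ! i))" for i
  have ends: "tail D (\<beta> i) = \<alpha> (fst (orient i)) \<and> head D (\<beta> i) = \<alpha> (snd (orient i))" if i: "i < length es" for i
  proof -
    obtain u w where uw: "es ! i = (u, w)"
      by (cases "es ! i")
    have uw': "u \<in> {1..n}" "w \<in> {1..n}" "u \<noteq> w"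
      using es[OF nth_mem[OF i]] uw by auto
    have "\<beta> i \<in> arcs D"
      using bij_betwE[OF \<beta>] i by simp
    then obtain t h where th: "t \<in> {1..n}" "h \<in> {1..n}" "tail D (\<beta> i) = \<alpha> t" "head D (\<beta> i) = \<alpha> h"
      using wf_digraph.tail_in_verts[OF wf] wf_digraph.head_in_verts[OF wf] \<alpha>
      unfolding bij_betw_def by (metis imageE)
    have inj: "\<alpha> v = \<alpha> v' \<longleftrightarrow> v = v'" if "v \<in> {1..n}" "v' \<in> {1..n}" for v v'
      using \<alpha> that by (auto simp: bij_betw_def dest: inj_onD)
    have "(v = t \<or> v = h) = (v = u \<or> v = w)" if "v \<in> {1..n}" for v
      using iff[OF that i] inj[OF that th(1)] inj[OF that th(2)] by (simp add: th(3,4) uw)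
    then have "t = u \<and> h = w \<or> t = w \<and> h = u"
      using th(1,2) uw' by metis
    then show ?thesis
      using uw'(3) inj[OF uw'(1,2)] inj[OF uw'(2,1)] by (auto simp: orient_def uw th(3,4))
  qed
  define os where "os = map orient [0..<length es]"
  have "os \<in> set (orientations es)"
    unfolding mem_orientations_iff list_all2_conv_all_nth by (auto simp: os_def orient_def)
  moreover have "digraph_iso D (digraph_of n os)"
  proof (rule digraph_isoI[OF wf, where \<alpha> = \<alpha> and \<beta> = \<beta>])
    show "bij_betw \<alpha> (verts (digraph_of n os)) (verts D)" "bij_betw \<beta> (arcs (digraph_of n os)) (arcs D)"
      using \<alpha> \<beta> by (simp_all add: digraph_of_def os_def)
  next
    fix i assume "i \<in> arcs (digraph_of n os)"
    then have i: "i < length es"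
      by (simp add: digraph_of_def os_def)
    show "tail D (\<beta> i) = \<alpha> (tail (digraph_of n os) i) \<and> head D (\<beta> i) = \<alpha> (head (digraph_of n os) i)"
      using ends[OF i] i by (simp add: digraph_of_def os_def)
    show "tail (digraph_of n os) i \<in> verts (digraph_of n os) \<and> head (digraph_of n os) i \<in> verts (digraph_of n os)"
      using es[OF nth_mem[OF i]] i by (auto simp: digraph_of_def os_def orient_def)
  qed
  ultimately show ?thesis
    by blast
qed

section \<open>Digraphs whose arcs lie on closed walks\<close>

text \<open>Expressed by pairs of ends only, so that it passes to isomorphic digraphs whatever their
  arcs are.\<close>

definition recurrent :: "('a, 'b) pre_digraph \<Rightarrow> bool" where
  "recurrent D \<longleftrightarrow> (\<forall>v\<in>verts D. \<exists>w. (v, w) \<in> arcs_ends D) \<and>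
     (\<forall>x\<in>arcs_ends D. (snd x, fst x) \<in> (arcs_ends D)\<^sup>*)"

lemma digraph_iso_ends:
  assumes "digraph_iso D H"
  shows "\<exists>h. bij_betw h (verts D) (verts H) \<and> arcs_ends H = map_prod h h ` arcs_ends D"
proof -
  obtain hom where hom: "pre_digraph.digraph_isomorphism D hom" "H = app_iso hom D"
    using assms by (auto simp: digraph_iso_def)
  interpret wf_digraph D
    using hom(1) by (simp add: pre_digraph.digraph_isomorphism_def)
  have "bij_betw (iso_verts hom) (verts D) (verts H)"
    using hom by (simp add: bij_betw_def digraph_isomorphism_def)
  moreover have "arcs_ends H = map_prod (iso_verts hom) (iso_verts hom) ` arcs_ends D"
    using hom(1) by (force simp: hom(2) arcs_ends_def arc_to_ends_def digraph_isomorphism_def)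
  ultimately show ?thesis
    by blast
qed

lemma recurrent_iso:
  assumes "digraph_iso D H" "recurrent D"
  shows "recurrent H"
proof -
  obtain h where h: "bij_betw h (verts D) (verts H)" "arcs_ends H = map_prod h h ` arcs_ends D"
    using digraph_iso_ends[OF assms(1)] by blast
  have step: "(h u, h w) \<in> arcs_ends H" if "(u, w) \<in> arcs_ends D" for u w
    using that by (force simp: h(2))
  have "\<exists>w. (v, w) \<in> arcs_ends H" if v: "v \<in> verts H" for v
  proof -
    obtain u where u: "u \<in> verts D" "v = h u"
      using h(1) v by (auto simp: bij_betw_def)
    then obtain w where "(u, w) \<in> arcs_ends D"
      using assms(2) by (auto simp: recurrent_def)
    then show ?thesis
      using step u by blast
  qed
  moreover have "(snd x, fst x) \<in> (arcs_ends H)\<^sup>*" if x: "x \<in> arcs_ends H" for x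
  proof -
    obtain y where y: "y \<in> arcs_ends D" "x = map_prod h h y"
      using x h(2) by auto
    then have "(snd y, fst y) \<in> (arcs_ends D)\<^sup>*"
      using assms(2) by (auto simp: recurrent_def)
    then have "(h (snd y), h (fst y)) \<in> (arcs_ends H)\<^sup>*"
      by (induction rule: rtrancl_induct) (auto intro: rtrancl_into_rtrancl step)
    then show ?thesis
      by (simp add: y(2))
  qed
  ultimately show ?thesis
    by (simp add: recurrent_def)
qed

lemma rtrancl_enters:
  assumes "(a, b) \<in> R\<^sup>*" "a \<notin> S" "b \<in> S"
  shows "\<exists>x\<in>R. fst x \<notin> S \<and> snd x \<in> S"
  using assms by (induction rule: rtrancl_induct) force+

text \<open>Necessary conditions for every arc to lie on a closed walk: besides the cuts formed by a single
  vertex, only one further cut \<open>S\<close> is needed for the graphs below.\<close>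

definition admissible :: "'a list \<Rightarrow> 'a list \<Rightarrow> ('a \<times> 'a) list \<Rightarrow> bool" where
  "admissible vs S arrs \<longleftrightarrow>
     list_all (\<lambda>v. list_ex (\<lambda>x. fst x = v) arrs \<and> list_ex (\<lambda>x. snd x = v) arrs) vs \<and>
     (list_ex (\<lambda>x. fst x \<in> set S \<and> snd x \<notin> set S) arrs \<longleftrightarrow>
      list_ex (\<lambda>x. fst x \<notin> set S \<and> snd x \<in> set S) arrs)"

text \<open>A closed walk through an arrow that leaves a set must enter the set again; for the set
  of a single vertex this turns an outgoing arrow into an incoming one.\<close>

lemma recurrent_admissible:
  assumes "recurrent (digraph_of n arrs)" and vs: "set vs = {1..n}"
  shows "admissible vs S arrs"
proof -
  have out: "\<exists>w. (v, w) \<in> set arrs" if "v \<in> {1..n}" for v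
    using assms(1) that unfolding recurrent_def arcs_ends_digraph_of by (simp add: digraph_of_def)
  have returns: "(w, v) \<in> (set arrs)\<^sup>*" if "(v, w) \<in> set arrs" for v w
    using assms(1) that unfolding recurrent_def arcs_ends_digraph_of by force
  have "\<exists>x\<in>set arrs. snd x = v" if v: "v \<in> {1..n}" for v
  proof -
    obtain w where w: "(v, w) \<in> set arrs"
      using out[OF v] by blast
    show ?thesis
    proof (cases "w = v")
      case False
      then show ?thesis
        using rtrancl_enters[OF returns[OF w], of "{v}"] by auto
    qed (use w in force)
  qed
  moreover have "\<exists>x\<in>set arrs. fst x = v" if "v \<in> {1..n}" for v
    using out[OF that] by force
  moreover have "\<exists>x\<in>set arrs. fst x \<notin> T \<and> snd x \<in> T" if leave: "\<exists>x\<in>set arrs. fst x \<in> T \<and> snd x \<notin> T" for T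
  proof -
    obtain u w where "(u, w) \<in> set arrs" "u \<in> T" "w \<notin> T"
      using leave by auto
    then show ?thesis
      using rtrancl_enters[OF returns] by blast
  qed
  from this[of "set S"] this[of "- set S"]
  have "(\<exists>x\<in>set arrs. fst x \<in> set S \<and> snd x \<notin> set S) \<longleftrightarrow> (\<exists>x\<in>set arrs. fst x \<notin> set S \<and> snd x \<in> set S)"
    by auto
  ultimately show ?thesis
    by (simp add: admissible_def list_all_iff list_ex_iff vs)
qed

section \<open>Classification of orientations by evaluation\<close>

text \<open>The multiplicities of all arrows possible on \<open>es\<close> are a normal form of an
  arrow list up to order, so that multisets are compared as lists of numbers.\<close>

definition count_key :: "('a \<times> 'a) list \<Rightarrow> ('a \<times> 'a) list \<Rightarrow> nat list" where
  "count_key es arrs = map (count_list arrs) (es @ map prod.swap es)"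

lemma mset_eq_if_count_key_eq:
  assumes "set xs \<subseteq> set (es @ map prod.swap es)" "set ys \<subseteq> set (es @ map prod.swap es)"
    and "count_key es xs = count_key es ys"
  shows "mset xs = mset ys"
proof (rule multiset_eqI)
  fix x
  show "count (mset xs) x = count (mset ys) x"
  proof (cases "x \<in> set (es @ map prod.swap es)")
    case True
    then show ?thesis
      using assms(3) unfolding count_key_def count_mset map_eq_conv by blast
  next
    case False
    then have "x \<notin> set xs" "x \<notin> set ys"
      using assms(1,2) by auto
    then show ?thesis
      by (simp add: count_mset)
  qed
qed

text \<open>An inclusion of sets, phrased so that the simplifier evaluates the first list only once.\<close>

fun all_members :: "'a list \<Rightarrow> 'a list \<Rightarrow> bool" where
  "all_members ks [] \<longleftrightarrow> True"
| "all_members ks (x # xs) \<longleftrightarrow> x \<in> set ks \<and> all_members ks xs"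

lemma all_members_iff: "all_members ks xs \<longleftrightarrow> set xs \<subseteq> set ks"
  by (induction xs) auto

text \<open>The list \<open>p\<close> names the images of 1, 2, and so on; vertices are numbered
  from 1, positions from 0.\<close>

definition relabel :: "nat list \<Rightarrow> nat \<Rightarrow> nat" where
  "relabel p v = p ! (v - 1)"

lemma relabel_bij:
  assumes "length p = n" "distinct p" "set p \<subseteq> {1..n}"
  shows "bij_betw (relabel p) {1..n} {1..n}"
proof -
  have inj: "inj_on (relabel p) {1..n}"
    using assms(1,2) by (auto simp: inj_on_def relabel_def nth_eq_iff_index_eq)
  moreover have "relabel p ` {1..n} \<subseteq> {1..n}"
  proof
    fix w assume "w \<in> relabel p ` {1..n}"
    then have "w \<in> set p"
      using assms(1) by (auto simp: relabel_def)
    then show "w \<in> {1..n}"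
      using assms(3) by blast
  qed
  ultimately show ?thesis
    by (simp add: bij_betw_def endo_inj_surj)
qed

definition relabellings :: "nat list list \<Rightarrow> (nat \<times> nat) list list \<Rightarrow> (nat \<times> nat) list list" where
  "relabellings ps ts = concat (map (\<lambda>p. map (map (map_prod (relabel p) (relabel p))) ts) ps)"

text \<open>A condition that evaluation can check: every admissible orientation of \<open>es\<close>
  is, up to the order of its arrows, a target in \<open>ts\<close> relabelled by a permutation in
  \<open>ps\<close>. The third conjunct keeps all relabelled arrows on edges of \<open>es\<close>,
  where \<open>count_key\<close> determines the multiset.\<close>

definition classifies ::
  "nat list \<Rightarrow> (nat \<times> nat) list \<Rightarrow> nat list \<Rightarrow> nat list list \<Rightarrow> (nat \<times> nat) list list \<Rightarrow> bool" where
  "classifies vs es S ps ts \<longleftrightarrow>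
     list_all (\<lambda>p. length p = length vs \<and> distinct p \<and> list_all (\<lambda>v. v \<in> set vs) p) ps \<and>
     list_all (list_all (\<lambda>x. fst x \<in> set vs \<and> snd x \<in> set vs)) ts \<and>
     list_all (list_all (\<lambda>x. x \<in> set (es @ map prod.swap es))) (relabellings ps ts) \<and>
     all_members (map (count_key es) (relabellings ps ts))
       (map (count_key es) (filter (admissible vs S) (orientations es)))"

lemma classifiesD:
  assumes vs: "set vs = {1..n}" "length vs = n" and cl: "classifies vs es S ps ts"
    and os: "os \<in> set (orientations es)" "recurrent (digraph_of n os)"
  shows "\<exists>t\<in>set ts. digraph_iso (digraph_of n os) (digraph_of n t)"
proof -
  have adm: "admissible vs S os"
    by (rule recurrent_admissible[OF os(2) vs(1)])
  have "set (map (count_key es) (filter (admissible vs S) (orientations es))) \<subseteq>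
      set (map (count_key es) (relabellings ps ts))"
    using cl by (simp only: classifies_def all_members_iff)
  then have "count_key es os \<in> count_key es ` set (relabellings ps ts)"
    using os(1) adm by auto
  then obtain p t where pt: "p \<in> set ps" "t \<in> set ts"
      "count_key es os = count_key es (map (map_prod (relabel p) (relabel p)) t)"
    by (auto simp: relabellings_def)
  have p: "length p = n" "distinct p" "set p \<subseteq> {1..n}"
    using cl pt(1) vs unfolding classifies_def list_all_iff by auto
  have t: "fst x \<in> {1..n} \<and> snd x \<in> {1..n}" if "x \<in> set t" for x
    using cl pt(2) that vs unfolding classifies_def list_all_iff by auto
  have "map (map_prod (relabel p) (relabel p)) t \<in> set (relabellings ps ts)"
    using pt(1,2) by (auto simp: relabellings_def)
  then have "set (map (map_prod (relabel p) (relabel p)) t) \<subseteq> set (es @ map prod.swap es)"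
    using cl unfolding classifies_def list_all_iff by blast
  moreover have "set os \<subseteq> set (es @ map prod.swap es)"
  proof
    fix x assume "x \<in> set os"
    then obtain i where "i < length os" "x = os ! i"
      by (auto simp: in_set_conv_nth)
    then have "es ! i \<in> set es" "x = es ! i \<or> x = prod.swap (es ! i)"
      using os(1) unfolding mem_orientations_iff list_all2_conv_all_nth by simp_all
    then show "x \<in> set (es @ map prod.swap es)"
      by auto
  qed
  ultimately have "mset (map (map_prod (relabel p) (relabel p)) t) = mset os"
    using pt(3) by (intro mset_eq_if_count_key_eq) auto
  then show ?thesis
    using digraph_of_iso_relabelling[OF t relabel_bij[OF p]] pt(2) by blast
qed

section \<open>Isomorphism invariants\<close>

lemma digraph_of_simps [simp]:
  "verts (digraph_of n arrs) = {1..n}" "arcs (digraph_of n arrs) = {..<length arrs}"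
  "tail (digraph_of n arrs) = (\<lambda>i. fst (arrs ! i))" "head (digraph_of n arrs) = (\<lambda>i. snd (arrs ! i))"
  by (simp_all add: digraph_of_def)

primrec walk_count :: "('a, 'b) pre_digraph \<Rightarrow> nat \<Rightarrow> 'a \<Rightarrow> nat" where
  "walk_count D 0 v = 1"
| "walk_count D (Suc k) v = (\<Sum>a\<in>out_arcs D v. walk_count D k (head D a))"

definition walk_square_sum :: "('a, 'b) pre_digraph \<Rightarrow> nat \<Rightarrow> nat" where
  "walk_square_sum D k = (\<Sum>v\<in>verts D. (walk_count D k v)\<^sup>2)"

text \<open>An isomorphism maps the arcs leaving \<open>v\<close> bijectively to those leaving its
  image, so walk counts are preserved vertex by vertex; summing over all vertices removes the
  dependence on the labels.\<close>

lemma walk_square_sum_iso: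
  assumes "digraph_iso D H"
  shows "walk_square_sum D k = walk_square_sum H k"
proof -
  obtain hom where hom: "pre_digraph.digraph_isomorphism D hom" "H = app_iso hom D"
    using assms by (auto simp: digraph_iso_def)
  interpret wf_digraph D
    using hom(1) by (simp add: pre_digraph.digraph_isomorphism_def)
  have wc: "walk_count H k (iso_verts hom v) = walk_count D k v" if "v \<in> verts D" for v
    using that
  proof (induction k arbitrary: v)
    case (Suc k)
    have inj: "inj_on (iso_arcs hom) (out_arcs D v)"
      by (rule inj_on_subset[OF digraph_isomorphism_inj_on_arcs[OF hom(1)]]) auto
    have "walk_count H (Suc k) (iso_verts hom v) =
        (\<Sum>a\<in>out_arcs D v. walk_count H k (head H (iso_arcs hom a)))"
      using out_arcs_app_iso_eq[OF hom(1) Suc.prems] by (simp add: hom(2) sum.reindex[OF inj])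
    also have "\<dots> = (\<Sum>a\<in>out_arcs D v. walk_count D k (head D a))"
    proof (rule sum.cong[OF refl])
      fix a assume "a \<in> out_arcs D v"
      then have "a \<in> arcs D"
        by simp
      then show "walk_count H k (head H (iso_arcs hom a)) = walk_count D k (head D a)"
        using Suc.IH[of "head D a"] by (simp add: hom(2) iso_verts_head[OF hom(1)])
    qed
    finally show ?case
      by simp
  qed simp
  have "walk_square_sum H k = (\<Sum>v\<in>verts D. (walk_count H k (iso_verts hom v))\<^sup>2)"
    using digraph_isomorphism_inj_on_verts[OF hom(1)] by (simp add: walk_square_sum_def hom(2) sum.reindex)
  then show ?thesis
    by (simp add: walk_square_sum_def wc)
qed

text \<open>The same count by recursion over the arrow list, which can be evaluated.\<close>

primrec list_walk_count :: "(nat \<times> nat) list \<Rightarrow> nat \<Rightarrow> nat \<Rightarrow> nat" where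
  "list_walk_count arrs 0 v = 1"
| "list_walk_count arrs (Suc k) v =
     sum_list (map (\<lambda>x. if fst x = v then list_walk_count arrs k (snd x) else 0) arrs)"

lemma walk_count_digraph_of: "walk_count (digraph_of n arrs) k v = list_walk_count arrs k v"
proof (induction k arbitrary: v)
  case (Suc k)
  have "walk_count (digraph_of n arrs) (Suc k) v =
      (\<Sum>i\<in>{i \<in> {..<length arrs}. fst (arrs ! i) = v}. list_walk_count arrs k (snd (arrs ! i)))"
    by (simp add: Suc out_arcs_def)
  also have "\<dots> = (\<Sum>i\<in>{..<length arrs}. if fst (arrs ! i) = v then list_walk_count arrs k (snd (arrs ! i)) else 0)"
    by (rule sum.inter_filter) simp
  also have "\<dots> = list_walk_count arrs (Suc k) v"
    by (simp add: sum_list_sum_nth atLeast0LessThan)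
  finally show ?case .
qed simp

lemma walk_square_sum_digraph_of:
  "walk_square_sum (digraph_of n arrs) k = sum_list (map (\<lambda>v. (list_walk_count arrs k v)\<^sup>2) [1..<Suc n])"
proof -
  have "walk_square_sum (digraph_of n arrs) k = (\<Sum>v\<in>set [1..<Suc n]. (list_walk_count arrs k v)\<^sup>2)"
    by (simp add: walk_square_sum_def walk_count_digraph_of atLeastLessThanSuc_atLeastAtMost
        del: upt_Suc)
  then show ?thesis
    by (simp add: sum_list_distinct_conv_sum_set del: upt_Suc)
qed

lemma card_two_cycle_pairs_iso:
  fixes D :: "('a, 'b) pre_digraph" and H :: "('c, 'd) pre_digraph"
  assumes "digraph_iso D H"
  shows "card (two_cycle_pairs D) = card (two_cycle_pairs H)"
proof -
  obtain h where h: "bij_betw h (verts D) (verts H)" "arcs_ends H = map_prod h h ` arcs_ends D"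
    using digraph_iso_ends[OF assms] by blast
  obtain hom :: "('a, 'b, 'c, 'd) digraph_isomorphism" where hom: "pre_digraph.digraph_isomorphism D hom"
    using assms unfolding digraph_iso_def by blast
  interpret wf_digraph D
    using hom by (simp add: pre_digraph.digraph_isomorphism_def)
  have inV: "u \<in> verts D \<and> w \<in> verts D" if "(u, w) \<in> arcs_ends D" for u w
    using that by (auto simp: arcs_ends_def arc_to_ends_def)
  have inj: "h u = h u' \<longleftrightarrow> u = u'" if "u \<in> verts D" "u' \<in> verts D" for u u'
    using h(1) that by (auto simp: bij_betw_def dest: inj_onD)
  have ends: "(h u, h w) \<in> arcs_ends H \<longleftrightarrow> (u, w) \<in> arcs_ends D" if "u \<in> verts D" "w \<in> verts D" for u w
    using that inj inV unfolding h(2) by (auto simp: map_prod_def image_iff) (metis (no_types, lifting) case_prod_conv)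
  have "two_cycle_pairs H = (`) h ` two_cycle_pairs D"
  proof (intro equalityI subsetI)
    fix p assume "p \<in> two_cycle_pairs H"
    then obtain a b where ab: "p = {a, b}" "a \<noteq> b" "(a, b) \<in> arcs_ends H" "(b, a) \<in> arcs_ends H"
      by (auto simp: two_cycle_pairs_def)
    then obtain u w where uw: "(u, w) \<in> arcs_ends D" "a = h u" "b = h w"
      by (auto simp: h(2))
    then have "(w, u) \<in> arcs_ends D" "u \<noteq> w"
      using ab ends inV[OF uw(1)] by auto
    then have "{u, w} \<in> two_cycle_pairs D" "p = h ` {u, w}"
      using uw ab(1) by (auto simp: two_cycle_pairs_def)
    then show "p \<in> (`) h ` two_cycle_pairs D"
      by blast
  next
    fix p assume "p \<in> (`) h ` two_cycle_pairs D"
    then obtain u w where uw: "p = {h u, h w}" "u \<noteq> w" "(u, w) \<in> arcs_ends D" "(w, u) \<in> arcs_ends D"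
      by (auto simp: two_cycle_pairs_def)
    then have "h u \<noteq> h w" "(h u, h w) \<in> arcs_ends H" "(h w, h u) \<in> arcs_ends H"
      using inj inV[OF uw(3)] ends by auto
    then show "p \<in> two_cycle_pairs H"
      unfolding two_cycle_pairs_def using uw(1) by blast
  qed
  moreover have "inj_on ((`) h) (two_cycle_pairs D)"
  proof (rule inj_on_subset)
    show "inj_on ((`) h) (Pow (verts D))"
      using h(1) by (simp add: bij_betw_def inj_on_image_Pow)
    show "two_cycle_pairs D \<subseteq> Pow (verts D)"
      using inV by (auto simp: two_cycle_pairs_def)
  qed
  ultimately show ?thesis
    by (simp add: card_image)
qed

section \<open>Cycles under isomorphisms\<close>

lemma cycle_app_iso:
  assumes hom: "pre_digraph.digraph_isomorphism G hom" and p: "pre_digraph.cycle G p"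
  shows "pre_digraph.cycle (app_iso hom G) (map (iso_arcs hom) p)"
proof -
  interpret wf_digraph G
    using hom by (simp add: pre_digraph.digraph_isomorphism_def)
  obtain u where u: "awalk u p u" "distinct (tl (awalk_verts u p))" "p \<noteq> []"
    using p by (auto simp: cycle_def)
  have "set (awalk_verts u p) \<subseteq> verts G"
    using awalk_verts_in_verts[of u p] u(1) by (auto simp: awalk_def)
  then have "set (tl (awalk_verts u p)) \<subseteq> verts G"
    using list.set_sel(2)[of "awalk_verts u p"] by (cases "awalk_verts u p") auto
  then have "distinct (map (iso_verts hom) (tl (awalk_verts u p)))"
    using u(2) digraph_isomorphism_inj_on_verts[OF hom] by (auto simp: distinct_map intro: inj_on_subset)
  then have "distinct (tl (pre_digraph.awalk_verts (app_iso hom G) (iso_verts hom u) (map (iso_arcs hom) p)))"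
    by (simp add: awalk_verts_app_iso_eq[OF hom u(1)] map_tl)
  then show ?thesis
    unfolding pre_digraph.cycle_def using awalk_app_isoI[OF u(1) hom] u(3) by blast
qed

lemma cycle_arcs: "pre_digraph.cycle G p \<Longrightarrow> set p \<subseteq> arcs G"
  by (auto simp: pre_digraph.cycle_def pre_digraph.awalk_def)

text \<open>The inverse isomorphism gives one of the inclusions between the families of arc sets.
  The last conjunct keeps the arc lists, and with them the lengths, for the claim that there is no
  cycle of length 6.\<close>

lemma cycles_iso:
  assumes "digraph_iso D H"
  shows "\<exists>h. inj_on h (arcs D) \<and> arcs H = h ` arcs D \<and> cycle_arc_sets H = (`) h ` cycle_arc_sets D \<and>
    (\<forall>p. pre_digraph.cycle D p \<longrightarrow> pre_digraph.cycle H (map h p))"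
proof -
  obtain hom where hom: "pre_digraph.digraph_isomorphism D hom" "H = app_iso hom D"
    using assms by (auto simp: digraph_iso_def)
  interpret wf_digraph D
    using hom(1) by (simp add: pre_digraph.digraph_isomorphism_def)
  let ?h = "iso_arcs hom"
  note inv = digraph_isomorphism_invI[OF hom(1)]
  have "cycle_arc_sets H = (`) ?h ` cycle_arc_sets D"
  proof (intro equalityI subsetI)
    fix C assume "C \<in> cycle_arc_sets H"
    then obtain q where q: "C = set q" "pre_digraph.cycle (app_iso hom D) q"
      by (auto simp: cycle_arc_sets_def hom(2))
    have "pre_digraph.cycle (app_iso (inv_iso hom) (app_iso hom D)) (map (iso_arcs (inv_iso hom)) q)"
      by (rule cycle_app_iso[OF inv q(2)])
    then have "set (map (iso_arcs (inv_iso hom)) q) \<in> cycle_arc_sets D"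
      unfolding cycle_arc_sets_def app_iso_inv[OF hom(1)] by blast
    moreover have "C = ?h ` set (map (iso_arcs (inv_iso hom)) q)"
    proof -
      have "?h (iso_arcs (inv_iso hom) e) = e" if "e \<in> set q" for e
        using iso_arcs_iso_inv[OF hom(1), of e] cycle_arcs[OF q(2)] that by auto
      then show ?thesis
        by (simp add: q(1) image_image)
    qed
    ultimately show "C \<in> (`) ?h ` cycle_arc_sets D"
      by blast
  next
    fix C assume "C \<in> (`) ?h ` cycle_arc_sets D"
    then obtain p where p: "C = ?h ` set p" "pre_digraph.cycle D p"
      by (auto simp: cycle_arc_sets_def)
    have "C = set (map ?h p)"
      by (simp add: p(1))
    then show "C \<in> cycle_arc_sets H"
      using cycle_app_iso[OF hom(1) p(2)] unfolding cycle_arc_sets_def hom(2) by blast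
  qed
  then show ?thesis
    using digraph_isomorphism_inj_on_arcs[OF hom(1)] cycle_app_iso[OF hom(1)] hom(2)
    by (intro exI[of _ ?h]) simp
qed

section \<open>The network without a cycle through all equilibria\<close>

abbreviation arrows_V3 :: "(nat \<times> nat) list" where
  "arrows_V3 \<equiv> [(1,4), (2,4), (4,3), (3,5), (3,6), (5,1), (5,2), (6,1), (6,2)]"

text \<open>The vertices are arranged cyclically in the levels \<open>{1, 2}, {4}, {3}, {5, 6}\<close>.\<close>

definition level_V3 :: "nat \<Rightarrow> nat" where
  "level_V3 v = (if v = 4 then 1 else if v = 3 then 2 else if v = 5 \<or> v = 6 then 3 else 0)"

text \<open>All closed walks with four arcs, by enumeration; requiring consecutive arcs to fit right
  after each quantifier prunes the search, and \<open>sort\<close> forgets the starting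
  point.\<close>

lemma closed_walks_V3:
  "\<forall>a\<in>set [0..<9]. \<forall>b\<in>set [0..<9]. snd (arrows_V3 ! a) = fst (arrows_V3 ! b) \<longrightarrow>
    (\<forall>c\<in>set [0..<9]. snd (arrows_V3 ! b) = fst (arrows_V3 ! c) \<longrightarrow>
      (\<forall>d\<in>set [0..<9]. snd (arrows_V3 ! c) = fst (arrows_V3 ! d) \<longrightarrow> snd (arrows_V3 ! d) = fst (arrows_V3 ! a) \<longrightarrow>
        sort [a, b, c, d] \<in> set [[0,2,3,5], [1,2,3,6], [0,2,4,7], [1,2,4,8]]))"
  by code_simp

lemma level_V3_arc: "i < 9 \<Longrightarrow> level_V3 (snd (arrows_V3 ! i)) = (level_V3 (fst (arrows_V3 ! i)) + 1) mod 4"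
proof -
  have "\<forall>i\<in>set [0..<9]. level_V3 (snd (arrows_V3 ! i)) = (level_V3 (fst (arrows_V3 ! i)) + 1) mod 4"
    by code_simp
  then show "i < 9 \<Longrightarrow> ?thesis"
    by simp
qed

text \<open>Every arc raises the level by one modulo 4, so the length of a cycle is a multiple of 4.
  Its arcs have different heads among six vertices, hence the length is 4 and the enumeration
  applies.\<close>

lemma cycle_V3:
  assumes "pre_digraph.cycle network_V3 p"
  shows "length p = 4 \<and> set p \<in> {{0,2,3,5}, {1,2,3,6}, {0,2,4,7}, {1,2,4,8}}"
proof -
  obtain u where u: "pre_digraph.awalk network_V3 u p u" "distinct (tl (pre_digraph.awalk_verts network_V3 u p))" "p \<noteq> []"
    using assms by (auto simp: pre_digraph.cycle_def)
  have ends: "tail network_V3 i = fst (arrows_V3 ! i)" "head network_V3 i = snd (arrows_V3 ! i)" for i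
    by (simp_all add: network_V3_def)
  have arcs: "set p \<subseteq> {..<9}" and cas: "pre_digraph.cas network_V3 u p u"
    using u(1) by (auto simp: pre_digraph.awalk_def network_V3_def)
  have level: "level_V3 w mod 4 = (level_V3 v + length q) mod 4"
    if "pre_digraph.cas network_V3 v q w" "set q \<subseteq> {..<9}" for v q w
    using that
  proof (induction q arbitrary: v)
    case (Cons i q)
    have "level_V3 w mod 4 = (level_V3 (head network_V3 i) + length q) mod 4"
      using Cons by (simp add: pre_digraph.cas.simps)
    also have "\<dots> = ((level_V3 v + 1) mod 4 + length q) mod 4"
      using Cons.prems level_V3_arc[of i] by (simp add: pre_digraph.cas.simps ends)
    also have "\<dots> = (level_V3 v + length (i # q)) mod 4"
      by (simp add: mod_add_left_eq)
    finally show ?case .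
  qed (simp add: pre_digraph.cas.simps)
  from level[OF cas arcs] have mod: "length p mod 4 = 0"
    by presburger
  have "distinct (map (head network_V3) p)"
    using u(2,3) pre_digraph.awalk_verts_conv'[OF cas] by simp
  then have "length p = card (head network_V3 ` set p)"
    using distinct_card by fastforce
  also have "\<dots> \<le> card {1..6::nat}"
  proof (rule card_mono)
    have "\<forall>i\<in>set [0..<9]. snd (arrows_V3 ! i) \<in> {1..6::nat}"
      by code_simp
    then show "head network_V3 ` set p \<subseteq> {1..6}"
      using arcs by (auto simp: ends)
  qed simp
  finally have "length p \<le> 6"
    by simp
  moreover have "length p > 0"
    using u(3) by simp
  ultimately have len: "length p = 4"
    using mod by presburger
  then obtain a b c d where p: "p = [a, b, c, d]"
    by (auto simp: numeral_eq_Suc length_Suc_conv)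
  have "sort [a, b, c, d] \<in> set [[0,2,3,5], [1,2,3,6], [0,2,4,7], [1,2,4,8]]"
    using closed_walks_V3 cas arcs by (simp add: p pre_digraph.cas.simps ends)
  then have "set (sort [a, b, c, d]) \<in> set ` set [[0,2,3,5], [1,2,3,6], [0,2,4,7], [1,2,4,8]]"
    by blast
  then have "set p \<in> set ` set [[0,2,3,5], [1,2,3,6], [0,2,4,7], [1,2,4,8]]"
    unfolding set_sort p .
  then show ?thesis
    using len by simp
qed

lemma cycle_arc_sets_V3: "cycle_arc_sets network_V3 = {{0,2,3,5}, {1,2,3,6}, {0,2,4,7}, {1,2,4,8}}"
proof
  show "cycle_arc_sets network_V3 \<subseteq> {{0,2,3,5}, {1,2,3,6}, {0,2,4,7}, {1,2,4,8}}"
  proof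
    fix C assume "C \<in> cycle_arc_sets network_V3"
    then obtain p where "C = set p" "pre_digraph.cycle network_V3 p"
      unfolding cycle_arc_sets_def by blast
    then show "C \<in> {{0,2,3,5}, {1,2,3,6}, {0,2,4,7}, {1,2,4,8}}"
      using cycle_V3 by blast
  qed
  have cyc: "set [a, b, c, d] \<in> cycle_arc_sets network_V3"
    if "pre_digraph.awalk network_V3 u [a, b, c, d] u" "distinct (map (head network_V3) [a, b, c, d])" for a b c d u
  proof -
    have "pre_digraph.cas network_V3 u [a, b, c, d] u"
      using that(1) by (simp add: pre_digraph.awalk_def)
    then have "distinct (tl (pre_digraph.awalk_verts network_V3 u [a, b, c, d]))"
      using that(2) pre_digraph.awalk_verts_conv' by fastforce
    then have "pre_digraph.cycle network_V3 [a, b, c, d]"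
      using that(1) unfolding pre_digraph.cycle_def by blast
    then show ?thesis
      unfolding cycle_arc_sets_def by blast
  qed
  have "set [0,2,3,5] \<in> cycle_arc_sets network_V3" "set [1,2,3,6] \<in> cycle_arc_sets network_V3"
    "set [0,2,4,7] \<in> cycle_arc_sets network_V3" "set [1,2,4,8] \<in> cycle_arc_sets network_V3"
    by (rule cyc[of 1] cyc[of 2]; simp add: pre_digraph.awalk_def pre_digraph.cas.simps network_V3_def)+
  then show "{{0,2,3,5}, {1,2,3,6}, {0,2,4,7}, {1,2,4,8}} \<subseteq> cycle_arc_sets network_V3"
    by simp
qed

text \<open>Everything is computed on \<open>network_V3\<close> and pulled back along an injection
  on arcs, which respects cardinalities and unions of arc sets.\<close>

lemma cycles_of_iso_V3:
  assumes "digraph_iso D network_V3"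
  shows "\<not> (\<exists>p. pre_digraph.cycle D p \<and> length p = 6)" "card (cycle_arc_sets D) = 4"
    "\<forall>C\<in>cycle_arc_sets D. card C = 4" "\<Union>(cycle_arc_sets D) = arcs D"
proof -
  obtain h where h: "inj_on h (arcs D)" "arcs network_V3 = h ` arcs D"
    "cycle_arc_sets network_V3 = (`) h ` cycle_arc_sets D"
    "\<And>p. pre_digraph.cycle D p \<Longrightarrow> pre_digraph.cycle network_V3 (map h p)"
    using cycles_iso[OF assms] by blast
  show "\<not> (\<exists>p. pre_digraph.cycle D p \<and> length p = 6)"
    using h(4) cycle_V3 by fastforce
  have sub: "C \<subseteq> arcs D" if "C \<in> cycle_arc_sets D" for C
    using that cycle_arcs by (auto simp: cycle_arc_sets_def)
  have "inj_on ((`) h) (cycle_arc_sets D)"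
    by (rule inj_on_subset[of _ "Pow (arcs D)"]) (use h(1) sub in \<open>auto simp: inj_on_image_Pow\<close>)
  then have "card (cycle_arc_sets D) = card (cycle_arc_sets network_V3)"
    by (simp add: h(3) card_image)
  moreover have "card {{0,2,3,5}, {1,2,3,6}, {0,2,4,7}, {1,2,4,8::nat}} = 4"
  proof -
    have "{0,2,3,5} \<noteq> {1,2,3,6::nat}" "{0,2,3,5} \<noteq> {0,2,4,7::nat}" "{0,2,3,5} \<noteq> {1,2,4,8::nat}"
      "{1,2,3,6} \<noteq> {0,2,4,7::nat}" "{1,2,3,6} \<noteq> {1,2,4,8::nat}" "{0,2,4,7} \<noteq> {1,2,4,8::nat}"
      by (simp_all add: set_eq_subset)
    then show ?thesis
      by simp
  qed
  ultimately show "card (cycle_arc_sets D) = 4"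
    by (simp add: cycle_arc_sets_V3)
  show "\<forall>C\<in>cycle_arc_sets D. card C = 4"
  proof
    fix C assume C: "C \<in> cycle_arc_sets D"
    have "card (h ` C) = card C"
      using sub[OF C] h(1) by (intro card_image) (rule inj_on_subset)
    moreover have "h ` C \<in> cycle_arc_sets network_V3"
      using C h(3) by blast
    ultimately show "card C = 4"
      unfolding cycle_arc_sets_V3 by auto
  qed
  have "h ` \<Union>(cycle_arc_sets D) = \<Union>(cycle_arc_sets network_V3)"
    by (simp add: h(3) image_Union)
  also have "\<dots> = arcs network_V3"
    unfolding cycle_arc_sets_V3 by (auto simp: network_V3_def)
  finally have "h ` \<Union>(cycle_arc_sets D) = h ` arcs D"
    by (simp add: h(2))
  moreover have "\<Union>(cycle_arc_sets D) \<subseteq> arcs D"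
    using sub by blast
  ultimately show "\<Union>(cycle_arc_sets D) = arcs D"
    using inj_on_image_eq_iff[OF h(1) _ subset_refl] by simp
qed

section \<open>Networks with two equilibria\<close>

text \<open>Each vertex has an arrow out and an arrow in and three arrow ends in all, and there are
  as many tails as heads; so one vertex \<open>A\<close> has two arrows out and one in, and
  \<open>B\<close> the converse. The arrow that leads back to \<open>A\<close> is the only one
  leaving \<open>B\<close> and the only one entering \<open>A\<close>, so both arrows from
  \<open>A\<close> end in \<open>B\<close>. In particular there are no loops.\<close>

lemma two_vertex_network:
  assumes wf: "wf_digraph D" and card2: "card (verts D) = 2" and fin: "finite (arcs D)"
    and deg: "\<And>v. v \<in> verts D \<Longrightarrow> card {a \<in> arcs D. tail D a = v} + card {a \<in> arcs D. head D a = v} = 3"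
    and rec: "recurrent D"
  shows "digraph_iso D network_two_orbits"
proof -
  interpret wf_digraph D
    by (rule wf)
  define out where "out v = {a \<in> arcs D. tail D a = v}" for v
  define inn where "inn v = {a \<in> arcs D. head D a = v}" for v
  have fin': "finite (out v)" "finite (inn v)" for v
    using fin by (simp_all add: out_def inn_def)
  have io: "card (out v) + card (inn v) = 3" if "v \<in> verts D" for v
    using deg[OF that] by (simp add: out_def inn_def)
  have returns: "(head D a, tail D a) \<in> (arcs_ends D)\<^sup>*" if "a \<in> arcs D" for a
    using rec that unfolding recurrent_def arcs_ends_def arc_to_ends_def by force
  have out1: "card (out v) \<ge> 1" if "v \<in> verts D" for v
  proof -
    obtain w where "(v, w) \<in> arcs_ends D"
      using rec \<open>v \<in> verts D\<close> by (auto simp: recurrent_def)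
    then have "out v \<noteq> {}"
      by (auto simp: out_def arcs_ends_def arc_to_ends_def)
    then show ?thesis
      using fin' by (simp add: Suc_le_eq card_gt_0_iff)
  qed
  have in1: "card (inn v) \<ge> 1" if v: "v \<in> verts D" for v
  proof -
    obtain a where a: "a \<in> arcs D" "tail D a = v"
      using out1[OF v] by (fastforce simp: out_def card_gt_0_iff Suc_le_eq)
    have "inn v \<noteq> {}"
    proof (cases "head D a = v")
      case False
      then obtain x where "x \<in> arcs_ends D" "snd x \<in> {v}"
        using rtrancl_enters[OF returns[OF a(1)], of "{v}"] a(2) by auto
      then show ?thesis
        by (auto simp: inn_def arcs_ends_def arc_to_ends_def)
    qed (use a in \<open>auto simp: inn_def\<close>)
    then show ?thesis
      using fin' by (simp add: Suc_le_eq card_gt_0_iff)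
  qed
  obtain A0 B0 where AB0: "verts D = {A0, B0}" "A0 \<noteq> B0"
    using card2 by (auto simp: card_2_iff)
  have "out A0 \<union> out B0 = arcs D" "inn A0 \<union> inn B0 = arcs D" "out A0 \<inter> out B0 = {}" "inn A0 \<inter> inn B0 = {}"
    using AB0 tail_in_verts head_in_verts by (auto simp: out_def inn_def)
  then have "card (out A0) + card (out B0) = card (inn A0) + card (inn B0)"
    using fin' by (metis card_Un_disjoint)
  then have "card (out A0) = 2 \<and> card (out B0) = 1 \<or> card (out A0) = 1 \<and> card (out B0) = 2"
    using io[of A0] io[of B0] out1[of A0] out1[of B0] in1[of A0] in1[of B0] AB0(1) by simp linarith
  then obtain A B where AB: "verts D = {A, B}" "A \<noteq> B" "card (out A) = 2" "card (out B) = 1"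
    using AB0 by (metis insert_commute)
  have "card (inn A) = 1"
    using io[of A] AB by simp
  then obtain c where c: "inn A = {c}"
    by (auto simp: card_1_singleton_iff)
  obtain b where b: "out B = {b}"
    using AB(4) by (auto simp: card_1_singleton_iff)
  obtain x y where xy: "out A = {x, y}" "x \<noteq> y"
    using AB(3) by (auto simp: card_2_iff)
  have mem: "x \<in> arcs D" "y \<in> arcs D" "b \<in> arcs D" "c \<in> arcs D" "tail D x = A" "tail D y = A" "tail D b = B" "head D c = A"
    using xy b c unfolding out_def inn_def by blast+
  have head_cases: "head D a = A \<or> head D a = B" if "a \<in> arcs D" for a
    using head_in_verts[OF that] AB(1) by simp
  have "\<exists>a\<in>{x, y}. head D a = B"
  proof (rule ccontr)
    assume "\<not> ?thesis"
    then have "x \<in> inn A" "y \<in> inn A"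
      using mem head_cases by (auto simp: inn_def)
    then show False
      using c xy(2) by simp
  qed
  then obtain a where a: "a \<in> arcs D" "tail D a = A" "head D a = B"
    using mem by blast
  obtain e where e: "e \<in> arcs_ends D" "fst e \<notin> {A}" "snd e \<in> {A}"
    using rtrancl_enters[OF returns[OF a(1)], of "{A}"] a AB(2) by auto
  then obtain k where k: "k \<in> arcs D" "tail D k \<noteq> A" "head D k = A"
    by (auto simp: arcs_ends_def arc_to_ends_def)
  then have "k \<in> inn A" "k \<in> out B"
    using tail_in_verts[OF k(1)] AB(1) by (auto simp: inn_def out_def)
  then have "c = b"
    using b c by simp
  have bA: "head D b = A"
    using mem(8) \<open>c = b\<close> by simp
  have "x \<notin> inn A" "y \<notin> inn A"
    using c \<open>c = b\<close> mem(5,6,7) AB(2) by auto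
  then have xyB: "head D x = B" "head D y = B"
    using mem head_cases by (auto simp: inn_def)
  have "arcs D = out A \<union> out B"
    using AB(1) tail_in_verts by (auto simp: out_def)
  then have arcs: "arcs D = {x, y, b}"
    using xy b by auto
  have neq: "x \<noteq> b" "y \<noteq> b"
    using mem AB(2) by auto
  have H_arcs: "arcs network_two_orbits = {0, 1, 2}"
    by (auto simp: network_two_orbits_def)
  have two: "{Suc 0..2} = {Suc 0, 2}"
    by auto
  show ?thesis
  proof (rule digraph_isoI[OF wf, where \<alpha> = "\<lambda>i. if i = 1 then A else B" and \<beta> = "(!) [x, y, b]"])
    show "bij_betw (\<lambda>i. if i = 1 then A else B) (verts network_two_orbits) (verts D)"
      using AB(1,2) by (auto simp: network_two_orbits_def two bij_betw_def)
    show "bij_betw ((!) [x, y, b]) (arcs network_two_orbits) (arcs D)"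
      unfolding H_arcs arcs using xy(2) neq by (auto simp: bij_betw_def inj_on_def)
  next
    fix i assume "i \<in> arcs network_two_orbits"
    then have "i = 0 \<or> i = 1 \<or> i = 2"
      by (simp add: H_arcs)
    then show "tail D ([x, y, b] ! i) = (if tail network_two_orbits i = 1 then A else B) \<and>
        head D ([x, y, b] ! i) = (if head network_two_orbits i = 1 then A else B)"
      "tail network_two_orbits i \<in> verts network_two_orbits \<and> head network_two_orbits i \<in> verts network_two_orbits"
      using mem bA xyB by (auto simp: network_two_orbits_def)
  qed
qed

section \<open>Classification of the admissible orientations\<close>

definition perms_of_three :: "'a \<Rightarrow> 'a \<Rightarrow> 'a \<Rightarrow> 'a list list" where
  "perms_of_three a b c = [[a,b,c], [a,c,b], [b,a,c], [b,c,a], [c,a,b], [c,b,a]]"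

abbreviation arrows_IV :: "bool \<Rightarrow> bool \<Rightarrow> (nat \<times> nat) list" where
  "arrows_IV b c \<equiv> [(1,3), (4,2)] @ (if b then [(1,2), (2,1)] else [(2,1), (2,1)])
        @ (if c then [(3,4), (4,3)] else [(3,4), (3,4)])"

text \<open>The relabellings are all permutations of four vertices, made by inserting 4 into the
  permutations of 1, 2, 3. A tournament on four vertices without source and sink has out-degrees 1,
  1, 2, 2 and is unique up to relabelling, so the empty cut suffices.\<close>

lemma classifies_III:
  "classifies [1,2,3,4] [(1,2), (1,3), (1,4), (2,3), (2,4), (3,4)] []
     (concat (map (\<lambda>p. map (\<lambda>i. take i p @ [4] @ drop i p) [0,1,2,3]) (perms_of_three 1 2 3)))
     [[(1,2), (2,3), (3,1), (3,4), (4,1), (4,2)]]"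
  by code_simp

text \<open>The cut between \<open>{1, 2}\<close> and \<open>{3, 4}\<close> forces its two edges to
  point in opposite directions. The four permutations are those that preserve the graph.\<close>

lemma classifies_IV:
  "classifies [1,2,3,4] [(1,2), (1,2), (3,4), (3,4), (1,3), (2,4)] [1,2]
     [[1,2,3,4], [2,1,4,3], [3,4,1,2], [4,3,2,1]]
     (concat (map (\<lambda>b. map (arrows_IV b) [True, False]) [True, False]))"
  by code_simp

text \<open>The third target is \<open>network_V3\<close> with its two colour classes moved to the odd and the even
  vertices.\<close>

lemma classifies_V:
  "classifies [1,2,3,4,5,6] [(1,2), (2,3), (3,4), (4,5), (5,6), (6,1), (1,4), (2,5), (3,6)] []
     (concat (map (\<lambda>p. concat (map (\<lambda>q.
        [[p!0,q!0,p!1,q!1,p!2,q!2], [q!0,p!0,q!1,p!1,q!2,p!2]]) (perms_of_three 2 4 6))) (perms_of_three 1 3 5)))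
     [[(1,2), (2,3), (3,4), (4,5), (5,6), (6,1), (1,4), (2,5), (3,6)],
      [(1,2), (2,3), (3,4), (4,5), (5,6), (6,1), (1,4), (3,6), (5,2)],
      [(1,2), (3,2), (2,5), (5,4), (5,6), (4,1), (4,3), (6,1), (6,3)]]"
  by code_simp

text \<open>The cut between the triangles excludes that all three edges joining them point the same
  way. The twelve permutations are the symmetries of the prism: one permutation for both triangles,
  with or without exchanging them.\<close>

lemma classifies_VI:
  "classifies [1,2,3,4,5,6] [(1,2), (2,3), (3,1), (4,5), (5,6), (6,4), (1,4), (2,5), (3,6)] [1,2,3]
     (concat (map (\<lambda>p. [p @ map (\<lambda>i. i + 3) p, map (\<lambda>i. i + 3) p @ p]) (perms_of_three 1 2 3)))
     (concat (map (\<lambda>p. map (arrows_VI p) [0,1,2,3]) [0,1,2,3]))"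
  by code_simp

lemma network_V3_relabelled:
  "digraph_iso (digraph_of 6 [(1,2), (3,2), (2,5), (5,4), (5,6), (4,1), (4,3), (6,1), (6,3)]) network_V3"
  unfolding network_V3_def
proof (rule digraph_of_iso_relabelling[where p = "relabel [1,3,5,2,4,6]"])
  show "bij_betw (relabel [1,3,5,2,4,6]) {1..6} {1..6}"
    by (rule relabel_bij) auto
qed (auto simp: relabel_def)

section \<open>Isomorphisms between the networks of types IV and VI\<close>

lemma two_cycle_pairs_digraph_of:
  "two_cycle_pairs (digraph_of n arrs) =
     set (map (\<lambda>x. {fst x, snd x}) (filter (\<lambda>x. fst x \<noteq> snd x \<and> (snd x, fst x) \<in> set arrs) arrs))"
  unfolding two_cycle_pairs_def arcs_ends_digraph_of by force

lemma card_two_cycle_pairs_IV: "card (two_cycle_pairs (network_IV b c)) = of_bool b + of_bool c"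
proof -
  have ne: "{Suc 0, 2} \<noteq> {3, 4}" and comm: "{2, Suc 0} = {Suc 0, 2}" "{4, 3} = {3, 4::nat}"
    by (auto simp: set_eq_subset)
  show ?thesis
    unfolding network_IV_def two_cycle_pairs_digraph_of
    by (cases b; cases c) (simp_all add: comm ne)
qed

text \<open>Exchanging 1 with 4 and 2 with 3 exchanges the two single arrows and the two double
  edges.\<close>

lemma network_IV_swap: "digraph_iso (network_IV b c) (network_IV c b)"
  unfolding network_IV_def
proof (rule digraph_of_iso_relabelling[where p = "relabel [4,3,2,1]"])
  show "bij_betw (relabel [4,3,2,1]) {1..4} {1..4}"
    by (rule relabel_bij) auto
  show "mset (map (map_prod (relabel [4,3,2,1]) (relabel [4,3,2,1])) (arrows_IV c b)) = mset (arrows_IV b c)"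
    by (cases b; cases c) (simp_all add: relabel_def)
qed (auto split: if_splits)

lemma network_IV_iso_iff:
  "digraph_iso (network_IV b c) (network_IV b' c') \<longleftrightarrow>
     (of_bool b + of_bool c :: nat) = of_bool b' + of_bool c'"
proof
  assume "digraph_iso (network_IV b c) (network_IV b' c')"
  then show "(of_bool b + of_bool c :: nat) = of_bool b' + of_bool c'"
    using card_two_cycle_pairs_iso card_two_cycle_pairs_IV by metis
next
  assume "(of_bool b + of_bool c :: nat) = of_bool b' + of_bool c'"
  then have "b' = b \<and> c' = c \<or> b' = c \<and> c' = b"
    by (auto simp: of_bool_def split: if_splits)
  then show "digraph_iso (network_IV b c) (network_IV b' c')"
    using network_IV_swap digraph_iso_trans[OF network_IV_swap network_IV_swap] by blast
qed

lemma all_less_4: "(\<forall>i<4. P i) \<longleftrightarrow> P 0 \<and> P 1 \<and> P 2 \<and> P (3::nat)"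
  by (auto simp: less_Suc_eq numeral_eq_Suc)

text \<open>The triangle orientations are listed so that \<open>relabel_VI\<close> reverses both
  lists, whence the indices \<open>3 - p\<close> and \<open>3 - q\<close>.\<close>

lemma relabel_VI_arrows:
  "\<forall>p<4. \<forall>q<4. map_prod relabel_VI relabel_VI ` set (arrows_VI p q) = set (arrows_VI (3 - p) (3 - q))"
proof -
  have "\<forall>p\<in>set [0,1,2,3]. \<forall>q\<in>set [0,1,2,3].
      set (map (map_prod relabel_VI relabel_VI) (arrows_VI p q)) = set (arrows_VI (3 - p) (3 - q))"
    by code_simp
  then show ?thesis
    unfolding all_less_4 by simp
qed

text \<open>Without repeated arrows, equality of the sets of arrows becomes equality of
  multisets.\<close>

lemma arrows_VI_props:
  "\<forall>p<4. \<forall>q<4. distinct (arrows_VI p q) \<and> distinct (map (map_prod relabel_VI relabel_VI) (arrows_VI p q)) \<and>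
     (\<forall>x\<in>set (arrows_VI p q). fst x \<in> {1..6} \<and> snd x \<in> {1..6})"
proof -
  have "\<forall>p\<in>set [0,1,2,3]. \<forall>q\<in>set [0,1,2,3].
      distinct (arrows_VI p q) \<and> distinct (map (map_prod relabel_VI relabel_VI) (arrows_VI p q)) \<and>
      (\<forall>x\<in>set (arrows_VI p q). fst x \<in> {1..6} \<and> snd x \<in> {1..6})"
    by code_simp
  then show ?thesis
    unfolding all_less_4 by simp
qed

lemma network_VI_swap:
  assumes "p < 4" "q < 4"
  shows "digraph_iso (network_VI (3 - p) (3 - q)) (network_VI p q)"
  unfolding network_VI_def
proof (rule digraph_of_iso_relabelling[where p = relabel_VI])
  have "inj_on relabel_VI {1..6}" "relabel_VI ` {1..6} \<subseteq> {1..6}"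
    by (auto simp: inj_on_def relabel_VI_def)
  then show "bij_betw relabel_VI {1..6} {1..6}"
    by (simp add: bij_betw_def endo_inj_surj)
  have "3 - p < 4" "3 - q < 4"
    by simp_all
  then show "mset (map (map_prod relabel_VI relabel_VI) (arrows_VI p q)) = mset (arrows_VI (3 - p) (3 - q))"
    using arrows_VI_props relabel_VI_arrows assms
    by (subst set_eq_iff_mset_eq_distinct[symmetric]) (simp_all only: set_map)
  show "fst x \<in> {1..6} \<and> snd x \<in> {1..6}" if "x \<in> set (arrows_VI p q)" for x
    using arrows_VI_props assms that by blast
qed

text \<open>Walks of length 5 are the shortest ones for which this invariant separates the eight
  isomorphism classes.\<close>

lemma walk_square_sum_VI:
  "map (\<lambda>p. map (\<lambda>q. walk_square_sum (network_VI p q) 5) [0,1,2,3]) [0,1,2,3] =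
    [[180, 193, 173, 195], [191, 175, 200, 171], [171, 200, 175, 191], [195, 173, 193, 180]]"
proof -
  have "map (\<lambda>p. map (\<lambda>q. sum_list (map (\<lambda>v. (list_walk_count (arrows_VI p q) 5 v)\<^sup>2) [1..<Suc 6])) [0,1,2,3]) [0,1,2,3] =
    [[180, 193, 173, 195], [191, 175, 200, 171], [171, 200, 175, 191], [195, 173, 193, 180]]"
    by code_simp
  then show ?thesis
    unfolding network_VI_def walk_square_sum_digraph_of .
qed

text \<open>The table of invariants is unchanged when both indices are reversed, and apart from that
  its eight values are different.\<close>

lemma network_VI_iso_iff:
  assumes "p < 4" "q < 4" "p' < 4" "q' < 4"
  shows "digraph_iso (network_VI p q) (network_VI p' q') \<longleftrightarrow> (p', q') = (p, q) \<or> (p', q') = (3 - p, 3 - q)"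
proof
  assume "digraph_iso (network_VI p q) (network_VI p' q')"
  then have eq: "walk_square_sum (network_VI p q) 5 = walk_square_sum (network_VI p' q') 5"
    by (rule walk_square_sum_iso)
  have "\<forall>p<4. \<forall>q<4. \<forall>p'<4. \<forall>q'<4.
      walk_square_sum (network_VI p q) 5 = walk_square_sum (network_VI p' q') 5 \<longrightarrow>
      (p', q') = (p, q) \<or> (p', q') = (3 - p, 3 - q)"
    using walk_square_sum_VI unfolding all_less_4 by simp
  then show "(p', q') = (p, q) \<or> (p', q') = (3 - p, 3 - q)"
    using eq assms by blast
next
  have swap: "digraph_iso (network_VI p q) (network_VI (3 - p) (3 - q))"
    using network_VI_swap[of "3 - p" "3 - q"] assms by simp
  assume "(p', q') = (p, q) \<or> (p', q') = (3 - p, 3 - q)"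
  then show "digraph_iso (network_VI p q) (network_VI p' q')"
    using swap digraph_iso_trans[OF swap network_VI_swap[OF assms(1,2)]] by auto
qed

section \<open>Orientations of the graph of a group\<close>

lemma set_concat_map_map: "set (concat (map (\<lambda>x. map (g x) ys) xs)) = {g x y | x y. x \<in> set xs \<and> y \<in> set ys}"
  by auto

context simple_maximal_network begin

lemma recurrent_D: "recurrent D"
  unfolding recurrent_def
proof (intro conjI ballI)
  fix v assume "v \<in> verts D"
  then obtain a where "a \<in> arcs D" "tail D a = v"
    using vertex_is_tail by blast
  then have "(v, head D a) \<in> arcs_ends D"
    by (force simp: arcs_ends_def arc_to_ends_def)
  then show "\<exists>w. (v, w) \<in> arcs_ends D" ..
next
  fix x assume "x \<in> arcs_ends D"
  then obtain a where "a \<in> arcs D" "x = (tail D a, head D a)"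
    by (auto simp: arcs_ends_def arc_to_ends_def)
  then show "(snd x, fst x) \<in> (arcs_ends D)\<^sup>*"
    using arcs_on_closed_walks[of a] by simp
qed

text \<open>Isotropy planes are fixed spaces of subsets of the finite group, and arcs correspond to
  their orbits.\<close>

lemma finite_arcs_D: "finite (arcs D)"
proof -
  have "isotropy_planes G \<subseteq> Fix ` Pow G"
    by (auto simp: isotropy_planes_def isotropy_spaces_def isotropy_def)
  then have "finite (graph_lines G)"
    using fin unfolding graph_lines_def by (meson finite_Pow_iff finite_imageI finite_subset)
  then show ?thesis
    using bij_betw_finite[OF arcs_bij] by simp
qed

text \<open>Recurrence passes from the network to the isomorphic orientation of the prescribed
  graph, and there the evaluated classification applies.\<close>

lemma network_from_graph:
  assumes graph: "graph_isomorphic_to G n es"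
    and es: "\<And>x. x \<in> set es \<Longrightarrow> fst x \<in> {1..n} \<and> snd x \<in> {1..n} \<and> fst x \<noteq> snd x"
    and cl: "classifies vs es S ps ts" and vs: "set vs = {1..n}" "length vs = n"
  shows "\<exists>t\<in>set ts. digraph_iso D (digraph_of n t)"
proof -
  obtain \<phi> \<psi> where bij: "bij_betw \<phi> {1..n} (graph_vertices G)" "bij_betw \<psi> {..<length es} (graph_lines G)"
    and inc: "\<forall>v\<in>{1..n}. \<forall>i<length es. lies_on (\<phi> v) (\<psi> i) \<longleftrightarrow> v = fst (es ! i) \<or> v = snd (es ! i)"
    using graph unfolding graph_isomorphic_to_def by blast
  have "\<exists>os\<in>set (orientations es). digraph_iso D (digraph_of n os)"
    by (rule orientation_of_multigraph[OF wf_D verts_bij arcs_bij lies_on_iff bij _ es]) (use inc in auto)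
  then obtain os where os: "os \<in> set (orientations es)" "digraph_iso D (digraph_of n os)"
    by blast
  have "recurrent (digraph_of n os)"
    by (rule recurrent_iso[OF os(2) recurrent_D])
  then obtain t where "t \<in> set ts" "digraph_iso (digraph_of n os) (digraph_of n t)"
    using classifiesD[OF vs cl os(1)] by blast
  then show ?thesis
    using digraph_iso_trans[OF os(2)] by blast
qed

lemma two_orbit_network:
  assumes "card (graph_vertices G) = 2"
  shows "digraph_iso D network_two_orbits"
proof (rule two_vertex_network[OF wf_D _ finite_arcs_D degree_D recurrent_D])
  show "card (verts D) = 2"
    using bij_betw_same_card[OF verts_bij] assms by simp
qed

lemma type_III_network:
  assumes "graph_type_III G"
  shows "digraph_iso D network_III"
proof -
  have "\<exists>t\<in>set [[(1,2), (2,3), (3,1), (3,4), (4,1), (4,2)]]. digraph_iso D (digraph_of 4 t)"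
    by (rule network_from_graph[OF assms[unfolded graph_type_III_def] _ classifies_III]) auto
  then show ?thesis
    by (simp add: network_III_def)
qed

lemma type_IV_network:
  assumes "graph_type_IV G"
  shows "\<exists>b c. digraph_iso D (network_IV b c) \<and> card (two_cycle_pairs D) = of_bool b + of_bool c"
proof -
  have "\<exists>t\<in>set (concat (map (\<lambda>b. map (arrows_IV b) [True, False]) [True, False])). digraph_iso D (digraph_of 4 t)"
    by (rule network_from_graph[OF assms[unfolded graph_type_IV_def] _ classifies_IV]) auto
  then obtain b c where "digraph_iso D (digraph_of 4 (arrows_IV b c))"
    unfolding set_concat_map_map by blast
  then have iso: "digraph_iso D (network_IV b c)"
    by (simp only: network_IV_def)
  then have "card (two_cycle_pairs D) = of_bool b + of_bool c"
    using card_two_cycle_pairs_iso card_two_cycle_pairs_IV by metis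
  with iso show ?thesis
    by blast
qed

lemma type_V_network:
  assumes "graph_type_V G"
  shows "digraph_iso D network_V1 \<or> digraph_iso D network_V2 \<or> digraph_iso D network_V3"
proof -
  have "\<exists>t\<in>set [[(1,2), (2,3), (3,4), (4,5), (5,6), (6,1), (1,4), (2,5), (3,6)],
      [(1,2), (2,3), (3,4), (4,5), (5,6), (6,1), (1,4), (3,6), (5,2)],
      [(1,2), (3,2), (2,5), (5,4), (5,6), (4,1), (4,3), (6,1), (6,3)]]. digraph_iso D (digraph_of 6 t)"
    by (rule network_from_graph[OF assms[unfolded graph_type_V_def] _ classifies_V]) auto
  then show ?thesis
    unfolding network_V1_def network_V2_def
    using digraph_iso_trans[OF _ network_V3_relabelled] by auto
qed

lemma type_VI_network:
  assumes "graph_type_VI G"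
  shows "\<exists>p<4. \<exists>q<4. digraph_iso D (network_VI p q)"
proof -
  have "\<exists>t\<in>set (concat (map (\<lambda>p. map (arrows_VI p) [0,1,2,3]) [0,1,2,3])). digraph_iso D (digraph_of 6 t)"
    by (rule network_from_graph[OF assms[unfolded graph_type_VI_def] _ classifies_VI]) auto
  then obtain p q where pq: "p \<in> set [0,1,2,3]" "q \<in> set [0,1,2,3]" "digraph_iso D (digraph_of 6 (arrows_VI p q))"
    unfolding set_concat_map_map by blast
  have "p < 4" "q < 4"
    using pq(1,2) by auto
  then show ?thesis
    using pq(3) unfolding network_VI_def by blast
qed

end

theorem theorem3:
  fixes \<Gamma> :: "(real^4^4) set" and f :: "real^4 \<Rightarrow> real^4"
    and E :: "(real^4) set" and K :: "connection set"
  assumes "finite \<Gamma>" and "matrix_group \<Gamma>" and "\<Gamma> \<subseteq> SO4"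
    and "smooth f" and "equivariant \<Gamma> f"
    and "simple_network \<Gamma> f E K" and "maximal_network \<Gamma> f E K"
  defines "D \<equiv> network_digraph \<Gamma> E K"
  shows
    "(card (graph_vertices \<Gamma>) = 2 \<longrightarrow> digraph_iso D network_two_orbits) \<and>
     (graph_type_III \<Gamma> \<longrightarrow> digraph_iso D network_III) \<and>
     (graph_type_IV \<Gamma> \<longrightarrow>
        (\<exists>b c. digraph_iso D (network_IV b c) \<and>
           card (two_cycle_pairs D) = of_bool b + of_bool c) \<and>
        (\<forall>b c b' c'. digraph_iso (network_IV b c) (network_IV b' c') \<longleftrightarrow>
           (of_bool b + of_bool c :: nat) = of_bool b' + of_bool c')) \<and>
     (graph_type_V \<Gamma> \<longrightarrow>
        digraph_iso D network_V1 \<or> digraph_iso D network_V2 \<or>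
        (digraph_iso D network_V3 \<and>
           \<not> (\<exists>p. pre_digraph.cycle D p \<and> length p = 6) \<and>
           card (cycle_arc_sets D) = 4 \<and> (\<forall>C\<in>cycle_arc_sets D. card C = 4) \<and>
           \<Union>(cycle_arc_sets D) = arcs D)) \<and>
     (graph_type_VI \<Gamma> \<longrightarrow>
        (\<exists>p<4. \<exists>q<4. digraph_iso D (network_VI p q)) \<and>
        (\<forall>p<4. \<forall>q<4. map_prod relabel_VI relabel_VI ` set (arrows_VI p q)
           = set (arrows_VI (3 - p) (3 - q))) \<and>
        (\<forall>p<4. \<forall>q<4. \<forall>p'<4. \<forall>q'<4.
           digraph_iso (network_VI p q) (network_VI p' q') \<longleftrightarrow>
             (p', q') = (p, q) \<or> (p', q') = (3 - p, 3 - q)))"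
proof -
  interpret simple_maximal_network \<Gamma> f E K
    by unfold_locales (use assms(1-7) in auto)
  have I: "card (graph_vertices \<Gamma>) = 2 \<longrightarrow> digraph_iso D network_two_orbits"
    using two_orbit_network unfolding D_def by blast
  have III: "graph_type_III \<Gamma> \<longrightarrow> digraph_iso D network_III"
    using type_III_network unfolding D_def by blast
  have IV: "graph_type_IV \<Gamma> \<longrightarrow>
        (\<exists>b c. digraph_iso D (network_IV b c) \<and>
           card (two_cycle_pairs D) = of_bool b + of_bool c) \<and>
        (\<forall>b c b' c'. digraph_iso (network_IV b c) (network_IV b' c') \<longleftrightarrow>
           (of_bool b + of_bool c :: nat) = of_bool b' + of_bool c')"
    using type_IV_network network_IV_iso_iff unfolding D_def by (intro impI conjI allI)
  have V: "graph_type_V \<Gamma> \<longrightarrow>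
        digraph_iso D network_V1 \<or> digraph_iso D network_V2 \<or>
        (digraph_iso D network_V3 \<and>
           \<not> (\<exists>p. pre_digraph.cycle D p \<and> length p = 6) \<and>
           card (cycle_arc_sets D) = 4 \<and> (\<forall>C\<in>cycle_arc_sets D. card C = 4) \<and>
           \<Union>(cycle_arc_sets D) = arcs D)"
    (is "_ \<longrightarrow> ?V1 \<or> ?V2 \<or> ?V3")
  proof
    assume "graph_type_V \<Gamma>"
    then have "?V1 \<or> ?V2 \<or> digraph_iso D network_V3"
      unfolding D_def by (rule type_V_network)
    then show "?V1 \<or> ?V2 \<or> ?V3"
    proof (elim disjE)
      assume iso: "digraph_iso D network_V3"
      show "?V1 \<or> ?V2 \<or> ?V3"
        by (intro disjI2 conjI iso cycles_of_iso_V3[OF iso])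
    qed (rule disjI1, assumption, rule disjI2, rule disjI1, assumption)
  qed
  have VI: "graph_type_VI \<Gamma> \<longrightarrow>
        (\<exists>p<4. \<exists>q<4. digraph_iso D (network_VI p q)) \<and>
        (\<forall>p<4. \<forall>q<4. map_prod relabel_VI relabel_VI ` set (arrows_VI p q)
           = set (arrows_VI (3 - p) (3 - q))) \<and>
        (\<forall>p<4. \<forall>q<4. \<forall>p'<4. \<forall>q'<4.
           digraph_iso (network_VI p q) (network_VI p' q') \<longleftrightarrow>
             (p', q') = (p, q) \<or> (p', q') = (3 - p, 3 - q))"
  proof (intro impI conjI)
    show "\<exists>p<4. \<exists>q<4. digraph_iso D (network_VI p q)" if "graph_type_VI \<Gamma>"
      using type_VI_network[OF that] unfolding D_def .
    show "\<forall>p<4. \<forall>q<4. \<forall>p'<4. \<forall>q'<4. digraph_iso (network_VI p q) (network_VI p' q') \<longleftrightarrow>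
        (p', q') = (p, q) \<or> (p', q') = (3 - p, 3 - q)"
      by (intro allI impI network_VI_iso_iff)
  qed (rule relabel_VI_arrows)
  show ?thesis
    by (intro conjI I III IV V VI)
qed

end
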